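(* Let $\phi:G\times Q\to Q$ be an action of a Lie group $G$ on a manifold $Q$ and let $A:G\to\Omega^1(Q)$ be a map (smooth in the sense that $(g,q)\mapsto A(g)(q)$ is a smooth map $G\times Q\to T^*Q$). Let $\Phi^A:G\times T^*Q\to T^*Q$ be the map given by $\Phi^A_g=(T^*\phi)_g\circ t_{A(g)}$. Then: (1) $\Phi^A$ is an action if and only if $A$ is a one-cocycle in the cohomology complex $(C^\bullet(G,\Omega^1(Q)),\delta_\phi)$. (2) In that case, $\Phi^A$ is also symplectic with respect to $\omega_Q$ if and only if $A(g)$ is a closed $1$-form on $Q$ for all $g\in G$, i.e. $A$ is a one-cocycle in the subcomplex $(C^\bullet(G,\Omega^1_c(Q)),\delta_\phi)$.
   Context: $\omega_Q=-d\theta_Q$ is the canonical symplectic form on $T^*Q$, with $\theta_Q$ the Liouville $1$-form. Actions are smooth left actions; an action $\Phi$ on $T^*Q$ is symplectic if $\Phi_g^*\omega_Q=\omega_Q$ for all $g$. The cotangent lift of $\phi$ is $(T^*\phi)_g(\alpha_q)=\alpha_q\circ T_{\phi_g(q)}\phi_{g^{-1}}\in T^*_{\phi_g(q)}Q$ for $\alpha_q\in T^*_qQ$. For a $1$-form $\alpha$ on $Q$, $t_\alpha(\gamma_q)=\gamma_q+\alpha(q)$. $\Omega^1(Q)$ is the space of $1$-forms on $Q$ and $\Omega^1_c(Q)$ the subspace of closed ones. The complex: $C^n(G,\Omega^1(Q))$ is the set of $n$-cochains, i.e. maps $A:G\times\overset{n}{\cdots}\times G\to\Omega^1(Q)$ (with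 $C^0=\Omega^1(Q)$), and the coboundary operator $\delta_\phi:C^n(G,\Omega^1(Q))\to C^{n+1}(G,\Omega^1(Q))$ is $$(\delta_\phi A)(g_1,\dots,g_{n+1})=(-1)^{n+1}A(g_2,\dots,g_{n+1})+\sum_{i=1}^n(-1)^{n+i+1}A(g_1,\dots,g_{i-1},g_ig_{i+1},\dots,g_{n+1})+\phi_{g_{n+1}}^*(A(g_1,\dots,g_n)).$$ Cochains with values in $\Omega^1_c(Q)$ form a subcomplex $C^\bullet(G,\Omega^1_c(Q))$. A one-cocycle is a $1$-cochain $A$ with $\delta_\phi A=0$. *)

theory Defs
  imports "HOL-Analysis.Analysis" "HOL-Algebra.Group_Action"
begin

section \<open>Smooth maps between open subsets of normed spaces\<close>

text \<open>Meant for open \<open>S\<close> in a finite-dimensional space, where asking for all iterated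
  directional derivatives to be Frechet differentiable is the usual \<open>C\<^sup>n\<close> condition.\<close>

primrec Cn_on :: "nat \<Rightarrow> 'a::real_normed_vector set \<Rightarrow> ('a \<Rightarrow> 'b::real_normed_vector) \<Rightarrow> bool" where
  "Cn_on 0 S f \<longleftrightarrow> continuous_on S f"
| "Cn_on (Suc n) S f \<longleftrightarrow> (\<forall>x\<in>S. f differentiable (at x)) \<and>
     (\<forall>v. Cn_on n S (\<lambda>x. frechet_derivative f (at x) v))"

definition smooth_on :: "'a::real_normed_vector set \<Rightarrow> ('a \<Rightarrow> 'b::real_normed_vector) \<Rightarrow> bool" where
  "smooth_on S f \<longleftrightarrow> (\<forall>n. Cn_on n S f)"


section \<open>Manifolds and smooth maps\<close>

text \<open>A manifold is given by a smooth atlas (not required to be maximal) on the set of its points;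
  the topology is the one making the charts homeomorphisms onto open sets. The model space is a
  finite-dimensional normed space rather than a \<open>euclidean_space\<close>, since that class has no
  zero-dimensional instance and discrete groups are Lie groups.\<close>

type_synonym ('a, 'e) chart = "'a set \<times> ('a \<Rightarrow> 'e)"
type_synonym ('a, 'e) atlas = "('a, 'e) chart set"

definition pts :: "('a, 'e) atlas \<Rightarrow> 'a set" where
  "pts M = (\<Union>c\<in>M. fst c)"

definition charts_at :: "('a, 'e) atlas \<Rightarrow> 'a \<Rightarrow> ('a, 'e) chart set" where
  "charts_at M p = {c \<in> M. p \<in> fst c}"

definition chart_inv :: "('a, 'e) chart \<Rightarrow> 'e \<Rightarrow> 'a" where
  "chart_inv c = inv_into (fst c) (snd c)"

definition atlas_topology :: "('a, 'e::real_normed_vector) atlas \<Rightarrow> 'a topology" where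
  "atlas_topology M = topology (\<lambda>W. W \<subseteq> pts M \<and> (\<forall>c\<in>M. open (snd c ` (W \<inter> fst c))))"

definition manifold :: "('a, 'e::real_normed_vector) atlas \<Rightarrow> bool" where
  "manifold M \<longleftrightarrow>
     (\<exists>B::'e set. finite B \<and> span B = UNIV) \<and>
     (\<forall>c\<in>M. inj_on (snd c) (fst c) \<and> open (snd c ` fst c)) \<and>
     (\<forall>c\<in>M. \<forall>d\<in>M. open (snd c ` (fst c \<inter> fst d)) \<and>
        smooth_on (snd c ` (fst c \<inter> fst d)) (snd d \<circ> chart_inv c)) \<and>
     Hausdorff_space (atlas_topology M) \<and> second_countable (atlas_topology M)"

text \<open>Openness of the domains of the local representatives is continuity of \<open>f\<close>.\<close>

definition smooth_map ::
  "('a, 'e::real_normed_vector) atlas \<Rightarrow> ('b, 'f::real_normed_vector) atlas \<Rightarrow> ('a \<Rightarrow> 'b) \<Rightarrow> bool" where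
  "smooth_map M N f \<longleftrightarrow> f ` pts M \<subseteq> pts N \<and>
     (\<forall>c\<in>M. \<forall>d\<in>N. open (snd c ` (fst c \<inter> f -` fst d)) \<and>
        smooth_on (snd c ` (fst c \<inter> f -` fst d)) (snd d \<circ> f \<circ> chart_inv c))"

definition product_atlas :: "('a, 'e) atlas \<Rightarrow> ('b, 'f) atlas \<Rightarrow> ('a \<times> 'b, 'e \<times> 'f) atlas" where
  "product_atlas M N = {(fst c \<times> fst d, map_prod (snd c) (snd d)) | c d. c \<in> M \<and> d \<in> N}"


section \<open>Tangent and cotangent spaces\<close>

text \<open>A tangent vector at \<open>p\<close> is the family of its representatives in the charts at \<open>p\<close>, related
  by the derivatives of the chart changes, and \<open>0\<close> at every other index. Covectors are linear
  functionals on the tangent space, extended by \<open>0\<close> so that equality and addition are those of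
  functions.\<close>

type_synonym ('a, 'e) tvec = "('a, 'e) chart \<Rightarrow> 'e"
type_synonym ('a, 'e) covec = "('a, 'e) tvec \<Rightarrow> real"

definition tangent_space :: "('a, 'e::real_normed_vector) atlas \<Rightarrow> 'a \<Rightarrow> ('a, 'e) tvec set" where
  "tangent_space M p = {v.
     (\<forall>c\<in>charts_at M p. \<forall>d\<in>charts_at M p.
        v d = frechet_derivative (snd d \<circ> chart_inv c) (at (snd c p)) (v c)) \<and>
     (\<forall>c. c \<notin> charts_at M p \<longrightarrow> v c = 0)}"

definition tangent_of_chart ::
  "('a, 'e::real_normed_vector) atlas \<Rightarrow> ('a, 'e) chart \<Rightarrow> 'a \<Rightarrow> 'e \<Rightarrow> ('a, 'e) tvec" where
  "tangent_of_chart M c p w = (\<lambda>d. if d \<in> charts_at M p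
     then frechet_derivative (snd d \<circ> chart_inv c) (at (snd c p)) w else 0)"

definition some_chart :: "('a, 'e) atlas \<Rightarrow> 'a \<Rightarrow> ('a, 'e) chart" where
  "some_chart M p = (SOME c. c \<in> charts_at M p)"

text \<open>The tangent map \<open>T\<^sub>p f\<close>; for smooth \<open>f\<close> and tangent \<open>v\<close> the choice of the chart at \<open>p\<close>
  is immaterial.\<close>

definition tangent_map ::
  "('a, 'e::real_normed_vector) atlas \<Rightarrow> ('b, 'f::real_normed_vector) atlas \<Rightarrow> ('a \<Rightarrow> 'b) \<Rightarrow>
   'a \<Rightarrow> ('a, 'e) tvec \<Rightarrow> ('b, 'f) tvec" where
  "tangent_map M N f p v = (\<lambda>d. if d \<in> charts_at N (f p)
     then (let c = some_chart M p in
       frechet_derivative (snd d \<circ> f \<circ> chart_inv c) (at (snd c p)) (v c)) else 0)"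

definition cotangent_space :: "('a, 'e::real_normed_vector) atlas \<Rightarrow> 'a \<Rightarrow> ('a, 'e) covec set" where
  "cotangent_space M p = {\<alpha>.
     (\<forall>u\<in>tangent_space M p. \<forall>v\<in>tangent_space M p. \<alpha> (\<lambda>c. u c + v c) = \<alpha> u + \<alpha> v) \<and>
     (\<forall>r. \<forall>v\<in>tangent_space M p. \<alpha> (\<lambda>c. r *\<^sub>R v c) = r * \<alpha> v) \<and>
     (\<forall>v. v \<notin> tangent_space M p \<longrightarrow> \<alpha> v = 0)}"

text \<open>The cotangent bundle, with points \<open>(q, \<alpha>)\<close> where \<open>\<alpha> \<in> T\<^sub>q\<^sup>*M\<close>, and the charts
  \<open>(q, \<alpha>) \<mapsto> (c q, \<alpha> \<circ> (T\<^sub>q c)\<^sup>-\<^sup>1)\<close> induced by the charts \<open>c\<close> of \<open>M\<close>.\<close>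

definition cotangent_chart ::
  "('a, 'e::real_normed_vector) atlas \<Rightarrow> ('a, 'e) chart \<Rightarrow>
   ('a \<times> ('a, 'e) covec, 'e \<times> ('e \<Rightarrow>\<^sub>L real)) chart" where
  "cotangent_chart M c =
     (Sigma (fst c) (cotangent_space M),
      \<lambda>(q, \<alpha>). (snd c q, Blinfun (\<lambda>w. \<alpha> (tangent_of_chart M c q w))))"

definition cotangent_bundle ::
  "('a, 'e::real_normed_vector) atlas \<Rightarrow> ('a \<times> ('a, 'e) covec, 'e \<times> ('e \<Rightarrow>\<^sub>L real)) atlas" where
  "cotangent_bundle M = cotangent_chart M ` M"

lemma pts_cotangent_bundle: "pts (cotangent_bundle M) = Sigma (pts M) (cotangent_space M)"
  by (auto simp: pts_def cotangent_bundle_def cotangent_chart_def)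


section \<open>Differential forms\<close>

text \<open>Forms vanish, by convention, off the manifold and off its tangent spaces.\<close>

type_synonym ('a, 'e) form1 = "'a \<Rightarrow> ('a, 'e) tvec \<Rightarrow> real"
type_synonym ('a, 'e) form2 = "'a \<Rightarrow> ('a, 'e) tvec \<Rightarrow> ('a, 'e) tvec \<Rightarrow> real"

definition one_forms :: "('a, 'e::real_normed_vector) atlas \<Rightarrow> ('a, 'e) form1 set" where
  "one_forms M = {\<alpha>. (\<forall>p\<in>pts M. \<alpha> p \<in> cotangent_space M p) \<and>
     (\<forall>p. p \<notin> pts M \<longrightarrow> \<alpha> p = (\<lambda>_. 0)) \<and>
     smooth_map M (cotangent_bundle M) (\<lambda>p. (p, \<alpha> p))}"

text \<open>\<open>d\<alpha>(u, v) = u(\<alpha>(v)) - v(\<alpha>(u))\<close>, where \<open>u\<close> and \<open>v\<close> are extended to vector fields that are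
  constant in a chart at \<open>p\<close>; for smooth \<open>\<alpha>\<close> the result does not depend on that chart.\<close>

definition ext_deriv :: "('a, 'e::real_normed_vector) atlas \<Rightarrow> ('a, 'e) form1 \<Rightarrow> ('a, 'e) form2" where
  "ext_deriv M \<alpha> = (\<lambda>p u v.
     if p \<in> pts M \<and> u \<in> tangent_space M p \<and> v \<in> tangent_space M p then
       (let c = some_chart M p;
            \<alpha>c = (\<lambda>w x. \<alpha> (chart_inv c x) (tangent_of_chart M c (chart_inv c x) w))
        in frechet_derivative (\<alpha>c (v c)) (at (snd c p)) (u c)
         - frechet_derivative (\<alpha>c (u c)) (at (snd c p)) (v c))
     else 0)"

definition closed_form :: "('a, 'e::real_normed_vector) atlas \<Rightarrow> ('a, 'e) form1 \<Rightarrow> bool" where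
  "closed_form M \<alpha> \<longleftrightarrow> ext_deriv M \<alpha> = (\<lambda>p u v. 0)"

definition closed_one_forms :: "('a, 'e::real_normed_vector) atlas \<Rightarrow> ('a, 'e) form1 set" where
  "closed_one_forms M = {\<alpha> \<in> one_forms M. closed_form M \<alpha>}"

definition pullback1 ::
  "('a, 'e::real_normed_vector) atlas \<Rightarrow> ('b, 'f::real_normed_vector) atlas \<Rightarrow> ('a \<Rightarrow> 'b) \<Rightarrow>
   ('b, 'f) form1 \<Rightarrow> ('a, 'e) form1" where
  "pullback1 M N f \<beta> = (\<lambda>p v. if p \<in> pts M \<and> v \<in> tangent_space M p
     then \<beta> (f p) (tangent_map M N f p v) else 0)"

definition pullback2 ::
  "('a, 'e::real_normed_vector) atlas \<Rightarrow> ('b, 'f::real_normed_vector) atlas \<Rightarrow> ('a \<Rightarrow> 'b) \<Rightarrow>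
   ('b, 'f) form2 \<Rightarrow> ('a, 'e) form2" where
  "pullback2 M N f \<beta> = (\<lambda>p u v.
     if p \<in> pts M \<and> u \<in> tangent_space M p \<and> v \<in> tangent_space M p
     then \<beta> (f p) (tangent_map M N f p u) (tangent_map M N f p v) else 0)"

definition liouville_form ::
  "('q, 'e::real_normed_vector) atlas \<Rightarrow>
   ('q \<times> ('q, 'e) covec, 'e \<times> ('e \<Rightarrow>\<^sub>L real)) form1" where
  "liouville_form Q = (\<lambda>x V.
     if x \<in> pts (cotangent_bundle Q) \<and> V \<in> tangent_space (cotangent_bundle Q) x
     then snd x (tangent_map (cotangent_bundle Q) Q fst x V) else 0)"

definition canonical_symplectic_form ::
  "('q, 'e::real_normed_vector) atlas \<Rightarrow>
   ('q \<times> ('q, 'e) covec, 'e \<times> ('e \<Rightarrow>\<^sub>L real)) form2" where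
  "canonical_symplectic_form Q =
     (\<lambda>x u v. - ext_deriv (cotangent_bundle Q) (liouville_form Q) x u v)"


section \<open>Lie groups and smooth actions\<close>

definition lie_group :: "('g, 'm) monoid_scheme \<Rightarrow> ('g, 'h::real_normed_vector) atlas \<Rightarrow> bool" where
  "lie_group G GA \<longleftrightarrow> group G \<and> manifold GA \<and> pts GA = carrier G \<and>
     smooth_map (product_atlas GA GA) GA (\<lambda>(g, h). g \<otimes>\<^bsub>G\<^esub> h) \<and>
     smooth_map GA GA (\<lambda>g. inv\<^bsub>G\<^esub> g)"

text \<open>Note that \<open>group_action\<close> requires each \<open>\<Phi> g\<close> to be \<open>undefined\<close> outside of \<open>pts M\<close>.\<close>

definition smooth_action ::
  "('g, 'm) monoid_scheme \<Rightarrow> ('g, 'h::real_normed_vector) atlas \<Rightarrow>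
   ('a, 'e::real_normed_vector) atlas \<Rightarrow> ('g \<Rightarrow> 'a \<Rightarrow> 'a) \<Rightarrow> bool" where
  "smooth_action G GA M \<Phi> \<longleftrightarrow> group_action G (pts M) \<Phi> \<and>
     smooth_map (product_atlas GA M) M (\<lambda>(g, x). \<Phi> g x)"

definition symplectic_action ::
  "('g, 'm) monoid_scheme \<Rightarrow> ('q, 'e::real_normed_vector) atlas \<Rightarrow>
   ('g \<Rightarrow> 'q \<times> ('q, 'e) covec \<Rightarrow> 'q \<times> ('q, 'e) covec) \<Rightarrow> bool" where
  "symplectic_action G Q \<Phi> \<longleftrightarrow> (\<forall>g\<in>carrier G.
     pullback2 (cotangent_bundle Q) (cotangent_bundle Q) (\<Phi> g) (canonical_symplectic_form Q)
       = canonical_symplectic_form Q)"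

definition cotangent_lift ::
  "('g, 'm) monoid_scheme \<Rightarrow> ('q, 'e::real_normed_vector) atlas \<Rightarrow> ('g \<Rightarrow> 'q \<Rightarrow> 'q) \<Rightarrow> 'g \<Rightarrow>
   'q \<times> ('q, 'e) covec \<Rightarrow> 'q \<times> ('q, 'e) covec" where
  "cotangent_lift G Q \<phi> g = (\<lambda>(q, \<alpha>).
     (\<phi> g q, \<lambda>w. if w \<in> tangent_space Q (\<phi> g q)
        then \<alpha> (tangent_map Q Q (\<phi> (inv\<^bsub>G\<^esub> g)) (\<phi> g q) w) else 0))"

definition translation ::
  "('q, 'e) form1 \<Rightarrow> 'q \<times> ('q, 'e) covec \<Rightarrow> 'q \<times> ('q, 'e) covec" where
  "translation \<alpha> = (\<lambda>(q, \<gamma>). (q, \<lambda>v. \<gamma> v + \<alpha> q v))"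

definition twisted_lift ::
  "('g, 'm) monoid_scheme \<Rightarrow> ('q, 'e::real_normed_vector) atlas \<Rightarrow> ('g \<Rightarrow> 'q \<Rightarrow> 'q) \<Rightarrow>
   ('g \<Rightarrow> ('q, 'e) form1) \<Rightarrow> 'g \<Rightarrow> 'q \<times> ('q, 'e) covec \<Rightarrow> 'q \<times> ('q, 'e) covec" where
  "twisted_lift G Q \<phi> A g =
     compose (pts (cotangent_bundle Q)) (cotangent_lift G Q \<phi> g) (translation (A g))"


section \<open>The cochain complex\<close>

text \<open>An \<open>n\<close>-cochain is a function of lists, considered on \<open>tuples G n\<close> only; \<open>F\<close> is the space
  of coefficients, all one-forms or the closed ones. No continuity in the group variables is
  required. In \<open>coboundary\<close>, \<open>A\<close> has degree \<open>n\<close> and \<open>gs\<close> has length \<open>n + 1\<close>; list indices start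
  at \<open>0\<close>.\<close>

definition tuples :: "('g, 'm) monoid_scheme \<Rightarrow> nat \<Rightarrow> 'g list set" where
  "tuples G n = {gs. length gs = n \<and> set gs \<subseteq> carrier G}"

definition cochains ::
  "('g, 'm) monoid_scheme \<Rightarrow> ('q, 'e) form1 set \<Rightarrow> nat \<Rightarrow> ('g list \<Rightarrow> ('q, 'e) form1) set" where
  "cochains G F n = {A. \<forall>gs\<in>tuples G n. A gs \<in> F}"

definition coboundary ::
  "('g, 'm) monoid_scheme \<Rightarrow> ('q, 'e::real_normed_vector) atlas \<Rightarrow> ('g \<Rightarrow> 'q \<Rightarrow> 'q) \<Rightarrow> nat \<Rightarrow>
   ('g list \<Rightarrow> ('q, 'e) form1) \<Rightarrow> 'g list \<Rightarrow> ('q, 'e) form1" where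
  "coboundary G Q \<phi> n A gs = (\<lambda>q v.
     (-1) ^ (n + 1) * A (tl gs) q v
     + (\<Sum>i=1..n. (-1) ^ (n + i + 1) *
          A (take (i - 1) gs @ [gs ! (i - 1) \<otimes>\<^bsub>G\<^esub> gs ! i] @ drop (i + 1) gs) q v)
     + pullback1 Q Q (\<phi> (last gs)) (A (butlast gs)) q v)"

definition cocycle ::
  "('g, 'm) monoid_scheme \<Rightarrow> ('q, 'e::real_normed_vector) atlas \<Rightarrow> ('g \<Rightarrow> 'q \<Rightarrow> 'q) \<Rightarrow>
   ('q, 'e) form1 set \<Rightarrow> nat \<Rightarrow> ('g list \<Rightarrow> ('q, 'e) form1) \<Rightarrow> bool" where
  "cocycle G Q \<phi> F n A \<longleftrightarrow> A \<in> cochains G F n \<and>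
     (\<forall>gs\<in>tuples G (n + 1). coboundary G Q \<phi> n A gs = (\<lambda>q v. 0))"

definition one_cocycle ::
  "('g, 'm) monoid_scheme \<Rightarrow> ('q, 'e::real_normed_vector) atlas \<Rightarrow> ('g \<Rightarrow> 'q \<Rightarrow> 'q) \<Rightarrow>
   ('q, 'e) form1 set \<Rightarrow> ('g \<Rightarrow> ('q, 'e) form1) \<Rightarrow> bool" where
  "one_cocycle G Q \<phi> F A \<longleftrightarrow> cocycle G Q \<phi> F 1 (\<lambda>gs. A (hd gs))"

end

theory Submission
  imports Defs
begin

text \<open>
  The composition law \<open>\<Phi>\<^bsub>gh\<^esub> = \<Phi>\<^bsub>g\<^esub> \<circ> \<Phi>\<^bsub>h\<^esub>\<close> over a point \<open>q\<close>, evaluated on the images of tangent vectors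
  at \<open>q\<close>, says exactly \<open>A(gh) = A(h) + \<phi>\<^sub>h\<^sup>* A(g)\<close> at \<open>q\<close>. The map \<open>\<Phi>\<close> is always smooth: in charts it involves
  only \<open>\<phi>\<close>, \<open>A\<close> and a partial derivative of the smooth map \<open>(g, q) \<mapsto> \<phi>(g\<^sup>-\<^sup>1, q)\<close>. Finally
  \<open>\<Phi>\<^sub>g\<^sup>* \<theta> = \<theta> + \<pi>\<^sup>* A(g)\<close> for the Liouville form \<open>\<theta>\<close> and the bundle projection \<open>\<pi>\<close>. Since \<open>d\<close> commutes with
  pullbacks, \<open>\<Phi>\<^sub>g\<^sup>* \<omega> - \<omega> = - \<pi>\<^sup>* dA(g)\<close>, which vanishes iff \<open>dA(g) = 0\<close> because \<open>\<pi>\<close> is a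
  surjective submersion.
\<close>

section \<open>Finite-dimensional normed spaces\<close>

text \<open>The model space is only known to have a finite spanning set, so coordinates have to be
  built: completeness of finite spans yields a dual basis of bounded functionals. It makes the
  directional derivatives in \<open>Cn_on\<close> compose, because the chain rule differentiates the
  outer map in a moving direction, which the dual basis rewrites as a combination of fixed ones. It
  also makes covectors bounded in a chart, so that \<open>Blinfun\<close> in
  \<open>cotangent_chart\<close> is meaningful. Chart changes are treated as local representatives
  of \<open>id\<close>. The chain rule for smooth maps then covers the compatibility of tangent
  components and the independence of \<open>tangent_map\<close> from the chosen chart. Inverse
  Jacobians, both in cotangent chart changes and in the cotangent lift, are taken as derivatives of
  the inverse maps. Their smoothness is therefore that of a known map, and no linear map has to be
  inverted. That d commutes with pullbacks rests on the symmetry of second derivatives. For this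
  step forms enter only through differentiable coefficients, so that the Liouville form, which is p
  dq in charts, and an arbitrary one-form can be treated alike.\<close>

definition finite_dim :: "'e::real_normed_vector itself \<Rightarrow> bool" where
  "finite_dim _ \<longleftrightarrow> (\<exists>B::'e set. finite B \<and> span B = UNIV)"

text \<open>For nonzero \<open>c\<close> the vector \<open>- (1 / c) y\<close> lies in
  \<open>S\<close>, so its distance to \<open>b\<close> is at least \<open>infdist b S\<close>;
  multiply by \<open>\<bar>c\<bar>\<close>. The estimate bounds the coordinate along
  \<open>b\<close> by the norm of the whole vector.\<close>

lemma infdist_mult_le_norm:
  fixes b :: "'e::real_normed_vector"
  assumes "subspace S" "y \<in> S"
  shows "\<bar>c\<bar> * infdist b S \<le> norm (c *\<^sub>R b + y)"
proof (cases "c = 0")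
  case False
  have "infdist b S \<le> dist b (- ((1 / c) *\<^sub>R y))"
    using assms by (intro infdist_le subspace_neg subspace_scale)
  then have "\<bar>c\<bar> * infdist b S \<le> \<bar>c\<bar> * norm (b + (1 / c) *\<^sub>R y)"
    by (simp add: dist_norm mult_left_mono)
  also have "\<dots> = norm (c *\<^sub>R (b + (1 / c) *\<^sub>R y))"
    by simp
  also have "\<dots> = norm (c *\<^sub>R b + y)"
    using False by (simp add: scaleR_right_distrib)
  finally show ?thesis .
qed simp

lemma infdist_span_pos:
  fixes b :: "'e::real_normed_vector"
  assumes "closed (span B)" "b \<notin> span B"
  shows "infdist b (span B) > 0"
proof -
  have "infdist b (span B) \<noteq> 0"
    using assms in_closed_iff_infdist_zero[OF assms(1), of b] span_zero[of B] by blast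
  then show ?thesis
    using infdist_nonneg[of b "span B"] by linarith
qed

text \<open>Adding \<open>b\<close> outside a closed span, the coordinates \<open>c n\<close> along
  \<open>b\<close> of a Cauchy sequence are Cauchy, since they are controlled by the positive
  distance \<open>d\<close>. The remainders \<open>Y n\<close> are then Cauchy in the smaller span,
  which is complete by induction.\<close>

lemma complete_span_finite:
  fixes B :: "'e::real_normed_vector set"
  assumes "finite B"
  shows "complete (span B)"
  using assms
proof (induction B rule: finite_induct)
  case (insert b B)
  show ?case
  proof (cases "b \<in> span B")
    case True
    then show ?thesis using insert.IH by (simp add: span_redundant)
  next
    case False
    define d where "d = infdist b (span B)"
    have d: "d > 0"
      unfolding d_def using insert False by (intro infdist_span_pos complete_imp_closed)
    show ?thesis
    proof (rule completeI)
      fix X assume X: "\<forall>n. X n \<in> span (insert b B)" "Cauchy X"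
      have "\<exists>c. X n - c *\<^sub>R b \<in> span B" for n
        using X(1) unfolding span_insert by blast
      then obtain c where c: "\<And>n. X n - c n *\<^sub>R b \<in> span B"
        by metis
      define Y where "Y n = X n - c n *\<^sub>R b" for n
      have est: "\<bar>c m - c n\<bar> * d \<le> dist (X m) (X n)" for m n
      proof -
        have "X m - X n = (c m - c n) *\<^sub>R b + (Y m - Y n)"
          by (simp add: Y_def algebra_simps)
        moreover have "Y m - Y n \<in> span B"
          using c by (simp add: Y_def span_diff)
        ultimately show ?thesis
          unfolding d_def dist_norm
          using infdist_mult_le_norm[of "span B" "Y m - Y n" "c m - c n" b] by simp
      qed
      have "Cauchy c"
      proof (rule metric_CauchyI)
        fix e :: real assume "e > 0"
        then obtain N where N: "\<And>m n. m \<ge> N \<Longrightarrow> n \<ge> N \<Longrightarrow> dist (X m) (X n) < e * d"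
          using metric_CauchyD[OF X(2), of "e * d"] d by auto
        have "dist (c m) (c n) < e" if "m \<ge> N" "n \<ge> N" for m n
          using le_less_trans[OF est N[OF that]] d by (simp add: dist_real_def)
        then show "\<exists>M. \<forall>m\<ge>M. \<forall>n\<ge>M. dist (c m) (c n) < e" by blast
      qed
      then obtain c0 where c0: "c \<longlonglongrightarrow> c0"
        using Cauchy_convergent convergent_def by blast
      have "Cauchy Y"
      proof (rule metric_CauchyI)
        fix e :: real assume e: "e > 0"
        have "Cauchy (\<lambda>n. c n *\<^sub>R b)"
          using c0 by (intro LIMSEQ_imp_Cauchy[of _ "c0 *\<^sub>R b"] tendsto_intros)
        then obtain N where N: "\<And>m n. m \<ge> N \<Longrightarrow> n \<ge> N \<Longrightarrow> dist (c m *\<^sub>R b) (c n *\<^sub>R b) < e / 2"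
          using metric_CauchyD[of _ "e / 2"] e by fastforce
        obtain N' where N': "\<And>m n. m \<ge> N' \<Longrightarrow> n \<ge> N' \<Longrightarrow> dist (X m) (X n) < e / 2"
          using metric_CauchyD[OF X(2), of "e / 2"] e by auto
        have "dist (Y m) (Y n) < e" if "m \<ge> max N N'" "n \<ge> max N N'" for m n
        proof -
          have "dist (Y m) (Y n) = norm ((X m - X n) - (c m *\<^sub>R b - c n *\<^sub>R b))"
            by (simp add: Y_def dist_norm algebra_simps)
          also have "\<dots> \<le> dist (X m) (X n) + dist (c m *\<^sub>R b) (c n *\<^sub>R b)"
            unfolding dist_norm by (rule norm_triangle_ineq4)
          finally show ?thesis using N[of m n] N'[of m n] that by simp
        qed
        then show "\<exists>M. \<forall>m\<ge>M. \<forall>n\<ge>M. dist (Y m) (Y n) < e" by blast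
      qed
      then obtain y where y: "y \<in> span B" "Y \<longlonglongrightarrow> y"
        using insert.IH[unfolded complete_def, rule_format, of Y] c by (auto simp: Y_def)
      have "(\<lambda>n. Y n + c n *\<^sub>R b) \<longlonglongrightarrow> y + c0 *\<^sub>R b"
        by (intro tendsto_add tendsto_scaleR tendsto_const y c0)
      then have "X \<longlonglongrightarrow> y + c0 *\<^sub>R b"
        by (simp add: Y_def)
      moreover have "y + c0 *\<^sub>R b \<in> span (insert b B)"
        using y(1) span_mono[of B "insert b B"] by (intro span_add span_scale) (auto intro: span_base)
      ultimately show "\<exists>l\<in>span (insert b B). X \<longlonglongrightarrow> l" by (rule bexI)
    qed
  qed
qed (simp add: compact_imp_complete)

text \<open>The functionals are the coordinates of an independent spanning set. The coordinate at
  \<open>b\<close> is bounded by \<open>1 / d\<close>, where \<open>d\<close> is the distance from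
  \<open>b\<close> to the span of the other basis vectors; \<open>d\<close> is positive because that
  span is complete, hence closed.\<close>

lemma finite_dim_dual_basis:
  assumes "finite_dim TYPE('e::real_normed_vector)"
  obtains B :: "'e::real_normed_vector set" and k :: "'e \<Rightarrow> 'e \<Rightarrow>\<^sub>L real"
  where "finite B" "\<forall>x. (\<Sum>b\<in>B. blinfun_apply (k b) x *\<^sub>R b) = x"
proof -
  obtain B' :: "'e set" where B': "finite B'" "span B' = UNIV"
    using assms unfolding finite_dim_def by auto
  obtain B where B: "B \<subseteq> B'" "independent B" "span B = UNIV"
  proof -
    obtain C where C: "C \<subseteq> B'" "independent C" "B' \<subseteq> span C"
      using maximal_independent_subset[of B'] .
    have "span B' \<subseteq> span C"
      using span_mono[OF C(3)] by (simp add: span_span)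
    then show ?thesis
      using that C B'(2) by blast
  qed
  have fin: "finite B" using B(1) B'(1) finite_subset by blast
  have rep: "(\<Sum>b\<in>B. representation B x b *\<^sub>R b) = x" for x
    using sum_representation_eq[of B x B] B fin by auto
  have bl: "bounded_linear (\<lambda>x. representation B x b)" if "b \<in> B" for b
  proof -
    define d where "d = infdist b (span (B - {b}))"
    have "b \<notin> span (B - {b})"
      using B(2) that dependent_def by blast
    then have d: "d > 0"
      unfolding d_def using fin
      by (intro infdist_span_pos complete_imp_closed complete_span_finite) auto
    show ?thesis
    proof (rule bounded_linear_intro)
      fix x y :: 'e and r :: real
      show "representation B (x + y) b = representation B x b + representation B y b"
        using B by (simp add: representation_add)
      show "representation B (r *\<^sub>R x) b = r *\<^sub>R representation B x b"
        using B by (simp add: representation_scale)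
      define y where "y = (\<Sum>a\<in>B - {b}. representation B x a *\<^sub>R a)"
      have "y \<in> span (B - {b})"
        unfolding y_def by (intro span_sum span_scale span_base)
      then have "\<bar>representation B x b\<bar> * d \<le> norm (representation B x b *\<^sub>R b + y)"
        unfolding d_def by (intro infdist_mult_le_norm subspace_span)
      also have "representation B x b *\<^sub>R b + y = x"
        unfolding y_def by (rule trans[OF sum.remove[OF fin that, symmetric] rep])
      finally have "\<bar>representation B x b\<bar> * d \<le> norm x" .
      then show "norm (representation B x b) \<le> norm x * (1 / d)"
        using d by (simp add: field_simps)
    qed
  qed
  have "(\<Sum>b\<in>B. blinfun_apply (Blinfun (\<lambda>x. representation B x b)) x *\<^sub>R b) = x" for x
    by (rule trans[OF sum.cong[OF refl] rep]) (simp add: bounded_linear_Blinfun_apply bl)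
  then show thesis by (intro that[OF fin] allI)
qed

lemma linear_sum_dual:
  assumes "linear f" "\<forall>x. (\<Sum>b\<in>B. blinfun_apply (k b) x *\<^sub>R b) = x"
  shows "f x = (\<Sum>b\<in>B. blinfun_apply (k b) x *\<^sub>R f b)"
proof -
  have "f x = f (\<Sum>b\<in>B. blinfun_apply (k b) x *\<^sub>R b)"
    using assms(2) by (intro arg_cong[of _ _ f]) (rule sym, blast)
  also have "\<dots> = (\<Sum>b\<in>B. blinfun_apply (k b) x *\<^sub>R f b)"
    by (simp only: linear_sum[OF assms(1)] linear_scale[OF assms(1)])
  finally show ?thesis .
qed

text \<open>The dual basis displays \<open>f\<close> as a finite sum of bounded functionals times
  fixed vectors.\<close>

lemma finite_dim_bounded_linear:
  fixes f :: "'e::real_normed_vector \<Rightarrow> 'f::real_normed_vector"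
  assumes "finite_dim TYPE('e)" "linear f"
  shows "bounded_linear f"
proof -
  obtain B :: "'e set" and k where "finite B" and k: "\<forall>x. (\<Sum>b\<in>B. blinfun_apply (k b) x *\<^sub>R b) = x"
    by (rule finite_dim_dual_basis[OF assms(1)])
  have "bounded_linear (\<lambda>x. \<Sum>b\<in>B. blinfun_apply (k b) x *\<^sub>R f b)"
    by (intro bounded_linear_sum bounded_linear_scaleR_left[THEN bounded_linear_compose] blinfun.bounded_linear_right)
  moreover have eq: "f = (\<lambda>x. \<Sum>b\<in>B. blinfun_apply (k b) x *\<^sub>R f b)"
    by (rule ext, rule linear_sum_dual[OF assms(2) k])
  ultimately show ?thesis by (subst eq)
qed

lemma finite_dim_prod:
  assumes "finite_dim TYPE('e::real_normed_vector)" "finite_dim TYPE('f::real_normed_vector)"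
  shows "finite_dim TYPE('e \<times> 'f)"
proof -
  obtain B :: "'e set" and C :: "'f set" where
    BC: "finite B" "span B = UNIV" "finite C" "span C = UNIV"
    using assms unfolding finite_dim_def by auto
  have "z \<in> span ((\<lambda>b. (b, 0)) ` B \<union> (\<lambda>c. (0, c)) ` C)" (is "z \<in> span ?D") for z :: "'e \<times> 'f"
  proof -
    have "linear (\<lambda>b::'e. (b, 0::'f))" "linear (\<lambda>c::'f. (0::'e, c))"
      by (auto intro!: linearI)
    from linear_span_image[OF this(1), of B] linear_span_image[OF this(2), of C]
    have "(fst z, 0) \<in> span ((\<lambda>b. (b, 0::'f)) ` B)" "(0, snd z) \<in> span ((\<lambda>c. (0::'e, c)) ` C)"
      using BC by auto
    then have "(fst z, 0) + (0, snd z) \<in> span ?D"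
      by (intro span_add) (use span_mono[OF Un_upper1] span_mono[OF Un_upper2] in blast)+
    then show ?thesis by simp
  qed
  then show ?thesis
    unfolding finite_dim_def using BC by (intro exI[of _ ?D]) auto
qed

text \<open>The coordinate functionals span the dual space, with the values of \<open>p\<close> on
  the basis as coefficients.\<close>

lemma blinfun_sum_dual:
  assumes "\<forall>x. (\<Sum>b\<in>B. blinfun_apply (k b) x *\<^sub>R b) = x"
  shows "p = (\<Sum>b\<in>B. blinfun_apply p b *\<^sub>R k b)"
proof (rule blinfun_eqI)
  fix x
  have "blinfun_apply p x = (\<Sum>b\<in>B. blinfun_apply (k b) x *\<^sub>R blinfun_apply p b)"
    by (intro linear_sum_dual assms bounded_linear.linear[OF blinfun.bounded_linear_right])
  also have "\<dots> = blinfun_apply (\<Sum>b\<in>B. blinfun_apply p b *\<^sub>R k b) x"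
    by (simp add: blinfun.sum_left blinfun.scaleR_left mult.commute)
  finally show "blinfun_apply p x = blinfun_apply (\<Sum>b\<in>B. blinfun_apply p b *\<^sub>R k b) x" .
qed

lemma finite_dim_dual:
  assumes "finite_dim TYPE('e::real_normed_vector)"
  shows "finite_dim TYPE('e \<Rightarrow>\<^sub>L real)"
proof -
  obtain B :: "'e set" and k where B: "finite B" "\<forall>x. (\<Sum>b\<in>B. blinfun_apply (k b) x *\<^sub>R b) = x"
    by (rule finite_dim_dual_basis[OF assms])
  have "p \<in> span (k ` B)" for p
    by (subst blinfun_sum_dual[OF B(2)]) (intro span_sum span_scale span_base imageI)
  then show ?thesis
    unfolding finite_dim_def using B(1) by blast
qed

section \<open>Calculus of smooth maps\<close>

lemma frechet_derivative_eq:
  "(f has_derivative f') (at x) \<Longrightarrow> frechet_derivative f (at x) = f'"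
  using frechet_derivative_at by metis

lemma has_derivative_frechet:
  "f differentiable (at x) \<Longrightarrow> (f has_derivative frechet_derivative f (at x)) (at x)"
  using frechet_derivative_works by blast

lemma linear_frechet_derivative':
  "f differentiable (at x) \<Longrightarrow> linear (frechet_derivative f (at x))"
  using has_derivative_frechet has_derivative_linear by blast

text \<open>On an open set the derivative of \<open>f\<close> is also a derivative of
  \<open>g\<close>, so the directional derivatives agree on \<open>S\<close> and the induction
  continues with them.\<close>

lemma Cn_on_cong:
  assumes "open S" "\<And>x. x \<in> S \<Longrightarrow> f x = g x" "Cn_on n S f"
  shows "Cn_on n S g"
  using assms(2,3)
proof (induction n arbitrary: f g)
  case 0
  then show ?case using continuous_on_eq by fastforce
next
  case (Suc n)
  have der: "(g has_derivative frechet_derivative f (at x)) (at x)" if "x \<in> S" for x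
    using has_derivative_transform_within_open[OF _ assms(1) that, of f _ UNIV g] Suc.prems that
    by (simp add: has_derivative_frechet)
  have "Cn_on n S (\<lambda>x. frechet_derivative g (at x) v)" for v
  proof (rule Suc.IH)
    show "Cn_on n S (\<lambda>x. frechet_derivative f (at x) v)"
      using Suc.prems by simp
    show "frechet_derivative f (at x) v = frechet_derivative g (at x) v" if "x \<in> S" for x
      using frechet_derivative_eq[OF der[OF that]] by simp
  qed
  moreover have "g differentiable (at x)" if "x \<in> S" for x
    using der[OF that] differentiableI by blast
  ultimately show ?case by simp
qed

lemma Cn_on_subset: "T \<subseteq> S \<Longrightarrow> Cn_on n S f \<Longrightarrow> Cn_on n T f"
  by (induction n arbitrary: f) (auto intro: continuous_on_subset)

text \<open>The sets \<open>T\<close> are open and \<open>Cn_on\<close> uses derivatives in full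
  neighbourhoods, so each condition at \<open>x\<close> can be read off from
  \<open>T\<close>.\<close>

lemma Cn_on_local:
  assumes "\<And>x. x \<in> S \<Longrightarrow> \<exists>T. open T \<and> x \<in> T \<and> Cn_on n T f"
  shows "Cn_on n S f"
  using assms
proof (induction n arbitrary: f)
  case 0
  have "isCont f x" if "x \<in> S" for x
    using 0[OF that] by (auto simp: continuous_on_eq_continuous_at)
  then show ?case by (simp add: continuous_at_imp_continuous_on)
next
  case (Suc n)
  have "f differentiable (at x)" if "x \<in> S" for x
    using Suc.prems[OF that] by auto
  moreover have "Cn_on n S (\<lambda>x. frechet_derivative f (at x) v)" for v
  proof (rule Suc.IH)
    fix x assume "x \<in> S"
    from Suc.prems[OF this] show "\<exists>T. open T \<and> x \<in> T \<and> Cn_on n T (\<lambda>x. frechet_derivative f (at x) v)"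
      by auto
  qed
  ultimately show ?case by simp
qed

lemma Cn_on_SucD: "Cn_on (Suc n) S f \<Longrightarrow> Cn_on n S f"
proof (induction n arbitrary: f)
  case 0
  then show ?case
    by (simp add: continuous_at_imp_continuous_on differentiable_imp_continuous_within)
next
  case (Suc n)
  have "f differentiable (at x)" if "x \<in> S" for x
    using Suc.prems that by simp
  moreover have "Cn_on n S (\<lambda>x. frechet_derivative f (at x) v)" for v
    using Suc.prems by (intro Suc.IH) simp
  ultimately show ?case by simp
qed

text \<open>By uniqueness of derivatives an explicit formula may replace the chosen
  \<open>frechet_derivative\<close>.\<close>

lemma Cn_on_SucI:
  assumes "open S" "\<And>x. x \<in> S \<Longrightarrow> (f has_derivative f' x) (at x)" "\<And>v. Cn_on n S (\<lambda>x. f' x v)"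
  shows "Cn_on (Suc n) S f"
proof -
  have "Cn_on n S (\<lambda>x. frechet_derivative f (at x) v)" for v
    by (rule Cn_on_cong[OF assms(1) _ assms(3)[of v]]) (simp add: frechet_derivative_eq[OF assms(2)])
  moreover have "\<forall>x\<in>S. f differentiable (at x)"
    using assms(2) differentiableI by blast
  ultimately show ?thesis by simp
qed

lemma Cn_on_const: "Cn_on n S (\<lambda>x. c)"
  by (induction n arbitrary: c) auto

lemma Cn_on_bounded_linear:
  assumes "bounded_linear L" "open S" "Cn_on n S f"
  shows "Cn_on n S (\<lambda>x. L (f x))"
  using assms(3)
proof (induction n arbitrary: f)
  case 0
  then show ?case
    using bounded_linear.continuous_on[OF assms(1)] by simp
next
  case (Suc n)
  show ?case
  proof (rule Cn_on_SucI[OF assms(2)])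
    show "((\<lambda>x. L (f x)) has_derivative (\<lambda>v. L (frechet_derivative f (at x) v))) (at x)" if "x \<in> S" for x
      using Suc.prems that by (intro bounded_linear.has_derivative[OF assms(1)] has_derivative_frechet) simp
    show "Cn_on n S (\<lambda>x. L (frechet_derivative f (at x) v))" for v
      using Suc.prems by (intro Suc.IH) simp
  qed
qed

lemma Cn_on_add:
  assumes "open S" "Cn_on n S f" "Cn_on n S g"
  shows "Cn_on n S (\<lambda>x. f x + g x)"
  using assms(2,3)
proof (induction n arbitrary: f g)
  case 0
  then show ?case by (simp add: continuous_on_add)
next
  case (Suc n)
  show ?case
  proof (rule Cn_on_SucI[OF assms(1)])
    show "((\<lambda>x. f x + g x) has_derivative (\<lambda>v. frechet_derivative f (at x) v + frechet_derivative g (at x) v)) (at x)"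
      if "x \<in> S" for x
      using Suc.prems that by (intro has_derivative_add has_derivative_frechet) simp_all
    show "Cn_on n S (\<lambda>x. frechet_derivative f (at x) v + frechet_derivative g (at x) v)" for v
      using Suc.prems by (intro Suc.IH) simp_all
  qed
qed

text \<open>The product rule gives two terms of the same shape, each with one differentiated factor
  of order \<open>n\<close>; the other factor is lowered to order \<open>n\<close> by
  \<open>Cn_on_SucD\<close>. This is why the induction generalises over both factors.\<close>

lemma Cn_on_bounded_bilinear:
  assumes "bounded_bilinear b" "open S" "Cn_on n S f" "Cn_on n S g"
  shows "Cn_on n S (\<lambda>x. b (f x) (g x))"
  using assms(3,4)
proof (induction n arbitrary: f g)
  case 0
  then show ?case by (simp add: bounded_bilinear.continuous_on[OF assms(1)])
next
  case (Suc n)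
  show ?case
  proof (rule Cn_on_SucI[OF assms(2)])
    show "((\<lambda>x. b (f x) (g x)) has_derivative
        (\<lambda>v. b (f x) (frechet_derivative g (at x) v) + b (frechet_derivative f (at x) v) (g x))) (at x)"
      if "x \<in> S" for x
      using Suc.prems that by (intro bounded_bilinear.FDERIV[OF assms(1)] has_derivative_frechet) simp_all
    show "Cn_on n S (\<lambda>x. b (f x) (frechet_derivative g (at x) v) + b (frechet_derivative f (at x) v) (g x))" for v
      using Suc.prems Cn_on_SucD[OF Suc.prems(1)] Cn_on_SucD[OF Suc.prems(2)]
      by (intro Cn_on_add Suc.IH assms(2)) simp_all
  qed
qed

lemma Cn_on_sum:
  assumes "open S" "\<And>i. i \<in> I \<Longrightarrow> Cn_on n S (f i)"
  shows "Cn_on n S (\<lambda>x. \<Sum>i\<in>I. f i x)"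
  using assms(2)
  by (induction I rule: infinite_finite_induct) (auto intro!: Cn_on_const Cn_on_add assms(1))

lemma Cn_on_id: "Cn_on n S (\<lambda>x. x)"
  by (cases n) (auto intro: Cn_on_const)

text \<open>A pair is the sum of its two components, each inserted by a bounded linear map.\<close>

lemma Cn_on_Pair:
  assumes "open S" "Cn_on n S f" "Cn_on n S g"
  shows "Cn_on n S (\<lambda>x. (f x, g x))"
proof -
  have "bounded_linear (\<lambda>x::'b. (x, 0::'c))" "bounded_linear (\<lambda>x::'c. (0::'b, x))"
    by (intro bounded_linear_Pair bounded_linear_ident bounded_linear_zero)+
  from Cn_on_add[OF assms(1) Cn_on_bounded_linear[OF this(1) assms(1,2)]
      Cn_on_bounded_linear[OF this(2) assms(1,3)]]
  show ?thesis by simp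
qed

text \<open>\<open>Cn_on\<close> controls the derivative of \<open>g\<close> only in fixed
  directions, while the chain rule evaluates it in the direction \<open>Df(x) v\<close>, which
  varies with \<open>x\<close>. Expanding that direction in the dual basis leaves scalar
  coefficients times \<open>Dg(f x) b\<close> with \<open>b\<close> fixed. The latter is again a
  composition with \<open>f\<close>, of lower order, hence the induction over arbitrary
  \<open>g\<close>.\<close>

lemma Cn_on_compose:
  fixes f :: "'a::real_normed_vector \<Rightarrow> 'b::real_normed_vector" and g :: "'b \<Rightarrow> 'c::real_normed_vector"
  assumes "finite_dim TYPE('b)" "open S" "open T" "\<And>x. x \<in> S \<Longrightarrow> f x \<in> T"
    and "Cn_on n S f" "Cn_on n T g"
  shows "Cn_on n S (\<lambda>x. g (f x))"
  using assms(5,6)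
proof (induction n arbitrary: g)
  case 0
  then show ?case
    using continuous_on_compose2[of T g S f] assms(4) by auto
next
  case (Suc n)
  obtain B :: "'b set" and k where B: "finite B" "\<forall>x. (\<Sum>b\<in>B. blinfun_apply (k b) x *\<^sub>R b) = x"
    by (rule finite_dim_dual_basis[OF assms(1)])
  let ?D = "\<lambda>x v. \<Sum>b\<in>B. blinfun_apply (k b) (frechet_derivative f (at x) v) *\<^sub>R frechet_derivative g (at (f x)) b"
  have f: "f differentiable (at x)" if "x \<in> S" for x
    using Suc.prems that by simp
  have g: "g differentiable (at (f x))" if "x \<in> S" for x
    using Suc.prems assms(4)[OF that] by simp
  show ?case
  proof (rule Cn_on_SucI[OF assms(2)])
    show "((\<lambda>x. g (f x)) has_derivative ?D x) (at x)" if "x \<in> S" for x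
    proof -
      have "?D x = (\<lambda>v. frechet_derivative g (at (f x)) (frechet_derivative f (at x) v))"
        by (rule ext, rule linear_sum_dual[symmetric]) (rule linear_frechet_derivative'[OF g[OF that]], rule B(2))
      moreover have "((\<lambda>x. g (f x)) has_derivative
          (\<lambda>v. frechet_derivative g (at (f x)) (frechet_derivative f (at x) v))) (at x)"
        by (rule has_derivative_compose[OF has_derivative_frechet[OF f[OF that]] has_derivative_frechet[OF g[OF that]]])
      ultimately show ?thesis by simp
    qed
    show "Cn_on n S (\<lambda>x. ?D x v)" for v
    proof (intro Cn_on_sum assms(2) Cn_on_bounded_bilinear[OF bounded_bilinear_scaleR]
        Cn_on_bounded_linear[OF blinfun.bounded_linear_right])
      show "Cn_on n S (\<lambda>x. frechet_derivative f (at x) v)"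
        using Suc.prems by simp
      show "Cn_on n S (\<lambda>x. frechet_derivative g (at (f x)) b)" for b
        using Suc.prems Cn_on_SucD[OF Suc.prems(1)] by (intro Suc.IH) simp_all
    qed
  qed
qed

text \<open>Finitely many values on basis vectors determine a functional, so pointwise regularity
  gives regularity in the operator norm.\<close>

lemma Cn_on_blinfun:
  fixes f :: "'a::real_normed_vector \<Rightarrow> ('e::real_normed_vector \<Rightarrow>\<^sub>L real)"
  assumes "finite_dim TYPE('e)" "open S" "\<And>w. Cn_on n S (\<lambda>x. blinfun_apply (f x) w)"
  shows "Cn_on n S f"
proof -
  obtain B :: "'e set" and k where B: "finite B" "\<forall>x. (\<Sum>b\<in>B. blinfun_apply (k b) x *\<^sub>R b) = x"
    by (rule finite_dim_dual_basis[OF assms(1)])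
  have "Cn_on n S (\<lambda>x. \<Sum>b\<in>B. blinfun_apply (f x) b *\<^sub>R k b)"
    by (intro Cn_on_sum assms Cn_on_bounded_linear[OF bounded_linear_scaleR_left])
  then show ?thesis
    by (rule Cn_on_cong[OF assms(2), rotated]) (rule blinfun_sum_dual[OF B(2), symmetric])
qed

section \<open>The closure properties for \<open>smooth_on\<close>\<close>

lemma smooth_on_cong:
  "open S \<Longrightarrow> (\<And>x. x \<in> S \<Longrightarrow> f x = g x) \<Longrightarrow> smooth_on S f \<Longrightarrow> smooth_on S g"
  unfolding smooth_on_def by (intro allI, rule Cn_on_cong[of S f g]) simp_all

lemma smooth_on_subset: "T \<subseteq> S \<Longrightarrow> smooth_on S f \<Longrightarrow> smooth_on T f"
  unfolding smooth_on_def using Cn_on_subset[of T S] by blast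

lemma smooth_on_local:
  assumes "\<And>x. x \<in> S \<Longrightarrow> \<exists>T. open T \<and> x \<in> T \<and> smooth_on T f"
  shows "smooth_on S f"
  unfolding smooth_on_def
proof (intro allI Cn_on_local)
  fix n x assume "x \<in> S"
  from assms[OF this] show "\<exists>T. open T \<and> x \<in> T \<and> Cn_on n T f"
    unfolding smooth_on_def by blast
qed

lemma smooth_on_differentiable: "smooth_on S f \<Longrightarrow> x \<in> S \<Longrightarrow> f differentiable (at x)"
  unfolding smooth_on_def by (drule spec[of _ "Suc 0"]) simp

lemma smooth_on_frechet_derivative: "smooth_on S f \<Longrightarrow> smooth_on S (\<lambda>x. frechet_derivative f (at x) v)"
  unfolding smooth_on_def
proof
  fix n assume *: "\<forall>n. Cn_on n S f"
  show "Cn_on n S (\<lambda>x. frechet_derivative f (at x) v)"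
    using *[rule_format, of "Suc n"] by simp
qed

lemma smooth_on_continuous: "smooth_on S f \<Longrightarrow> continuous_on S f"
  unfolding smooth_on_def by (drule spec[of _ 0]) simp

lemma smooth_on_const: "smooth_on S (\<lambda>x. c)"
  by (simp add: smooth_on_def Cn_on_const)

lemma smooth_on_id: "smooth_on S (\<lambda>x. x)"
  by (simp add: smooth_on_def Cn_on_id)

lemma smooth_on_bounded_linear:
  "bounded_linear L \<Longrightarrow> open S \<Longrightarrow> smooth_on S f \<Longrightarrow> smooth_on S (\<lambda>x. L (f x))"
  unfolding smooth_on_def using Cn_on_bounded_linear[of L S _ f] by simp

lemma smooth_on_add:
  "open S \<Longrightarrow> smooth_on S f \<Longrightarrow> smooth_on S g \<Longrightarrow> smooth_on S (\<lambda>x. f x + g x)"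
  unfolding smooth_on_def using Cn_on_add[of S _ f g] by simp

lemma smooth_on_Pair:
  "open S \<Longrightarrow> smooth_on S f \<Longrightarrow> smooth_on S g \<Longrightarrow> smooth_on S (\<lambda>x. (f x, g x))"
  unfolding smooth_on_def using Cn_on_Pair[of S _ f g] by simp

lemma smooth_on_fst: "open S \<Longrightarrow> smooth_on S f \<Longrightarrow> smooth_on S (\<lambda>x. fst (f x))"
  by (rule smooth_on_bounded_linear[OF bounded_linear_fst])

lemma smooth_on_snd: "open S \<Longrightarrow> smooth_on S f \<Longrightarrow> smooth_on S (\<lambda>x. snd (f x))"
  by (rule smooth_on_bounded_linear[OF bounded_linear_snd])

lemma smooth_on_bounded_bilinear:
  "bounded_bilinear b \<Longrightarrow> open S \<Longrightarrow> smooth_on S f \<Longrightarrow> smooth_on S g \<Longrightarrow> smooth_on S (\<lambda>x. b (f x) (g x))"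
  unfolding smooth_on_def using Cn_on_bounded_bilinear[of b S _ f g] by simp

lemma smooth_on_compose:
  fixes f :: "'a::real_normed_vector \<Rightarrow> 'b::real_normed_vector" and g :: "'b \<Rightarrow> 'c::real_normed_vector"
  assumes "finite_dim TYPE('b)" "open S" "open T" "\<And>x. x \<in> S \<Longrightarrow> f x \<in> T"
    and "smooth_on S f" "smooth_on T g"
  shows "smooth_on S (\<lambda>x. g (f x))"
  using assms(5,6) Cn_on_compose[of S T f _ g, OF assms(1-4)] unfolding smooth_on_def by simp

lemma smooth_on_blinfun:
  fixes f :: "'a::real_normed_vector \<Rightarrow> ('e::real_normed_vector \<Rightarrow>\<^sub>L real)"
  assumes "finite_dim TYPE('e)" "open S" "\<And>w. smooth_on S (\<lambda>x. blinfun_apply (f x) w)"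
  shows "smooth_on S f"
  using assms(3) Cn_on_blinfun[OF assms(1,2), of _ f] unfolding smooth_on_def by simp

lemma smooth_on_open_vimage:
  assumes "smooth_on S f" "open S" "open T"
  shows "open (S \<inter> f -` T)"
  using continuous_open_preimage[OF smooth_on_continuous[OF assms(1)] assms(2,3)] .

text \<open>The mean value inequality applied to \<open>s \<mapsto> f (x + s u + t w) - f (x + s u)\<close>; the second
  difference is symmetric in \<open>u\<close> and \<open>w\<close>, hence so is the second derivative.\<close>

lemma second_difference_bound:
  fixes f :: "'a::real_normed_vector \<Rightarrow> 'b::real_normed_vector"
  assumes S: "open S" "x \<in> S" "\<And>y. y \<in> S \<Longrightarrow> f differentiable (at y)"
    and H: "((\<lambda>y. frechet_derivative f (at y) u) has_derivative H') (at x)"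
    and e: "e > 0"
  obtains \<delta> where "\<delta> > 0"
    "\<forall>t. 0 < t \<longrightarrow> t < \<delta> \<longrightarrow>
      norm (f (x + t *\<^sub>R u + t *\<^sub>R w) - f (x + t *\<^sub>R u) - f (x + t *\<^sub>R w) + f x - (t * t) *\<^sub>R H' w) \<le> e * (t * t)"
proof -
  \<comment> \<open>\<open>t * M\<close> bounds every displacement \<open>s u + \<tau> w\<close>
    with \<open>s\<close> and \<open>\<tau>\<close> between 0 and \<open>t\<close>; the summand 1
    makes \<open>M\<close> positive.\<close>
  define M where "M = norm u + norm w + 1"
  have M: "M > 0" unfolding M_def by (simp add: add_nonneg_pos)
  define H where "H y = frechet_derivative f (at y) u" for y
  have lin: "linear H'"
    using assms(4) has_derivative_linear by blast
  \<comment> \<open>Two linearisation errors, each at most this constant times \<open>t * M\<close>,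
    will add up to \<open>e * t\<close>.\<close>
  have "e / (2 * M) > 0" using e M by simp
  then obtain d where d: "d > 0"
    "\<And>y. norm (y - x) < d \<Longrightarrow> norm (H y - H x - H' (y - x)) \<le> e / (2 * M) * norm (y - x)"
    using assms(4) unfolding has_derivative_at_alt H_def by blast
  obtain r where r: "r > 0" "ball x r \<subseteq> S"
    using S(1,2) open_contains_ball by blast
  \<comment> \<open>For \<open>t\<close> below this bound all displacements stay within the range
    \<open>d\<close> of the derivative estimate and inside the ball of radius \<open>r\<close>
    contained in \<open>S\<close>.\<close>
  define \<delta> where "\<delta> = min d r / M"
  show thesis
  proof (intro that allI impI)
    show "\<delta> > 0" using d r M by (simp add: \<delta>_def)
    fix t :: real assume t: "0 < t" "t < \<delta>"
    have tM: "t * M < d" "t * M < r"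
      using t(2) M unfolding \<delta>_def by (simp_all add: pos_less_divide_eq)
    \<comment> \<open>The linear term is subtracted in advance: \<open>g t - g 0\<close> is then the
      whole error, and its derivative \<open>g'\<close> is small.\<close>
    define g where "g s = f (x + s *\<^sub>R u + t *\<^sub>R w) - f (x + s *\<^sub>R u) - s *\<^sub>R (t *\<^sub>R H' w)" for s
    define g' where "g' s = H (x + s *\<^sub>R u + t *\<^sub>R w) - H (x + s *\<^sub>R u) - t *\<^sub>R H' w" for s
    have near: "norm (s *\<^sub>R u + \<tau> *\<^sub>R w) \<le> t * M" if "0 \<le> s" "s \<le> t" "0 \<le> \<tau>" "\<tau> \<le> t" for s \<tau>
    proof -
      have "norm (s *\<^sub>R u + \<tau> *\<^sub>R w) \<le> s * norm u + \<tau> * norm w"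
        using norm_triangle_ineq[of "s *\<^sub>R u" "\<tau> *\<^sub>R w"] that by simp
      also have "\<dots> \<le> t * norm u + t * norm w"
        using that by (intro add_mono mult_right_mono) auto
      also have "\<dots> \<le> t * M"
        using t by (simp add: M_def algebra_simps)
      finally show ?thesis .
    qed
    have near_u: "norm (s *\<^sub>R u) \<le> t * M" if "0 \<le> s" "s \<le> t" for s
      using near[OF that, of 0] t by simp
    have ball: "x + y \<in> S" if "norm y \<le> t * M" for y
    proof -
      have "x + y \<in> ball x r" using that tM by (simp add: dist_norm)
      then show ?thesis using r(2) by blast
    qed
    have der: "(g has_derivative (\<lambda>h. h *\<^sub>R g' s)) (at s within {0..t})" if s: "s \<in> {0..t}" for s
    proof -
      have in_S: "x + s *\<^sub>R u + t *\<^sub>R w \<in> S" "x + s *\<^sub>R u \<in> S"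
        using ball[OF near[of s t]] ball[OF near_u[of s]] s t by (simp_all add: add.assoc)
      have shift: "((\<lambda>s. x + s *\<^sub>R u + c) has_derivative (\<lambda>h. h *\<^sub>R u)) (at s within {0..t})" for c
        by (auto intro!: derivative_eq_intros)
      have *: "((\<lambda>s. f (x + s *\<^sub>R u + c)) has_derivative (\<lambda>h. h *\<^sub>R H (x + s *\<^sub>R u + c))) (at s within {0..t})"
        if "x + s *\<^sub>R u + c \<in> S" for c
        using has_derivative_compose[OF shift has_derivative_frechet[OF S(3)[OF that]]]
          linear_scale[OF linear_frechet_derivative'[OF S(3)[OF that]]]
        by (simp add: H_def)
      have "(g has_derivative (\<lambda>h. h *\<^sub>R H (x + s *\<^sub>R u + t *\<^sub>R w) - h *\<^sub>R H (x + s *\<^sub>R u) - h *\<^sub>R (t *\<^sub>R H' w))) (at s within {0..t})"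
        unfolding g_def using *[of "t *\<^sub>R w"] *[of 0] in_S
        by (intro has_derivative_diff has_derivative_scaleR_left has_derivative_ident) simp_all
      moreover have "(\<lambda>h. h *\<^sub>R g' s) = (\<lambda>h. h *\<^sub>R H (x + s *\<^sub>R u + t *\<^sub>R w) - h *\<^sub>R H (x + s *\<^sub>R u) - h *\<^sub>R (t *\<^sub>R H' w))"
        by (simp add: g'_def scaleR_diff_right)
      ultimately show ?thesis by simp
    qed
    have bound: "onorm (\<lambda>h. h *\<^sub>R g' s) \<le> e * t" if s: "s \<in> {0..t}" for s
    proof -
      have H_near: "norm (H (x + y) - H x - H' y) \<le> e / (2 * M) * (t * M)" if "norm y \<le> t * M" for y
      proof -
        have "norm (H (x + y) - H x - H' y) \<le> e / (2 * M) * norm y"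
          using d(2)[of "x + y"] that tM by simp
        also have "\<dots> \<le> e / (2 * M) * (t * M)"
          using that e M by (intro mult_left_mono) auto
        finally show ?thesis .
      qed
      \<comment> \<open>Both values of \<open>H\<close> are compared with the linearisation at
        \<open>x\<close>; the contributions \<open>H x\<close> and \<open>H' (s u)\<close> cancel
        and \<open>t H' w\<close> remains.\<close>
      have "g' s = (H (x + (s *\<^sub>R u + t *\<^sub>R w)) - H x - H' (s *\<^sub>R u + t *\<^sub>R w)) - (H (x + s *\<^sub>R u) - H x - H' (s *\<^sub>R u))"
        by (simp add: g'_def linear_add[OF lin] linear_scale[OF lin] add.assoc)
      then have "norm (g' s) \<le> norm (H (x + (s *\<^sub>R u + t *\<^sub>R w)) - H x - H' (s *\<^sub>R u + t *\<^sub>R w)) + norm (H (x + s *\<^sub>R u) - H x - H' (s *\<^sub>R u))"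
        by (simp only: norm_triangle_ineq4)
      also have "\<dots> \<le> e / (2 * M) * (t * M) + e / (2 * M) * (t * M)"
        using s t by (intro add_mono H_near near near_u) auto
      also have "\<dots> = e * t"
        using M by (simp add: field_simps)
      finally have "norm (g' s) \<le> e * t" .
      then show ?thesis
        by (intro onorm_le) (simp add: mult.commute mult_left_mono)
    qed
    have "norm (g t - g 0) \<le> e * t * norm (t - 0)"
      by (rule differentiable_bound[OF _ der bound]) (use t in auto)
    then show "norm (f (x + t *\<^sub>R u + t *\<^sub>R w) - f (x + t *\<^sub>R u) - f (x + t *\<^sub>R w) + f x - (t * t) *\<^sub>R H' w) \<le> e * (t * t)"
      using t by (simp add: g_def algebra_simps)
  qed
qed

lemma frechet_derivative_symmetric:
  fixes f :: "'a::real_normed_vector \<Rightarrow> 'b::real_normed_vector"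
  assumes S: "open S" "x \<in> S" "\<And>y. y \<in> S \<Longrightarrow> f differentiable (at y)"
    and u: "(\<lambda>y. frechet_derivative f (at y) u) differentiable (at x)"
    and w: "(\<lambda>y. frechet_derivative f (at y) w) differentiable (at x)"
  shows "frechet_derivative (\<lambda>y. frechet_derivative f (at y) u) (at x) w
       = frechet_derivative (\<lambda>y. frechet_derivative f (at y) w) (at x) u" (is "?a = ?b")
proof -
  have "norm (?a - ?b) \<le> e" if e: "e > 0" for e
  proof -
    have e2: "e / 2 > 0" using e by simp
    obtain \<delta>1 where d1: "\<delta>1 > 0"
      "\<forall>t. 0 < t \<longrightarrow> t < \<delta>1 \<longrightarrow>
        norm (f (x + t *\<^sub>R u + t *\<^sub>R w) - f (x + t *\<^sub>R u) - f (x + t *\<^sub>R w) + f x - (t * t) *\<^sub>R ?a) \<le> e / 2 * (t * t)"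
      by (rule second_difference_bound[OF S has_derivative_frechet[OF u] e2])
    obtain \<delta>2 where d2: "\<delta>2 > 0"
      "\<forall>t. 0 < t \<longrightarrow> t < \<delta>2 \<longrightarrow>
        norm (f (x + t *\<^sub>R w + t *\<^sub>R u) - f (x + t *\<^sub>R w) - f (x + t *\<^sub>R u) + f x - (t * t) *\<^sub>R ?b) \<le> e / 2 * (t * t)"
      by (rule second_difference_bound[OF S has_derivative_frechet[OF w] e2])
    define t where "t = min \<delta>1 \<delta>2 / 2"
    have t: "0 < t" "t < \<delta>1" "t < \<delta>2"
      using d1(1) d2(1) by (auto simp: t_def)
    \<comment> \<open>One second difference, written in both orders of \<open>u\<close> and
      \<open>w\<close>: it is approximated by \<open>t * t\<close> times either mixed derivative, so
      these differ by at most \<open>e\<close>.\<close>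
    define D where "D = f (x + t *\<^sub>R u + t *\<^sub>R w) - f (x + t *\<^sub>R u) - f (x + t *\<^sub>R w) + f x"
    have D': "D = f (x + t *\<^sub>R w + t *\<^sub>R u) - f (x + t *\<^sub>R w) - f (x + t *\<^sub>R u) + f x"
      by (simp add: D_def algebra_simps)
    have "t * t * norm (?a - ?b) = norm ((D - (t * t) *\<^sub>R ?b) - (D - (t * t) *\<^sub>R ?a))"
      using t by (simp flip: scaleR_diff_right)
    also have "\<dots> \<le> norm (D - (t * t) *\<^sub>R ?b) + norm (D - (t * t) *\<^sub>R ?a)"
      by (rule norm_triangle_ineq4)
    also have "\<dots> \<le> e / 2 * (t * t) + e / 2 * (t * t)"
      using d1(2)[rule_format, OF t(1,2)] d2(2)[rule_format, OF t(1,3)] unfolding D_def[symmetric] D'[symmetric] by linarith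
    also have "\<dots> = t * t * e" by simp
    finally show ?thesis
      using t by (simp add: mult_le_cancel_left_pos)
  qed
  then have "norm (?a - ?b) \<le> 0"
    using field_le_epsilon[of "norm (?a - ?b)" 0] by simp
  then show ?thesis by simp
qed

section \<open>Smooth maps between manifolds\<close>

text \<open>The conditions of \<open>manifold\<close> that are checked chart by chart; they pass to
  products and to cotangent bundles by computation in charts.\<close>

definition smooth_atlas :: "('a, 'e::real_normed_vector) atlas \<Rightarrow> bool" where
  "smooth_atlas M \<longleftrightarrow> finite_dim TYPE('e) \<and>
     (\<forall>c\<in>M. inj_on (snd c) (fst c) \<and> open (snd c ` fst c)) \<and>
     (\<forall>c\<in>M. \<forall>d\<in>M. open (snd c ` (fst c \<inter> fst d)) \<and>
        smooth_on (snd c ` (fst c \<inter> fst d)) (snd d \<circ> chart_inv c))"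

lemma manifold_smooth_atlas: "manifold M \<Longrightarrow> smooth_atlas M"
  by (simp add: manifold_def smooth_atlas_def finite_dim_def)

lemma smooth_atlas_finite_dim:
  fixes M :: "('a, 'e::real_normed_vector) atlas"
  shows "smooth_atlas M \<Longrightarrow> finite_dim TYPE('e)"
  by (simp add: smooth_atlas_def)

lemma smooth_atlas_open: "smooth_atlas M \<Longrightarrow> c \<in> M \<Longrightarrow> open (snd c ` fst c)"
  by (simp add: smooth_atlas_def)

lemma smooth_atlas_transition:
  assumes "smooth_atlas M" "c \<in> M" "d \<in> M"
  shows "smooth_on (snd c ` (fst c \<inter> fst d)) (snd d \<circ> chart_inv c)"
  using assms by (simp add: smooth_atlas_def)

lemma chart_inv_chart [simp]:
  "smooth_atlas M \<Longrightarrow> c \<in> M \<Longrightarrow> p \<in> fst c \<Longrightarrow> chart_inv c (snd c p) = p"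
  by (simp add: smooth_atlas_def chart_inv_def)

lemma chart_chart_inv [simp]: "x \<in> snd c ` fst c \<Longrightarrow> snd c (chart_inv c x) = x"
  unfolding chart_inv_def by (rule f_inv_into_f)

lemma chart_inv_mem: "x \<in> snd c ` fst c \<Longrightarrow> chart_inv c x \<in> fst c"
  unfolding chart_inv_def by (rule inv_into_into)

lemma mem_pts: "c \<in> M \<Longrightarrow> p \<in> fst c \<Longrightarrow> p \<in> pts M"
  by (auto simp: pts_def)

lemma chart_inv_unique:
  assumes "inj_on (snd c) (fst c)" "p \<in> fst c" "snd c p = x"
  shows "chart_inv c x = p"
  using assms by (auto simp: chart_inv_def)

text \<open>The domain of the local representative of \<open>f\<close> in the charts
  \<open>c\<close> and \<open>d\<close>, as a condition on the coordinate \<open>x\<close> rather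
  than as the image of a set of points used in \<open>smooth_map\<close>.\<close>

definition rep_dom :: "('a, 'e) chart \<Rightarrow> ('a \<Rightarrow> 'b) \<Rightarrow> ('b, 'f) chart \<Rightarrow> 'e set" where
  "rep_dom c f d = {x \<in> snd c ` fst c. f (chart_inv c x) \<in> fst d}"

lemma rep_dom_eq:
  assumes "smooth_atlas M" "c \<in> M"
  shows "snd c ` (fst c \<inter> f -` fst d) = rep_dom c f d"
  using assms by (auto simp: rep_dom_def)

lemma smooth_map_iff:
  assumes "smooth_atlas M"
  shows "smooth_map M N f \<longleftrightarrow> f ` pts M \<subseteq> pts N \<and>
    (\<forall>c\<in>M. \<forall>d\<in>N. open (rep_dom c f d) \<and> smooth_on (rep_dom c f d) (snd d \<circ> f \<circ> chart_inv c))"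
  by (simp add: smooth_map_def rep_dom_eq[OF assms] cong: ball_cong)

lemma smooth_map_mem: "smooth_map M N f \<Longrightarrow> p \<in> pts M \<Longrightarrow> f p \<in> pts N"
  by (auto simp: smooth_map_def)

lemma smooth_map_open: "smooth_atlas M \<Longrightarrow> smooth_map M N f \<Longrightarrow> c \<in> M \<Longrightarrow> d \<in> N \<Longrightarrow> open (rep_dom c f d)"
  by (simp add: smooth_map_iff)

lemma smooth_map_smooth_on:
  "smooth_atlas M \<Longrightarrow> smooth_map M N f \<Longrightarrow> c \<in> M \<Longrightarrow> d \<in> N \<Longrightarrow>
    smooth_on (rep_dom c f d) (snd d \<circ> f \<circ> chart_inv c)"
  by (simp add: smooth_map_iff)

text \<open>For \<open>id\<close> the definition of smoothness is the mutual compatibility of the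
  charts. Chart changes can thus be handled as local representatives of \<open>id\<close>.\<close>

lemma smooth_map_id:
  assumes "smooth_atlas M"
  shows "smooth_map M M id"
  using assms by (simp add: smooth_map_def smooth_atlas_def)

text \<open>Through a chart \<open>e\<close> at the intermediate point, the representative of a composition is,
  near a given point, the composition of representatives.\<close>

lemma rep_compose_local:
  assumes M: "smooth_atlas M" and N: "smooth_atlas N"
    and f: "smooth_map M N f" and g: "smooth_map N P g"
    and c: "c \<in> M" and e: "e \<in> N" and d: "d \<in> P"
    and x: "x \<in> rep_dom c f e" "x \<in> rep_dom c (g \<circ> f) d"
  obtains T where "open T" "x \<in> T" "T \<subseteq> rep_dom c (g \<circ> f) d" "T \<subseteq> rep_dom c f e"
    "\<forall>y\<in>T. (snd e \<circ> f \<circ> chart_inv c) y \<in> rep_dom e g d"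
    "\<forall>y\<in>T. (snd d \<circ> g \<circ> chart_inv e) ((snd e \<circ> f \<circ> chart_inv c) y) = (snd d \<circ> (g \<circ> f) \<circ> chart_inv c) y"
proof
  let ?F = "snd e \<circ> f \<circ> chart_inv c"
  let ?T = "rep_dom c f e \<inter> ?F -` rep_dom e g d"
  show "open ?T"
    using smooth_on_open_vimage[OF smooth_map_smooth_on[OF M f c e] smooth_map_open[OF M f c e]
        smooth_map_open[OF N g e d]] .
  show "x \<in> ?T"
    using x N e by (auto simp: rep_dom_def)
  have inv: "chart_inv e (?F y) = f (chart_inv c y)" if "y \<in> rep_dom c f e" for y
    using that N e by (simp add: rep_dom_def)
  show "?T \<subseteq> rep_dom c (g \<circ> f) d"
  proof
    fix y assume y: "y \<in> ?T"
    then have "g (chart_inv e (?F y)) \<in> fst d"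
      unfolding rep_dom_def[of e] by blast
    with y show "y \<in> rep_dom c (g \<circ> f) d"
      by (simp add: inv del: comp_apply) (simp add: rep_dom_def)
  qed
  show "?T \<subseteq> rep_dom c f e" by blast
  show "\<forall>y\<in>?T. ?F y \<in> rep_dom e g d"
    by simp
  show "\<forall>y\<in>?T. (snd d \<circ> g \<circ> chart_inv e) (?F y) = (snd d \<circ> (g \<circ> f) \<circ> chart_inv c) y"
    using inv by (simp add: comp_def)
qed

text \<open>No single chart of \<open>N\<close> has to contain the relevant image, so openness and
  smoothness are verified near each point, with a chart \<open>e\<close> chosen at its
  image.\<close>

lemma smooth_map_compose:
  fixes M :: "('a, 'e::real_normed_vector) atlas" and N :: "('b, 'f::real_normed_vector) atlas"
    and P :: "('c, 'h::real_normed_vector) atlas"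
  assumes M: "smooth_atlas M" and N: "smooth_atlas N"
    and f: "smooth_map M N f" and g: "smooth_map N P g"
  shows "smooth_map M P (g \<circ> f)"
  unfolding smooth_map_iff[OF M]
proof (intro conjI ballI)
  show "(g \<circ> f) ` pts M \<subseteq> pts P"
    using smooth_map_mem[OF f] smooth_map_mem[OF g] by auto
  fix c d assume c: "c \<in> M" and d: "d \<in> P"
  let ?R = "snd d \<circ> (g \<circ> f) \<circ> chart_inv c"
  have loc: "\<exists>T. open T \<and> x \<in> T \<and> T \<subseteq> rep_dom c (g \<circ> f) d \<and> smooth_on T ?R"
    if x: "x \<in> rep_dom c (g \<circ> f) d" for x
  proof -
    have "f (chart_inv c x) \<in> pts N"
      using x by (auto simp: rep_dom_def intro!: smooth_map_mem[OF f] mem_pts[OF c] chart_inv_mem)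
    then obtain e where e: "e \<in> N" "f (chart_inv c x) \<in> fst e"
      by (auto simp: pts_def)
    have xe: "x \<in> rep_dom c f e"
      using x e by (simp add: rep_dom_def)
    obtain T where T: "open T" "x \<in> T" "T \<subseteq> rep_dom c (g \<circ> f) d" "T \<subseteq> rep_dom c f e"
      "\<forall>y\<in>T. (snd e \<circ> f \<circ> chart_inv c) y \<in> rep_dom e g d"
      "\<forall>y\<in>T. (snd d \<circ> g \<circ> chart_inv e) ((snd e \<circ> f \<circ> chart_inv c) y) = ?R y"
      by (rule rep_compose_local[OF M N f g c e(1) d xe x])
    have "smooth_on T (\<lambda>y. (snd d \<circ> g \<circ> chart_inv e) ((snd e \<circ> f \<circ> chart_inv c) y))"
      by (rule smooth_on_compose[OF smooth_atlas_finite_dim[OF N] T(1) smooth_map_open[OF N g e(1) d]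
            bspec[OF T(5)] smooth_on_subset[OF T(4) smooth_map_smooth_on[OF M f c e(1)]]
            smooth_map_smooth_on[OF N g e(1) d]])
    then have "smooth_on T ?R"
      by (rule smooth_on_cong[OF T(1), where f = "\<lambda>y. (snd d \<circ> g \<circ> chart_inv e) ((snd e \<circ> f \<circ> chart_inv c) y)", rotated])
        (rule T(6)[THEN bspec])
    then show ?thesis
      using T(1-3) by (intro exI[of _ T]) simp
  qed
  show "open (rep_dom c (g \<circ> f) d)"
  proof (rule Topological_Spaces.openI)
    fix x assume "x \<in> rep_dom c (g \<circ> f) d"
    from loc[OF this] show "\<exists>T. open T \<and> x \<in> T \<and> T \<subseteq> rep_dom c (g \<circ> f) d" by blast
  qed
  show "smooth_on (rep_dom c (g \<circ> f) d) ?R"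
  proof (rule smooth_on_local)
    fix x assume "x \<in> rep_dom c (g \<circ> f) d"
    from loc[OF this] show "\<exists>T. open T \<and> x \<in> T \<and> smooth_on T ?R" by blast
  qed
qed

lemma smooth_map_const:
  assumes M: "smooth_atlas M" and q: "q \<in> pts N"
  shows "smooth_map M N (\<lambda>_. q)"
  unfolding smooth_map_iff[OF M]
proof (intro conjI ballI)
  fix c d assume "c \<in> M" "d \<in> N"
  then show "open (rep_dom c (\<lambda>_. q) d)"
    using smooth_atlas_open[OF M] by (cases "q \<in> fst d") (simp_all add: rep_dom_def)
  show "smooth_on (rep_dom c (\<lambda>_. q) d) (snd d \<circ> (\<lambda>_. q) \<circ> chart_inv c)"
    by (simp add: comp_def smooth_on_const)
qed (use q in auto)

section \<open>Products of atlases\<close>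

lemma product_atlasI:
  "c \<in> M \<Longrightarrow> d \<in> N \<Longrightarrow> (fst c \<times> fst d, map_prod (snd c) (snd d)) \<in> product_atlas M N"
  unfolding product_atlas_def by blast

lemma pts_product_atlas: "pts (product_atlas M N) = pts M \<times> pts N"
proof (intro equalityI subsetI)
  fix z assume "z \<in> pts M \<times> pts N"
  then obtain c d where "c \<in> M" "d \<in> N" "z \<in> fst c \<times> fst d"
    by (auto simp: pts_def)
  then show "z \<in> pts (product_atlas M N)"
    by (intro mem_pts[OF product_atlasI]) simp_all
qed (auto simp: pts_def product_atlas_def)

lemma smooth_map_Pair:
  assumes M: "smooth_atlas M" and f: "smooth_map M N f" and g: "smooth_map M P g"
  shows "smooth_map M (product_atlas N P) (\<lambda>x. (f x, g x))"
  unfolding smooth_map_iff[OF M]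
proof (intro conjI ballI)
  show "(\<lambda>x. (f x, g x)) ` pts M \<subseteq> pts (product_atlas N P)"
    using smooth_map_mem[OF f] smooth_map_mem[OF g]
    by (auto simp: pts_product_atlas)
  fix c d assume c: "c \<in> M" and "d \<in> product_atlas N P"
  then obtain a b where d: "d = (fst a \<times> fst b, map_prod (snd a) (snd b))" "a \<in> N" "b \<in> P"
    by (auto simp: product_atlas_def)
  have dom: "rep_dom c (\<lambda>x. (f x, g x)) d = rep_dom c f a \<inter> rep_dom c g b"
    by (auto simp: rep_dom_def d)
  show op: "open (rep_dom c (\<lambda>x. (f x, g x)) d)"
    unfolding dom by (intro open_Int smooth_map_open[OF M f c d(2)] smooth_map_open[OF M g c d(3)])
  have "smooth_on (rep_dom c (\<lambda>x. (f x, g x)) d) (\<lambda>x. ((snd a \<circ> f \<circ> chart_inv c) x, (snd b \<circ> g \<circ> chart_inv c) x))"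
    by (intro smooth_on_Pair op) (auto simp only: dom intro: smooth_on_subset[OF Int_lower1 smooth_map_smooth_on[OF M f c d(2)]]
        smooth_on_subset[OF Int_lower2 smooth_map_smooth_on[OF M g c d(3)]])
  then show "smooth_on (rep_dom c (\<lambda>x. (f x, g x)) d) (snd d \<circ> (\<lambda>x. (f x, g x)) \<circ> chart_inv c)"
    by (simp add: d comp_def)
qed

lemma smooth_on_Times_fst:
  fixes f :: "'a::real_normed_vector \<Rightarrow> 'c::real_normed_vector" and V :: "'b::real_normed_vector set"
  assumes "finite_dim TYPE('a)" "open U" "open V" "smooth_on U f"
  shows "smooth_on (U \<times> V) (\<lambda>z. f (fst z))"
proof (rule smooth_on_compose[OF assms(1) _ assms(2) _ _ assms(4)])
  show op: "open (U \<times> V)" using assms by (simp add: open_Times)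
  show "smooth_on (U \<times> V) (\<lambda>z. fst z)" by (rule smooth_on_fst[OF op smooth_on_id])
qed auto

lemma smooth_on_Times_snd:
  fixes f :: "'b::real_normed_vector \<Rightarrow> 'c::real_normed_vector" and U :: "'a::real_normed_vector set"
  assumes "finite_dim TYPE('b)" "open U" "open V" "smooth_on V f"
  shows "smooth_on (U \<times> V) (\<lambda>z. f (snd z))"
proof (rule smooth_on_compose[OF assms(1) _ assms(3) _ _ assms(4)])
  show op: "open (U \<times> V)" using assms by (simp add: open_Times)
  show "smooth_on (U \<times> V) (\<lambda>z. snd z)" by (rule smooth_on_snd[OF op smooth_on_id])
qed auto

lemma chart_inv_product:
  assumes "smooth_atlas M" "smooth_atlas N" "c \<in> M" "d \<in> N"
    and "x \<in> snd c ` fst c" "y \<in> snd d ` fst d"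
  shows "chart_inv (fst c \<times> fst d, map_prod (snd c) (snd d)) (x, y) = (chart_inv c x, chart_inv d y)"
proof (rule chart_inv_unique)
  show "inj_on (snd (fst c \<times> fst d, map_prod (snd c) (snd d))) (fst (fst c \<times> fst d, map_prod (snd c) (snd d)))"
    using assms map_prod_inj_on[of "snd c" "fst c" "snd d" "fst d"] by (simp add: smooth_atlas_def)
qed (use assms in \<open>auto simp: chart_inv_mem\<close>)

lemma image_product_chart:
  "snd (fst c \<times> fst d, map_prod (snd c) (snd d)) ` fst (fst c \<times> fst d, map_prod (snd c) (snd d))
    = snd c ` fst c \<times> snd d ` fst d"
  by force

lemma smooth_atlas_product:
  fixes M :: "('a, 'e::real_normed_vector) atlas" and N :: "('b, 'f::real_normed_vector) atlas"
  assumes M: "smooth_atlas M" and N: "smooth_atlas N"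
  shows "smooth_atlas (product_atlas M N)"
  unfolding smooth_atlas_def
proof (intro conjI ballI)
  show "finite_dim TYPE('e \<times> 'f)"
    using M N by (intro finite_dim_prod smooth_atlas_finite_dim)
  fix C assume "C \<in> product_atlas M N"
  then obtain c d where C: "C = (fst c \<times> fst d, map_prod (snd c) (snd d))" "c \<in> M" "d \<in> N"
    by (auto simp: product_atlas_def)
  show inj: "inj_on (snd C) (fst C)"
    using M N C map_prod_inj_on[of "snd c" "fst c" "snd d" "fst d"] by (simp add: smooth_atlas_def)
  have im: "snd C ` fst C = snd c ` fst c \<times> snd d ` fst d"
    unfolding C(1) by (rule image_product_chart)
  show "open (snd C ` fst C)"
    unfolding im using M N C by (intro open_Times smooth_atlas_open)
  fix C' assume "C' \<in> product_atlas M N"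
  then obtain c' d' where C': "C' = (fst c' \<times> fst d', map_prod (snd c') (snd d'))" "c' \<in> M" "d' \<in> N"
    by (auto simp: product_atlas_def)
  let ?U = "snd c ` (fst c \<inter> fst c')" and ?V = "snd d ` (fst d \<inter> fst d')"
  have dom: "snd C ` (fst C \<inter> fst C') = ?U \<times> ?V"
    unfolding C(1) C'(1) by force
  have op: "open ?U" "open ?V"
    using M N C C' by (simp_all add: smooth_atlas_def)
  show op': "open (snd C ` (fst C \<inter> fst C'))"
    unfolding dom by (intro open_Times op)
  have "smooth_on (?U \<times> ?V) (\<lambda>z. ((snd c' \<circ> chart_inv c) (fst z), (snd d' \<circ> chart_inv d) (snd z)))"
  proof (rule smooth_on_Pair[OF open_Times[OF op]])
    show "smooth_on (?U \<times> ?V) (\<lambda>z. (snd c' \<circ> chart_inv c) (fst z))"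
      by (rule smooth_on_Times_fst[OF smooth_atlas_finite_dim[OF M] op smooth_atlas_transition[OF M C(2) C'(2)]])
    show "smooth_on (?U \<times> ?V) (\<lambda>z. (snd d' \<circ> chart_inv d) (snd z))"
      by (rule smooth_on_Times_snd[OF smooth_atlas_finite_dim[OF N] op smooth_atlas_transition[OF N C(3) C'(3)]])
  qed
  then show "smooth_on (snd C ` (fst C \<inter> fst C')) (snd C' \<circ> chart_inv C)"
    unfolding dom
    by (rule smooth_on_cong[rotated 2]) (use op in \<open>auto intro!: open_Times simp: C C' chart_inv_product[OF M N C(2,3)]\<close>)
qed

text \<open>In product charts the projection is a chart change of the first factor applied to the
  first coordinate.\<close>

lemma smooth_map_fst:
  fixes M :: "('a, 'e::real_normed_vector) atlas" and N :: "('b, 'f::real_normed_vector) atlas"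
  assumes M: "smooth_atlas M" and N: "smooth_atlas N"
  shows "smooth_map (product_atlas M N) M fst"
  unfolding smooth_map_iff[OF smooth_atlas_product[OF M N]]
proof (intro conjI ballI)
  fix C c' assume "C \<in> product_atlas M N" and c': "c' \<in> M"
  then obtain c d where C: "C = (fst c \<times> fst d, map_prod (snd c) (snd d))" "c \<in> M" "d \<in> N"
    by (auto simp: product_atlas_def)
  have dom: "rep_dom C fst c' = rep_dom c id c' \<times> snd d ` fst d"
    unfolding rep_dom_def C(1) image_product_chart using chart_inv_product[OF M N C(2,3)] by auto
  have op: "open (rep_dom c id c')" "open (snd d ` fst d)"
    using smooth_map_open[OF M smooth_map_id[OF M] C(2) c'] smooth_atlas_open[OF N C(3)] .
  then show "open (rep_dom C fst c')"
    unfolding dom by (intro open_Times)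
  have "smooth_on (rep_dom c id c' \<times> snd d ` fst d) (\<lambda>z. (snd c' \<circ> id \<circ> chart_inv c) (fst z))"
    by (rule smooth_on_Times_fst[OF smooth_atlas_finite_dim[OF M] op
          smooth_map_smooth_on[OF M smooth_map_id[OF M] C(2) c']])
  then show "smooth_on (rep_dom C fst c') (snd c' \<circ> fst \<circ> chart_inv C)"
    unfolding dom
    by (rule smooth_on_cong[rotated 2])
      (use op in \<open>auto intro!: open_Times simp: C rep_dom_def chart_inv_product[OF M N C(2,3)]\<close>)
qed (auto simp: pts_product_atlas)

lemma smooth_map_snd:
  fixes M :: "('a, 'e::real_normed_vector) atlas" and N :: "('b, 'f::real_normed_vector) atlas"
  assumes M: "smooth_atlas M" and N: "smooth_atlas N"
  shows "smooth_map (product_atlas M N) N snd"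
  unfolding smooth_map_iff[OF smooth_atlas_product[OF M N]]
proof (intro conjI ballI)
  fix C d' assume "C \<in> product_atlas M N" and d': "d' \<in> N"
  then obtain c d where C: "C = (fst c \<times> fst d, map_prod (snd c) (snd d))" "c \<in> M" "d \<in> N"
    by (auto simp: product_atlas_def)
  have dom: "rep_dom C snd d' = snd c ` fst c \<times> rep_dom d id d'"
    unfolding rep_dom_def C(1) image_product_chart using chart_inv_product[OF M N C(2,3)] by auto
  have op: "open (rep_dom d id d')" "open (snd c ` fst c)"
    using smooth_map_open[OF N smooth_map_id[OF N] C(3) d'] smooth_atlas_open[OF M C(2)] .
  then show "open (rep_dom C snd d')"
    unfolding dom by (intro open_Times)
  have "smooth_on (snd c ` fst c \<times> rep_dom d id d') (\<lambda>z. (snd d' \<circ> id \<circ> chart_inv d) (snd z))"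
    by (rule smooth_on_Times_snd[OF smooth_atlas_finite_dim[OF N] op(2,1)
          smooth_map_smooth_on[OF N smooth_map_id[OF N] C(3) d']])
  then show "smooth_on (rep_dom C snd d') (snd d' \<circ> snd \<circ> chart_inv C)"
    unfolding dom
    by (rule smooth_on_cong[rotated 2])
      (use op in \<open>auto intro!: open_Times simp: C rep_dom_def chart_inv_product[OF M N C(2,3)]\<close>)
qed (auto simp: pts_product_atlas)

section \<open>Tangent maps\<close>

text \<open>The Jacobian of \<open>f\<close> at \<open>p\<close> in the two charts. For
  \<open>f = id\<close> it is the Jacobian of a chart change, which relates the components of a
  tangent vector.\<close>

definition chart_deriv ::
  "('a \<Rightarrow> 'b) \<Rightarrow> ('a, 'e::real_normed_vector) chart \<Rightarrow> ('b, 'f::real_normed_vector) chart \<Rightarrow> 'a \<Rightarrow> 'e \<Rightarrow> 'f" where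
  "chart_deriv f c d p = frechet_derivative (snd d \<circ> f \<circ> chart_inv c) (at (snd c p))"

lemma charts_atD: "c \<in> charts_at M p \<Longrightarrow> c \<in> M" "c \<in> charts_at M p \<Longrightarrow> p \<in> fst c"
  by (auto simp: charts_at_def)

lemma charts_atI: "c \<in> M \<Longrightarrow> p \<in> fst c \<Longrightarrow> c \<in> charts_at M p"
  by (simp add: charts_at_def)

lemma some_chart_mem: "p \<in> pts M \<Longrightarrow> some_chart M p \<in> charts_at M p"
  unfolding some_chart_def by (rule someI_ex) (auto simp: pts_def charts_at_def)

lemma charts_at_pts: "c \<in> charts_at M p \<Longrightarrow> p \<in> pts M"
  by (auto simp: pts_def charts_at_def)

lemma rep_has_derivative:
  assumes "smooth_atlas M" "smooth_map M N f" "c \<in> charts_at M p" "d \<in> charts_at N (f p)"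
  shows "(snd d \<circ> f \<circ> chart_inv c has_derivative chart_deriv f c d p) (at (snd c p))"
  unfolding chart_deriv_def
proof (rule has_derivative_frechet)
  have "snd c p \<in> rep_dom c f d"
    using assms by (simp add: rep_dom_def charts_at_def)
  then show "(snd d \<circ> f \<circ> chart_inv c) differentiable (at (snd c p))"
    by (rule smooth_on_differentiable[OF smooth_map_smooth_on[OF assms(1,2) charts_atD(1)[OF assms(3)]
          charts_atD(1)[OF assms(4)]]])
qed

lemma linear_chart_deriv:
  assumes "smooth_atlas M" "smooth_map M N f" "c \<in> charts_at M p" "d \<in> charts_at N (f p)"
  shows "linear (chart_deriv f c d p)"
  using rep_has_derivative[OF assms] by (rule has_derivative_linear)

lemma chart_deriv_cong:
  assumes M: "smooth_atlas M" and f: "smooth_map M N f" and eq: "\<And>q. q \<in> pts M \<Longrightarrow> f q = g q"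
    and c: "c \<in> charts_at M p" and d: "d \<in> charts_at N (f p)"
  shows "chart_deriv f c d p = chart_deriv g c d p"
proof -
  have "(snd d \<circ> g \<circ> chart_inv c has_derivative chart_deriv f c d p) (at (snd c p))"
  proof (rule has_derivative_transform_within_open[OF rep_has_derivative[OF M f c d]])
    show "open (snd c ` fst c)" "snd c p \<in> snd c ` fst c"
      using M c by (auto simp: charts_at_def smooth_atlas_open)
    show "(snd d \<circ> f \<circ> chart_inv c) x = (snd d \<circ> g \<circ> chart_inv c) x" if "x \<in> snd c ` fst c" for x
      using eq[OF mem_pts[OF charts_atD(1)[OF c] chart_inv_mem[OF that]]] by simp
  qed
  then show ?thesis
    unfolding chart_deriv_def[of g] by (rule frechet_derivative_eq[symmetric])
qed

text \<open>The representative of \<open>g o f\<close> factors through \<open>e\<close> only near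
  \<open>snd c p\<close>, so the ordinary chain rule is transferred on the open set
  \<open>T\<close>.\<close>

lemma chart_deriv_compose:
  assumes M: "smooth_atlas M" and N: "smooth_atlas N"
    and f: "smooth_map M N f" and g: "smooth_map N P g"
    and c: "c \<in> charts_at M p" and e: "e \<in> charts_at N (f p)" and d: "d \<in> charts_at P (g (f p))"
  shows "chart_deriv (g \<circ> f) c d p v = chart_deriv g e d (f p) (chart_deriv f c e p v)"
proof -
  let ?F = "snd e \<circ> f \<circ> chart_inv c" and ?G = "snd d \<circ> g \<circ> chart_inv e"
  have x: "snd c p \<in> rep_dom c f e" "snd c p \<in> rep_dom c (g \<circ> f) d"
    using M c e d by (auto simp: rep_dom_def charts_at_def)
  obtain T where T: "open T" "snd c p \<in> T" "T \<subseteq> rep_dom c (g \<circ> f) d" "T \<subseteq> rep_dom c f e"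
    "\<forall>y\<in>T. ?F y \<in> rep_dom e g d"
    "\<forall>y\<in>T. ?G (?F y) = (snd d \<circ> (g \<circ> f) \<circ> chart_inv c) y"
    by (rule rep_compose_local[OF M N f g charts_atD(1)[OF c] charts_atD(1)[OF e] charts_atD(1)[OF d] x])
  have Fp: "?F (snd c p) = snd e (f p)"
    using M c by (simp add: charts_at_def)
  have "((\<lambda>y. ?G (?F y)) has_derivative (\<lambda>v. chart_deriv g e d (f p) (chart_deriv f c e p v))) (at (snd c p))"
    using has_derivative_compose[OF rep_has_derivative[OF M f c e], of ?G "chart_deriv g e d (f p)"]
      rep_has_derivative[OF N g e d] unfolding Fp by blast
  then have "(snd d \<circ> (g \<circ> f) \<circ> chart_inv c has_derivative
      (\<lambda>v. chart_deriv g e d (f p) (chart_deriv f c e p v))) (at (snd c p))"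
    using T(6) by (elim has_derivative_transform_within_open[OF _ T(1,2)]) blast
  then show ?thesis
    unfolding chart_deriv_def[of "g \<circ> f"] by (simp add: frechet_derivative_eq)
qed

lemma chart_deriv_id_self:
  assumes "smooth_atlas M" "c \<in> charts_at M p"
  shows "chart_deriv id c c p v = v"
proof -
  have "(snd c \<circ> id \<circ> chart_inv c has_derivative (\<lambda>v. v)) (at (snd c p))"
  proof (rule has_derivative_transform_within_open[OF has_derivative_ident])
    show "open (snd c ` fst c)" "snd c p \<in> snd c ` fst c"
      using assms by (auto simp: charts_at_def smooth_atlas_open)
  qed simp
  then show ?thesis
    unfolding chart_deriv_def by (simp add: frechet_derivative_eq)
qed

lemma tangent_space_iff:
  "v \<in> tangent_space M p \<longleftrightarrow>
    (\<forall>c\<in>charts_at M p. \<forall>d\<in>charts_at M p. v d = chart_deriv id c d p (v c)) \<and>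
    (\<forall>c. c \<notin> charts_at M p \<longrightarrow> v c = 0)"
  by (simp add: tangent_space_def chart_deriv_def)

lemma tangent_spaceI:
  assumes "\<And>c d. c \<in> charts_at M p \<Longrightarrow> d \<in> charts_at M p \<Longrightarrow> chart_deriv id c d p (v c) = v d"
    and "\<And>c. c \<notin> charts_at M p \<Longrightarrow> v c = 0"
  shows "v \<in> tangent_space M p"
  using assms unfolding tangent_space_iff by metis

lemma tangent_space_change:
  assumes "v \<in> tangent_space M p" "c \<in> charts_at M p" "d \<in> charts_at M p"
  shows "chart_deriv id c d p (v c) = v d"
  using assms unfolding tangent_space_iff by metis

lemma tangent_space_off: "v \<in> tangent_space M p \<Longrightarrow> c \<notin> charts_at M p \<Longrightarrow> v c = 0"
  unfolding tangent_space_iff by blast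

lemma tangent_of_chart_eq:
  "tangent_of_chart M c p w = (\<lambda>d. if d \<in> charts_at M p then chart_deriv id c d p w else 0)"
  unfolding tangent_of_chart_def chart_deriv_def comp_id ..

lemma tangent_map_eq:
  "tangent_map M N f p v = (\<lambda>d. if d \<in> charts_at N (f p)
     then chart_deriv f (some_chart M p) d p (v (some_chart M p)) else 0)"
  unfolding tangent_map_def chart_deriv_def Let_def ..

lemma tangent_of_chart_apply:
  "smooth_atlas M \<Longrightarrow> c \<in> charts_at M p \<Longrightarrow> tangent_of_chart M c p w c = w"
  by (simp add: tangent_of_chart_eq chart_deriv_id_self)

text \<open>The chain rule for \<open>id o id\<close> is the cocycle identity for the Jacobians of
  chart changes.\<close>

lemma tangent_of_chart_mem:
  assumes M: "smooth_atlas M" and c: "c \<in> charts_at M p"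
  shows "tangent_of_chart M c p w \<in> tangent_space M p"
proof (rule tangent_spaceI)
  fix e d assume e: "e \<in> charts_at M p" and d: "d \<in> charts_at M p"
  have "chart_deriv (id \<circ> id) c d p w = chart_deriv id e d (id p) (chart_deriv id c e p w)"
    by (rule chart_deriv_compose[OF M M smooth_map_id[OF M] smooth_map_id[OF M] c]) (simp_all add: e d)
  then show "chart_deriv id e d p (tangent_of_chart M c p w e) = tangent_of_chart M c p w d"
    by (simp add: tangent_of_chart_eq e d)
qed (simp add: tangent_of_chart_eq)

lemma tangent_of_chart_self:
  assumes "v \<in> tangent_space M p" "c \<in> charts_at M p"
  shows "tangent_of_chart M c p (v c) = v"
  using tangent_space_change[OF assms] tangent_space_off[OF assms(1)]
  by (auto simp: tangent_of_chart_eq fun_eq_iff)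

text \<open>The component in one chart rebuilds the whole vector through
  \<open>tangent_of_chart\<close>; identities between tangent vectors are reduced to one component
  in this way.\<close>

lemma tangent_space_eqI:
  assumes "u \<in> tangent_space M p" "v \<in> tangent_space M p" "c \<in> charts_at M p" "u c = v c"
  shows "u = v"
  using tangent_of_chart_self[OF assms(1,3)] tangent_of_chart_self[OF assms(2,3)] assms(4) by metis

lemma tangent_space_add:
  assumes M: "smooth_atlas M" and "u \<in> tangent_space M p" "v \<in> tangent_space M p"
  shows "(\<lambda>c. u c + v c) \<in> tangent_space M p"
  using assms linear_add[OF linear_chart_deriv[OF M smooth_map_id[OF M]]]
  by (intro tangent_spaceI) (simp_all add: tangent_space_change tangent_space_off)

lemma tangent_space_scale:
  assumes M: "smooth_atlas M" and "v \<in> tangent_space M p"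
  shows "(\<lambda>c. r *\<^sub>R v c) \<in> tangent_space M p"
  using assms linear_scale[OF linear_chart_deriv[OF M smooth_map_id[OF M]]]
  by (intro tangent_spaceI) (simp_all add: tangent_space_change tangent_space_off)

text \<open>Removes the arbitrary \<open>some_chart\<close> from the definition: apply the chain
  rule to \<open>f o id\<close>, with \<open>id\<close> read from \<open>c\<close> to the chosen
  chart.\<close>

lemma tangent_map_apply:
  assumes M: "smooth_atlas M" and f: "smooth_map M N f" and v: "v \<in> tangent_space M p"
    and c: "c \<in> charts_at M p" and d: "d \<in> charts_at N (f p)"
  shows "tangent_map M N f p v d = chart_deriv f c d p (v c)"
proof -
  let ?s = "some_chart M p"
  have s: "?s \<in> charts_at M p"
    by (rule some_chart_mem[OF charts_at_pts[OF c]])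
  have "chart_deriv f c d p (v c) = chart_deriv f ?s d p (chart_deriv id c ?s p (v c))"
    using chart_deriv_compose[OF M M smooth_map_id[OF M] f c, of ?s d "v c"] s d by simp
  also have "chart_deriv id c ?s p (v c) = v ?s"
    by (rule tangent_space_change[OF v c s])
  finally show ?thesis
    using d by (simp add: tangent_map_eq)
qed

lemma tangent_map_mem:
  assumes M: "smooth_atlas M" and N: "smooth_atlas N" and f: "smooth_map M N f"
    and p: "p \<in> pts M"
  shows "tangent_map M N f p v \<in> tangent_space N (f p)"
proof (rule tangent_spaceI)
  fix e d assume e: "e \<in> charts_at N (f p)" and d: "d \<in> charts_at N (f p)"
  let ?s = "some_chart M p"
  have "chart_deriv (id \<circ> f) ?s d p (v ?s) = chart_deriv id e d (f p) (chart_deriv f ?s e p (v ?s))"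
    by (rule chart_deriv_compose[OF M N f smooth_map_id[OF N] some_chart_mem[OF p]]) (simp_all add: e d)
  then show "chart_deriv id e d (f p) (tangent_map M N f p v e) = tangent_map M N f p v d"
    by (simp add: tangent_map_eq e d)
qed (simp add: tangent_map_eq)

lemma tangent_map_compose:
  assumes M: "smooth_atlas M" and N: "smooth_atlas N"
    and f: "smooth_map M N f" and g: "smooth_map N P g"
    and p: "p \<in> pts M"
  shows "tangent_map M P (g \<circ> f) p v = tangent_map N P g (f p) (tangent_map M N f p v)"
proof -
  have s: "some_chart N (f p) \<in> charts_at N (f p)"
    by (rule some_chart_mem[OF smooth_map_mem[OF f p]])
  show ?thesis
    using chart_deriv_compose[OF M N f g some_chart_mem[OF p] s] s
    by (simp add: tangent_map_eq fun_eq_iff)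
qed

lemma tangent_map_cong:
  assumes M: "smooth_atlas M" and f: "smooth_map M N f" and eq: "\<And>q. q \<in> pts M \<Longrightarrow> f q = g q"
    and p: "p \<in> pts M"
  shows "tangent_map M N f p v = tangent_map M N g p v"
  using chart_deriv_cong[OF M f eq some_chart_mem[OF p]] eq[OF p]
  by (simp add: tangent_map_eq fun_eq_iff)

lemma tangent_map_id:
  assumes M: "smooth_atlas M" and p: "p \<in> pts M" and v: "v \<in> tangent_space M p"
    and eq: "\<And>q. q \<in> pts M \<Longrightarrow> f q = q"
  shows "tangent_map M M f p v = v"
proof -
  have "tangent_map M M f p v = tangent_map M M id p v"
    by (rule tangent_map_cong[OF M smooth_map_id[OF M] _ p, symmetric]) (simp add: eq)
  also have "\<dots> = v"
    using tangent_space_change[OF v some_chart_mem[OF p]] tangent_space_off[OF v]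
    by (auto simp: tangent_map_eq fun_eq_iff)
  finally show ?thesis .
qed

lemma tangent_map_add:
  assumes M: "smooth_atlas M" and f: "smooth_map M N f" and p: "p \<in> pts M"
  shows "tangent_map M N f p (\<lambda>c. u c + v c) = (\<lambda>d. tangent_map M N f p u d + tangent_map M N f p v d)"
  using linear_add[OF linear_chart_deriv[OF M f some_chart_mem[OF p]]]
  by (auto simp: tangent_map_eq fun_eq_iff)

lemma tangent_map_scale:
  assumes M: "smooth_atlas M" and f: "smooth_map M N f" and p: "p \<in> pts M"
  shows "tangent_map M N f p (\<lambda>c. r *\<^sub>R v c) = (\<lambda>d. r *\<^sub>R tangent_map M N f p v d)"
  using linear_scale[OF linear_chart_deriv[OF M f some_chart_mem[OF p]]]
  by (auto simp: tangent_map_eq fun_eq_iff)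

lemma tangent_of_chart_add:
  assumes M: "smooth_atlas M" and c: "c \<in> charts_at M p"
  shows "tangent_of_chart M c p (u + v) = (\<lambda>d. tangent_of_chart M c p u d + tangent_of_chart M c p v d)"
  using linear_add[OF linear_chart_deriv[OF M smooth_map_id[OF M] c]]
  by (simp add: tangent_of_chart_eq fun_eq_iff)

lemma tangent_of_chart_scale:
  assumes M: "smooth_atlas M" and c: "c \<in> charts_at M p"
  shows "tangent_of_chart M c p (r *\<^sub>R v) = (\<lambda>d. r *\<^sub>R tangent_of_chart M c p v d)"
  using linear_scale[OF linear_chart_deriv[OF M smooth_map_id[OF M] c]]
  by (simp add: tangent_of_chart_eq fun_eq_iff)

lemma tangent_map_of_chart:
  assumes M: "smooth_atlas M" and N: "smooth_atlas N" and f: "smooth_map M N f"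
    and c: "c \<in> charts_at M p" and d: "d \<in> charts_at N (f p)"
  shows "tangent_map M N f p (tangent_of_chart M c p w) = tangent_of_chart N d (f p) (chart_deriv f c d p w)"
proof (rule tangent_space_eqI[OF _ _ d])
  show "tangent_map M N f p (tangent_of_chart M c p w) \<in> tangent_space N (f p)"
    by (rule tangent_map_mem[OF M N f charts_at_pts[OF c]])
  show "tangent_of_chart N d (f p) (chart_deriv f c d p w) \<in> tangent_space N (f p)"
    by (rule tangent_of_chart_mem[OF N d])
  show "tangent_map M N f p (tangent_of_chart M c p w) d = tangent_of_chart N d (f p) (chart_deriv f c d p w) d"
    by (simp add: tangent_map_apply[OF M f tangent_of_chart_mem[OF M c] c d]
        tangent_of_chart_apply[OF M c] tangent_of_chart_apply[OF N d])
qed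

section \<open>Covectors in a chart\<close>

lemma cotangent_spaceD:
  assumes "\<alpha> \<in> cotangent_space M p"
  shows "u \<in> tangent_space M p \<Longrightarrow> v \<in> tangent_space M p \<Longrightarrow> \<alpha> (\<lambda>c. u c + v c) = \<alpha> u + \<alpha> v"
    and "v \<in> tangent_space M p \<Longrightarrow> \<alpha> (\<lambda>c. r *\<^sub>R v c) = r * \<alpha> v"
    and "v \<notin> tangent_space M p \<Longrightarrow> \<alpha> v = 0"
  using assms by (auto simp: cotangent_space_def)

text \<open>Covectors are only algebraically linear; boundedness comes from finite dimension and is
  what allows \<open>Blinfun\<close> to be evaluated.\<close>

lemma bounded_linear_covec_chart:
  fixes M :: "('a, 'e::real_normed_vector) atlas"
  assumes M: "smooth_atlas M" and c: "c \<in> charts_at M p" and \<alpha>: "\<alpha> \<in> cotangent_space M p"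
  shows "bounded_linear (\<lambda>w. \<alpha> (tangent_of_chart M c p w))"
proof (rule finite_dim_bounded_linear[OF smooth_atlas_finite_dim[OF M]], rule linearI)
  note mem = tangent_of_chart_mem[OF M c]
  show "\<alpha> (tangent_of_chart M c p (u + v)) = \<alpha> (tangent_of_chart M c p u) + \<alpha> (tangent_of_chart M c p v)" for u v
    unfolding tangent_of_chart_add[OF M c] by (rule cotangent_spaceD(1)[OF \<alpha> mem mem])
  show "\<alpha> (tangent_of_chart M c p (r *\<^sub>R v)) = r *\<^sub>R \<alpha> (tangent_of_chart M c p v)" for r v
    unfolding tangent_of_chart_scale[OF M c] real_scaleR_def by (rule cotangent_spaceD(2)[OF \<alpha> mem])
qed

section \<open>The cotangent bundle\<close>

text \<open>The common shape of the fibre component of a cotangent chart change and of the twisted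
  lift: a covector precomposed with a linear map, both depending on the point. Smoothness in each
  fixed direction \<open>w\<close> suffices, by \<open>smooth_on_blinfun\<close>.\<close>

lemma smooth_on_dual_apply:
  fixes L :: "'z::real_normed_vector \<Rightarrow> 'e::real_normed_vector \<Rightarrow> 'f::real_normed_vector"
    and P :: "'z \<Rightarrow> 'f \<Rightarrow>\<^sub>L real"
  assumes fin: "finite_dim TYPE('e)" and S: "open S" and P: "smooth_on S P"
    and L: "\<And>w. smooth_on S (\<lambda>z. L z w)" "\<And>z. z \<in> S \<Longrightarrow> linear (L z)"
  shows "smooth_on S (\<lambda>z. Blinfun (\<lambda>w. blinfun_apply (P z) (L z w)))"
proof (rule smooth_on_blinfun[OF fin S])
  fix w
  have bl: "bounded_linear (\<lambda>w. blinfun_apply (P z) (L z w))" if "z \<in> S" for z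
    by (rule bounded_linear_compose[OF blinfun.bounded_linear_right finite_dim_bounded_linear[OF fin L(2)[OF that]]])
  show "smooth_on S (\<lambda>z. blinfun_apply (Blinfun (\<lambda>w. blinfun_apply (P z) (L z w))) w)"
    by (rule smooth_on_cong[OF S _ smooth_on_bounded_bilinear[OF bounded_bilinear_blinfun_apply S P L(1)[of w]]])
      (simp add: bounded_linear_Blinfun_apply bl)
qed

lemma fst_cotangent_chart: "fst (cotangent_chart M c) = Sigma (fst c) (cotangent_space M)"
  by (simp add: cotangent_chart_def)

lemma snd_cotangent_chart:
  "snd (cotangent_chart M c) (q, \<alpha>) = (snd c q, Blinfun (\<lambda>w. \<alpha> (tangent_of_chart M c q w)))"
  by (simp add: cotangent_chart_def)

text \<open>The inverse of the fibre part of \<open>cotangent_chart\<close>, cut off to 0 outside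
  the tangent space as \<open>cotangent_space\<close> demands.\<close>

definition chart_covec ::
  "('a, 'e::real_normed_vector) atlas \<Rightarrow> ('a, 'e) chart \<Rightarrow> 'a \<Rightarrow> ('e \<Rightarrow>\<^sub>L real) \<Rightarrow> ('a, 'e) covec" where
  "chart_covec M c q p = (\<lambda>v. if v \<in> tangent_space M q then blinfun_apply p (v c) else 0)"

lemma chart_covec_mem:
  assumes "smooth_atlas M"
  shows "chart_covec M c q p \<in> cotangent_space M q"
  using tangent_space_add[OF assms] tangent_space_scale[OF assms]
  by (simp add: cotangent_space_def chart_covec_def blinfun.add_right blinfun.scaleR_right)

lemma chart_covec_tangent_of_chart:
  assumes "smooth_atlas M" "d \<in> charts_at M q" "c \<in> charts_at M q"
  shows "chart_covec M c q p (tangent_of_chart M d q w) = blinfun_apply p (chart_deriv id d c q w)"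
  using tangent_of_chart_mem[OF assms(1,2)] assms(3) by (simp add: chart_covec_def tangent_of_chart_eq)

lemma snd_cotangent_chart_covec:
  assumes "smooth_atlas M" "c \<in> charts_at M q"
  shows "snd (cotangent_chart M c) (q, chart_covec M c q p) = (snd c q, p)"
  using assms
  by (simp add: snd_cotangent_chart chart_covec_tangent_of_chart chart_deriv_id_self blinfun_apply_inverse)

lemma chart_covec_Blinfun:
  assumes "smooth_atlas M" "c \<in> charts_at M q" "\<alpha> \<in> cotangent_space M q"
  shows "chart_covec M c q (Blinfun (\<lambda>w. \<alpha> (tangent_of_chart M c q w))) = \<alpha>"
proof
  fix v
  show "chart_covec M c q (Blinfun (\<lambda>w. \<alpha> (tangent_of_chart M c q w))) v = \<alpha> v"
    using cotangent_spaceD(3)[OF assms(3), of v] tangent_of_chart_self[OF _ assms(2), of v]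
    by (simp add: chart_covec_def bounded_linear_Blinfun_apply[OF bounded_linear_covec_chart[OF assms]])
qed

lemma inj_on_cotangent_chart:
  assumes M: "smooth_atlas M" and c: "c \<in> M"
  shows "inj_on (snd (cotangent_chart M c)) (fst (cotangent_chart M c))"
proof (rule inj_onI)
  fix X Y assume X: "X \<in> fst (cotangent_chart M c)" and Y: "Y \<in> fst (cotangent_chart M c)"
    and eq: "snd (cotangent_chart M c) X = snd (cotangent_chart M c) Y"
  obtain q \<alpha> where X': "X = (q, \<alpha>)" "q \<in> fst c" "\<alpha> \<in> cotangent_space M q"
    using X by (auto simp: fst_cotangent_chart)
  obtain r \<beta> where Y': "Y = (r, \<beta>)" "r \<in> fst c" "\<beta> \<in> cotangent_space M r"
    using Y by (auto simp: fst_cotangent_chart)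
  have "snd c q = snd c r"
    using eq by (simp add: X' Y' snd_cotangent_chart)
  then have qr: "q = r"
    using chart_inv_chart[OF M c X'(2)] chart_inv_chart[OF M c Y'(2)] by metis
  have "Blinfun (\<lambda>w. \<alpha> (tangent_of_chart M c q w)) = Blinfun (\<lambda>w. \<beta> (tangent_of_chart M c r w))"
    using eq by (simp add: X' Y' snd_cotangent_chart)
  then have "\<alpha> = \<beta>"
    using chart_covec_Blinfun[OF M charts_atI[OF c X'(2)] X'(3)]
      chart_covec_Blinfun[OF M charts_atI[OF c Y'(2)] Y'(3)] qr by metis
  then show "X = Y" using X' Y' qr by simp
qed

text \<open>Every functional is attained through \<open>chart_covec\<close>. The set
  \<open>U\<close> is kept general so that the lemma serves both whole charts and overlaps of
  charts.\<close>

lemma image_cotangent_chart: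
  assumes M: "smooth_atlas M" and c: "c \<in> M" and U: "U \<subseteq> fst c"
  shows "snd (cotangent_chart M c) ` (Sigma U (cotangent_space M)) = snd c ` U \<times> UNIV"
proof (intro equalityI subsetI)
  fix z assume "z \<in> snd c ` U \<times> (UNIV :: ('b \<Rightarrow>\<^sub>L real) set)"
  then obtain q p where q: "z = (snd c q, p)" "q \<in> U" by auto
  then have "z = snd (cotangent_chart M c) (q, chart_covec M c q p)"
    using snd_cotangent_chart_covec[OF M charts_atI[OF c]] U by auto
  then show "z \<in> snd (cotangent_chart M c) ` (Sigma U (cotangent_space M))"
    using q(2) chart_covec_mem[OF M] by blast
qed (auto simp: snd_cotangent_chart)

lemma range_cotangent_chart:
  assumes M: "smooth_atlas M" and c: "c \<in> M"
  shows "snd (cotangent_chart M c) ` fst (cotangent_chart M c) = snd c ` fst c \<times> UNIV"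
  unfolding fst_cotangent_chart by (rule image_cotangent_chart[OF M c order_refl])

lemma chart_inv_cotangent:
  assumes M: "smooth_atlas M" and c: "c \<in> M" and x: "x \<in> snd c ` fst c"
  shows "chart_inv (cotangent_chart M c) (x, p) = (chart_inv c x, chart_covec M c (chart_inv c x) p)"
proof (rule chart_inv_unique[OF inj_on_cotangent_chart[OF M c]])
  show "(chart_inv c x, chart_covec M c (chart_inv c x) p) \<in> fst (cotangent_chart M c)"
    using chart_inv_mem[OF x] chart_covec_mem[OF M] by (simp add: fst_cotangent_chart)
  show "snd (cotangent_chart M c) (chart_inv c x, chart_covec M c (chart_inv c x) p) = (x, p)"
    using snd_cotangent_chart_covec[OF M charts_atI[OF c chart_inv_mem[OF x]]] x by simp
qed

lemma rep_dom_id: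
  assumes "smooth_atlas M" "c \<in> M"
  shows "snd c ` (fst c \<inter> fst d) = rep_dom c id d"
  using rep_dom_eq[OF assms, of id d] by simp

text \<open>With \<open>F\<close> the change from \<open>c\<close> to \<open>d\<close> and
  \<open>G\<close> the change back, a chart change of the bundle is
  \<open>(x, p) \<mapsto> (F x, p o DG(F x))\<close>.\<close>

lemma smooth_atlas_cotangent_bundle:
  fixes M :: "('a, 'e::real_normed_vector) atlas"
  assumes M: "smooth_atlas M"
  shows "smooth_atlas (cotangent_bundle M)"
  unfolding smooth_atlas_def
proof (intro conjI ballI)
  note fin = smooth_atlas_finite_dim[OF M]
  show "finite_dim TYPE('e \<times> ('e \<Rightarrow>\<^sub>L real))"
    by (intro finite_dim_prod finite_dim_dual fin)
  fix C assume "C \<in> cotangent_bundle M"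
  then obtain c where C: "C = cotangent_chart M c" "c \<in> M"
    by (auto simp: cotangent_bundle_def)
  show "inj_on (snd C) (fst C)"
    unfolding C(1) by (rule inj_on_cotangent_chart[OF M C(2)])
  show "open (snd C ` fst C)"
    unfolding C(1) range_cotangent_chart[OF M C(2)]
    by (intro open_Times open_UNIV smooth_atlas_open[OF M C(2)])
  fix D assume "D \<in> cotangent_bundle M"
  then obtain d where D: "D = cotangent_chart M d" "d \<in> M"
    by (auto simp: cotangent_bundle_def)
  let ?U = "rep_dom c id d"
  have "fst C \<inter> fst D = Sigma (fst c \<inter> fst d) (cotangent_space M)"
    by (auto simp: C(1) D(1) fst_cotangent_chart)
  then have dom: "snd C ` (fst C \<inter> fst D) = ?U \<times> UNIV"
    using image_cotangent_chart[OF M C(2), of "fst c \<inter> fst d"] rep_dom_id[OF M C(2), of d]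
    by (simp add: C(1))
  have op: "open ?U" "open (rep_dom d id c)"
    using smooth_map_open[OF M smooth_map_id[OF M]] C D by auto
  have op': "open (?U \<times> (UNIV :: ('e \<Rightarrow>\<^sub>L real) set))"
    by (intro open_Times op open_UNIV)
  then show "open (snd C ` (fst C \<inter> fst D))"
    unfolding dom .
  let ?F = "snd d \<circ> id \<circ> chart_inv c" and ?G = "snd c \<circ> id \<circ> chart_inv d"
  have F: "smooth_on ?U ?F" and G: "smooth_on (rep_dom d id c) ?G"
    using smooth_map_smooth_on[OF M smooth_map_id[OF M]] C D by blast+
  have FU: "?F x \<in> rep_dom d id c" if "x \<in> ?U" for x
    using that M C D by (auto simp: rep_dom_def)
  let ?W = "?U \<times> (UNIV :: ('e \<Rightarrow>\<^sub>L real) set)"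
  \<comment> \<open>The derivative of the reverse chart change stands for the inverse Jacobian of
    \<open>?F\<close>, so its smoothness is that of \<open>?G\<close>.\<close>
  let ?L = "\<lambda>z. frechet_derivative ?G (at (?F (fst z)))"
  have base: "smooth_on (?W) (\<lambda>z. ?F (fst z))"
    by (rule smooth_on_Times_fst[OF fin op(1) open_UNIV F])
  have "smooth_on (?W) (\<lambda>z. (?F (fst z), Blinfun (\<lambda>w. blinfun_apply (snd z) (?L z w))))"
  proof (rule smooth_on_Pair[OF op' base], rule smooth_on_dual_apply[OF fin op', where P = snd and L = ?L])
    show "smooth_on (?W) snd"
      by (rule smooth_on_snd[OF op' smooth_on_id])
    show "smooth_on (?W) (\<lambda>z. ?L z w)" for w
    proof (rule smooth_on_compose[OF fin op' op(2) _ base, where g = "\<lambda>y. frechet_derivative ?G (at y) w"])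
      show "?F (fst z) \<in> rep_dom d id c" if "z \<in> ?W" for z
        using that by (intro FU) auto
      show "smooth_on (rep_dom d id c) (\<lambda>y. frechet_derivative ?G (at y) w)"
        by (rule smooth_on_frechet_derivative[OF G])
    qed
    show "linear (?L z)" if "z \<in> ?W" for z
      using that by (intro linear_frechet_derivative' smooth_on_differentiable[OF G] FU) auto
  qed
  then show "smooth_on (snd C ` (fst C \<inter> fst D)) (snd D \<circ> chart_inv C)"
    unfolding dom
  proof (rule smooth_on_cong[OF op', rotated])
    fix z assume z: "z \<in> ?U \<times> (UNIV :: ('e \<Rightarrow>\<^sub>L real) set)"
    obtain x p where xp: "z = (x, p)" by (cases z)
    let ?q = "chart_inv c x"
    have x: "x \<in> snd c ` fst c" "?q \<in> fst c" "?q \<in> fst d"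
      using z by (auto simp: xp rep_dom_def chart_inv_mem)
    have q: "c \<in> charts_at M ?q" "d \<in> charts_at M ?q"
      using x C D by (auto simp: charts_at_def)
    show "(?F (fst z), Blinfun (\<lambda>w. blinfun_apply (snd z) (?L z w))) = (snd D \<circ> chart_inv C) z"
      by (simp add: xp C(1) D(1) chart_inv_cotangent[OF M C(2) x(1)] snd_cotangent_chart
          chart_covec_tangent_of_chart[OF M q(2,1)] chart_deriv_def)
  qed
qed

lemma cotangent_charts_atI:
  assumes "c \<in> charts_at M q" "\<alpha> \<in> cotangent_space M q"
  shows "cotangent_chart M c \<in> charts_at (cotangent_bundle M) (q, \<alpha>)"
  using assms by (auto simp: charts_at_def cotangent_bundle_def fst_cotangent_chart)

lemma smooth_map_cotangent_fst:
  fixes M :: "('a, 'e::real_normed_vector) atlas"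
  assumes M: "smooth_atlas M"
  shows "smooth_map (cotangent_bundle M) M fst"
  unfolding smooth_map_iff[OF smooth_atlas_cotangent_bundle[OF M]]
proof (intro conjI ballI)
  fix C d assume "C \<in> cotangent_bundle M" and d: "d \<in> M"
  then obtain c where C: "C = cotangent_chart M c" "c \<in> M"
    by (auto simp: cotangent_bundle_def)
  have dom: "rep_dom C fst d = rep_dom c id d \<times> UNIV"
    unfolding rep_dom_def C(1) range_cotangent_chart[OF M C(2)]
    using chart_inv_cotangent[OF M C(2)] by auto
  have op: "open (rep_dom c id d)"
    by (rule smooth_map_open[OF M smooth_map_id[OF M] C(2) d])
  have op': "open (rep_dom c id d \<times> (UNIV :: ('e \<Rightarrow>\<^sub>L real) set))"
    by (intro open_Times op open_UNIV)
  show "open (rep_dom C fst d)"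
    unfolding dom by (rule op')
  have "smooth_on (rep_dom c id d \<times> UNIV) (\<lambda>z. (snd d \<circ> id \<circ> chart_inv c) (fst z))"
    by (rule smooth_on_Times_fst[OF smooth_atlas_finite_dim[OF M] op open_UNIV
          smooth_map_smooth_on[OF M smooth_map_id[OF M] C(2) d]])
  then show "smooth_on (rep_dom C fst d) (snd d \<circ> fst \<circ> chart_inv C)"
    unfolding dom
    by (rule smooth_on_cong[OF op', rotated]) (auto simp: C(1) rep_dom_def chart_inv_cotangent[OF M C(2)])
qed (auto simp: pts_cotangent_bundle)

text \<open>In the induced chart the projection reads \<open>(x, p) \<mapsto> x\<close>, which is
  linear and so its own derivative.\<close>

lemma chart_deriv_cotangent_fst:
  assumes M: "smooth_atlas M" and c: "c \<in> charts_at M q" and \<alpha>: "\<alpha> \<in> cotangent_space M q"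
  shows "chart_deriv fst (cotangent_chart M c) c (q, \<alpha>) W = fst W"
proof -
  let ?C = "cotangent_chart M c"
  have "(snd c \<circ> fst \<circ> chart_inv ?C has_derivative fst) (at (snd ?C (q, \<alpha>)))"
  proof (rule has_derivative_transform_within_open)
    show "(fst has_derivative fst) (at (snd ?C (q, \<alpha>)))"
      by (rule bounded_linear_imp_has_derivative[OF bounded_linear_fst])
    show "open (snd c ` fst c \<times> UNIV)"
      by (intro open_Times open_UNIV smooth_atlas_open[OF M charts_atD(1)[OF c]])
    show "snd ?C (q, \<alpha>) \<in> snd c ` fst c \<times> UNIV"
      using charts_atD(2)[OF c] by (simp add: snd_cotangent_chart)
    show "fst z = (snd c \<circ> fst \<circ> chart_inv ?C) z" if "z \<in> snd c ` fst c \<times> UNIV" for z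
      using that chart_inv_cotangent[OF M charts_atD(1)[OF c]] by (cases z) simp
  qed
  then show ?thesis
    unfolding chart_deriv_def by (simp add: frechet_derivative_eq)
qed

section \<open>Exterior derivatives and pullbacks\<close>

text \<open>The coefficient of the form on the field that is constantly \<open>w\<close> in the
  chart: exactly the function that \<open>ext_deriv\<close> differentiates.\<close>

definition form_rep ::
  "('a, 'e::real_normed_vector) atlas \<Rightarrow> ('a, 'e) chart \<Rightarrow> ('a, 'e) form1 \<Rightarrow> 'e \<Rightarrow> 'e \<Rightarrow> real" where
  "form_rep M c \<beta> w x = \<beta> (chart_inv c x) (tangent_of_chart M c (chart_inv c x) w)"

text \<open>The coefficients are gathered into one dual-valued map \<open>B\<close>, since a
  pullback evaluates them on vectors that move with the point and the product rule then needs a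
  derivative of \<open>B\<close> itself.\<close>

definition differentiable_form :: "('a, 'e::real_normed_vector) atlas \<Rightarrow> ('a, 'e) form1 \<Rightarrow> bool" where
  "differentiable_form M \<beta> \<longleftrightarrow> (\<forall>c\<in>M. \<exists>B. \<forall>x\<in>snd c ` fst c. B differentiable (at x) \<and>
     (\<forall>w. form_rep M c \<beta> w x = blinfun_apply (B x) w))"

lemma differentiable_formE:
  assumes "differentiable_form M \<beta>" "c \<in> M"
  obtains B where "\<forall>x\<in>snd c ` fst c. B differentiable (at x)"
    "\<forall>x\<in>snd c ` fst c. \<forall>w. form_rep M c \<beta> w x = blinfun_apply (B x) w"
  using assms unfolding differentiable_form_def by blast

lemma ext_deriv_eq:
  assumes "p \<in> pts M" "u \<in> tangent_space M p" "v \<in> tangent_space M p"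
  shows "ext_deriv M \<beta> p u v =
    frechet_derivative (form_rep M (some_chart M p) \<beta> (v (some_chart M p))) (at (snd (some_chart M p) p)) (u (some_chart M p))
    - frechet_derivative (form_rep M (some_chart M p) \<beta> (u (some_chart M p))) (at (snd (some_chart M p) p)) (v (some_chart M p))"
  using assms by (simp add: ext_deriv_def Let_def form_rep_def[abs_def])

lemma form_rep_has_derivative:
  assumes M: "smooth_atlas M" and c: "c \<in> charts_at M p"
    and B: "\<forall>x\<in>snd c ` fst c. B differentiable (at x)"
      "\<forall>x\<in>snd c ` fst c. \<forall>w. form_rep M c \<beta> w x = blinfun_apply (B x) w"
  shows "(form_rep M c \<beta> w has_derivative (\<lambda>h. blinfun_apply (frechet_derivative B (at (snd c p)) h) w)) (at (snd c p))"
proof (rule has_derivative_transform_within_open)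
  have x: "snd c p \<in> snd c ` fst c" using charts_atD(2)[OF c] by simp
  then show "snd c p \<in> snd c ` fst c" .
  show "open (snd c ` fst c)"
    by (rule smooth_atlas_open[OF M charts_atD(1)[OF c]])
  show "((\<lambda>x. blinfun_apply (B x) w) has_derivative (\<lambda>h. blinfun_apply (frechet_derivative B (at (snd c p)) h) w)) (at (snd c p))"
    by (rule bounded_linear.has_derivative[OF blinfun.bounded_linear_left has_derivative_frechet[OF bspec[OF B(1) x]]])
  show "blinfun_apply (B x) w = form_rep M c \<beta> w x" if "x \<in> snd c ` fst c" for x
    using bspec[OF B(2) that] by simp
qed

lemma form_rep_differentiable:
  assumes M: "smooth_atlas M" and c: "c \<in> charts_at M p" and \<beta>: "differentiable_form M \<beta>"
  shows "form_rep M c \<beta> w differentiable (at (snd c p))"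
proof -
  obtain B where "\<forall>x\<in>snd c ` fst c. B differentiable (at x)"
    "\<forall>x\<in>snd c ` fst c. \<forall>w. form_rep M c \<beta> w x = blinfun_apply (B x) w"
    by (rule differentiable_formE[OF \<beta> charts_atD(1)[OF c]])
  from form_rep_has_derivative[OF M c this] show ?thesis
    by (rule differentiableI)
qed

text \<open>With \<open>F\<close> the representative of \<open>f\<close>, the pullback has
  coefficients \<open>B (F x) (DF(x) w)\<close> near the point. The product rule gives one term with
  the second derivative of \<open>F\<close> and one with the derivative of \<open>B\<close>.\<close>

lemma form_rep_pullback_has_derivative:
  assumes M: "smooth_atlas M" and N: "smooth_atlas N" and f: "smooth_map M N f"
    and c: "c \<in> charts_at M p" and e: "e \<in> charts_at N (f p)"
    and B: "\<forall>x\<in>snd e ` fst e. B differentiable (at x)"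
      "\<forall>x\<in>snd e ` fst e. \<forall>w. form_rep N e \<beta> w x = blinfun_apply (B x) w"
  shows "(form_rep M c (pullback1 M N f \<beta>) w has_derivative
    (\<lambda>h. blinfun_apply (B (snd e (f p)))
           (frechet_derivative (\<lambda>x. frechet_derivative (snd e \<circ> f \<circ> chart_inv c) (at x) w) (at (snd c p)) h)
       + blinfun_apply (frechet_derivative B (at (snd e (f p))) (chart_deriv f c e p h)) (chart_deriv f c e p w)))
    (at (snd c p))"
proof (rule has_derivative_transform_within_open)
  let ?F = "snd e \<circ> f \<circ> chart_inv c" and ?x = "snd c p" and ?y = "snd e (f p)"
  note c' = charts_atD(1)[OF c] and e' = charts_atD(1)[OF e]
  show "open (rep_dom c f e)"
    by (rule smooth_map_open[OF M f c' e'])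
  show x: "?x \<in> rep_dom c f e"
    using charts_atD(2)[OF c] charts_atD(2)[OF e] M c' by (simp add: rep_dom_def)
  have Fx: "?F ?x = ?y"
    using charts_atD(2)[OF c] M c' by simp
  have y: "?y \<in> snd e ` fst e"
    using charts_atD(2)[OF e] by simp
  have "((\<lambda>x. B (?F x)) has_derivative (\<lambda>h. frechet_derivative B (at ?y) (chart_deriv f c e p h))) (at ?x)"
    using has_derivative_compose[OF rep_has_derivative[OF M f c e], of B "frechet_derivative B (at ?y)"]
      has_derivative_frechet[OF bspec[OF B(1) y]] unfolding Fx by blast
  from blinfun.FDERIV[OF this has_derivative_frechet[OF smooth_on_differentiable[OF
        smooth_on_frechet_derivative[OF smooth_map_smooth_on[OF M f c' e']] x]], of w]
  show "((\<lambda>x. blinfun_apply (B (?F x)) (frechet_derivative ?F (at x) w)) has_derivative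
    (\<lambda>h. blinfun_apply (B ?y) (frechet_derivative (\<lambda>x. frechet_derivative ?F (at x) w) (at ?x) h)
       + blinfun_apply (frechet_derivative B (at ?y) (chart_deriv f c e p h)) (chart_deriv f c e p w))) (at ?x)"
    unfolding Fx chart_deriv_def .
  fix x assume x: "x \<in> rep_dom c f e"
  let ?q = "chart_inv c x"
  have xc: "x \<in> snd c ` fst c" and fq: "f ?q \<in> fst e"
    using x by (auto simp: rep_dom_def)
  have q: "c \<in> charts_at M ?q" "e \<in> charts_at N (f ?q)"
    using c' e' fq chart_inv_mem[OF xc] by (auto simp: charts_at_def)
  have "form_rep M c (pullback1 M N f \<beta>) w x = \<beta> (f ?q) (tangent_map M N f ?q (tangent_of_chart M c ?q w))"
    using charts_at_pts[OF q(1)] tangent_of_chart_mem[OF M q(1)] by (simp add: form_rep_def pullback1_def)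
  also have "\<dots> = form_rep N e \<beta> (chart_deriv f c e ?q w) (snd e (f ?q))"
    using N e' fq by (simp add: form_rep_def tangent_map_of_chart[OF M N f q])
  also have "\<dots> = blinfun_apply (B (?F x)) (frechet_derivative ?F (at x) w)"
    using bspec[OF B(2), of "snd e (f ?q)"] fq by (simp add: chart_deriv_def chart_chart_inv[OF xc])
  finally show "blinfun_apply (B (?F x)) (frechet_derivative ?F (at x) w) = form_rep M c (pullback1 M N f \<beta>) w x" ..
qed

lemma form_rep_pullback_differentiable:
  assumes M: "smooth_atlas M" and N: "smooth_atlas N" and f: "smooth_map M N f"
    and \<beta>: "differentiable_form N \<beta>" and c: "c \<in> charts_at M p"
  shows "form_rep M c (pullback1 M N f \<beta>) w differentiable (at (snd c p))"
proof -
  let ?e = "some_chart N (f p)"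
  have e: "?e \<in> charts_at N (f p)"
    by (rule some_chart_mem[OF smooth_map_mem[OF f charts_at_pts[OF c]]])
  obtain B where B: "\<forall>x\<in>snd ?e ` fst ?e. B differentiable (at x)"
      "\<forall>x\<in>snd ?e ` fst ?e. \<forall>w. form_rep N ?e \<beta> w x = blinfun_apply (B x) w"
    by (rule differentiable_formE[OF \<beta> charts_atD(1)[OF e]])
  from form_rep_pullback_has_derivative[OF M N f c e B] show ?thesis
    by (rule differentiableI)
qed

text \<open>The second derivatives of the representative of \<open>f\<close> cancel by symmetry.\<close>

lemma ext_deriv_pullback:
  assumes M: "smooth_atlas M" and N: "smooth_atlas N" and f: "smooth_map M N f"
    and \<beta>: "differentiable_form N \<beta>"
  shows "ext_deriv M (pullback1 M N f \<beta>) = pullback2 M N f (ext_deriv N \<beta>)"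
proof (intro ext)
  fix p u v
  show "ext_deriv M (pullback1 M N f \<beta>) p u v = pullback2 M N f (ext_deriv N \<beta>) p u v"
  proof (cases "p \<in> pts M \<and> u \<in> tangent_space M p \<and> v \<in> tangent_space M p")
    case True
    then have p: "p \<in> pts M" and u: "u \<in> tangent_space M p" and v: "v \<in> tangent_space M p" by auto
    define c where "c = some_chart M p"
    define e where "e = some_chart N (f p)"
    have c: "c \<in> charts_at M p"
      unfolding c_def by (rule some_chart_mem[OF p])
    have e: "e \<in> charts_at N (f p)"
      unfolding e_def by (rule some_chart_mem[OF smooth_map_mem[OF f p]])
    obtain B where B: "\<forall>x\<in>snd e ` fst e. B differentiable (at x)"
      "\<forall>x\<in>snd e ` fst e. \<forall>w. form_rep N e \<beta> w x = blinfun_apply (B x) w"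
      by (rule differentiable_formE[OF \<beta> charts_atD(1)[OF e]])
    define F where "F = snd e \<circ> f \<circ> chart_inv c"
    define D2 where "D2 w h = frechet_derivative (\<lambda>x. frechet_derivative F (at x) w) (at (snd c p)) h" for w h
    define D where "D = chart_deriv f c e p"
    define B' where "B' = frechet_derivative B (at (snd e (f p)))"
    have Tu: "tangent_map M N f p u e = D (u c)" and Tv: "tangent_map M N f p v e = D (v c)"
      unfolding D_def by (rule tangent_map_apply[OF M f u c e], rule tangent_map_apply[OF M f v c e])
    have x: "snd c p \<in> rep_dom c f e"
      using charts_atD[OF c] charts_atD(2)[OF e] M by (simp add: rep_dom_def)
    have sm: "smooth_on (rep_dom c f e) F"
      unfolding F_def by (rule smooth_map_smooth_on[OF M f charts_atD(1)[OF c] charts_atD(1)[OF e]])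
    have sym: "D2 (v c) (u c) = D2 (u c) (v c)"
      unfolding D2_def
      by (rule frechet_derivative_symmetric[OF smooth_map_open[OF M f charts_atD(1)[OF c] charts_atD(1)[OF e]] x])
        (rule smooth_on_differentiable[OF sm], assumption,
          (rule smooth_on_differentiable[OF smooth_on_frechet_derivative[OF sm] x])+)
    have "ext_deriv M (pullback1 M N f \<beta>) p u v =
      (blinfun_apply (B (snd e (f p))) (D2 (v c) (u c)) + blinfun_apply (B' (D (u c))) (D (v c)))
      - (blinfun_apply (B (snd e (f p))) (D2 (u c) (v c)) + blinfun_apply (B' (D (v c))) (D (u c)))"
      unfolding ext_deriv_eq[OF p u v, folded c_def]
        frechet_derivative_eq[OF form_rep_pullback_has_derivative[OF M N f c e B]] D2_def F_def D_def B'_def ..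
    also have "\<dots> = blinfun_apply (B' (D (u c))) (D (v c)) - blinfun_apply (B' (D (v c))) (D (u c))"
      by (simp add: sym)
    also have "\<dots> = ext_deriv N \<beta> (f p) (tangent_map M N f p u) (tangent_map M N f p v)"
      unfolding ext_deriv_eq[OF smooth_map_mem[OF f p] tangent_map_mem[OF M N f p] tangent_map_mem[OF M N f p], folded e_def]
        frechet_derivative_eq[OF form_rep_has_derivative[OF N e B]] Tu Tv B'_def ..
    finally show ?thesis
      using p u v by (simp add: pullback2_def)
  qed (auto simp: ext_deriv_def pullback2_def)
qed

text \<open>Differentiability is asked of each coefficient separately because this is the form in
  which it is available for pullbacks, from \<open>form_rep_pullback_differentiable\<close>.\<close>

lemma ext_deriv_add:
  assumes "\<And>p c w. c \<in> charts_at M p \<Longrightarrow> form_rep M c \<alpha> w differentiable (at (snd c p))"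
    and "\<And>p c w. c \<in> charts_at M p \<Longrightarrow> form_rep M c \<beta> w differentiable (at (snd c p))"
  shows "ext_deriv M (\<lambda>p v. \<alpha> p v + \<beta> p v) = (\<lambda>p u v. ext_deriv M \<alpha> p u v + ext_deriv M \<beta> p u v)"
proof (intro ext)
  fix p u v
  show "ext_deriv M (\<lambda>p v. \<alpha> p v + \<beta> p v) p u v = ext_deriv M \<alpha> p u v + ext_deriv M \<beta> p u v"
  proof (cases "p \<in> pts M \<and> u \<in> tangent_space M p \<and> v \<in> tangent_space M p")
    case True
    then have p: "p \<in> pts M" and u: "u \<in> tangent_space M p" and v: "v \<in> tangent_space M p" by auto
    let ?c = "some_chart M p"
    note c = some_chart_mem[OF p]
    have "frechet_derivative (form_rep M ?c (\<lambda>p v. \<alpha> p v + \<beta> p v) w) (at (snd ?c p)) h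
        = frechet_derivative (form_rep M ?c \<alpha> w) (at (snd ?c p)) h + frechet_derivative (form_rep M ?c \<beta> w) (at (snd ?c p)) h" for w h
    proof -
      have "form_rep M ?c (\<lambda>p v. \<alpha> p v + \<beta> p v) w = (\<lambda>x. form_rep M ?c \<alpha> w x + form_rep M ?c \<beta> w x)"
        by (simp add: form_rep_def fun_eq_iff)
      then show ?thesis
        using frechet_derivative_eq[OF has_derivative_add[OF has_derivative_frechet[OF assms(1)[OF c, of w]]
              has_derivative_frechet[OF assms(2)[OF c, of w]]]] by simp
    qed
    then show ?thesis
      by (simp add: ext_deriv_eq[OF p u v])
  qed (auto simp: ext_deriv_def)
qed

section \<open>Differentiability of one-forms and of the Liouville form\<close>

lemma one_formsD:
  assumes "\<alpha> \<in> one_forms M"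
  shows "p \<in> pts M \<Longrightarrow> \<alpha> p \<in> cotangent_space M p"
    and "p \<notin> pts M \<Longrightarrow> \<alpha> p v = 0"
    and "v \<notin> tangent_space M p \<Longrightarrow> \<alpha> p v = 0"
proof -
  show mem: "p \<in> pts M \<Longrightarrow> \<alpha> p \<in> cotangent_space M p" and off: "p \<notin> pts M \<Longrightarrow> \<alpha> p v = 0"
    using assms by (auto simp: one_forms_def)
  show "v \<notin> tangent_space M p \<Longrightarrow> \<alpha> p v = 0"
    using cotangent_spaceD(3)[OF mem] off by (cases "p \<in> pts M") simp_all
qed

text \<open>The map \<open>B\<close> is the fibre coordinate of the smooth section
  \<open>p \<mapsto> (p, \<alpha> p)\<close> in the induced chart.\<close>

lemma differentiable_form_one_forms:
  assumes M: "smooth_atlas M" and \<alpha>: "\<alpha> \<in> one_forms M"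
  shows "differentiable_form M \<alpha>"
  unfolding differentiable_form_def
proof (rule ballI)
  fix c assume c: "c \<in> M"
  let ?s = "\<lambda>p. (p, \<alpha> p)" and ?C = "cotangent_chart M c"
  have s: "smooth_map M (cotangent_bundle M) ?s"
    using \<alpha> by (simp add: one_forms_def)
  have C: "?C \<in> cotangent_bundle M"
    using c by (simp add: cotangent_bundle_def)
  have dom: "rep_dom c ?s ?C = snd c ` fst c"
    using one_formsD(1)[OF \<alpha> mem_pts[OF c]] M c by (auto simp: rep_dom_def fst_cotangent_chart)
  have sm: "smooth_on (snd c ` fst c) (\<lambda>x. snd ((snd ?C \<circ> ?s \<circ> chart_inv c) x))"
    by (rule smooth_on_snd[OF smooth_atlas_open[OF M c] smooth_map_smooth_on[OF M s c C, unfolded dom]])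
  have "form_rep M c \<alpha> w x = blinfun_apply (snd ((snd ?C \<circ> ?s \<circ> chart_inv c) x)) w" if x: "x \<in> snd c ` fst c" for x w
  proof -
    have "c \<in> charts_at M (chart_inv c x)" "\<alpha> (chart_inv c x) \<in> cotangent_space M (chart_inv c x)"
      using chart_inv_mem[OF x] c one_formsD(1)[OF \<alpha> mem_pts[OF c chart_inv_mem[OF x]]]
      by (auto simp: charts_at_def)
    from bounded_linear_Blinfun_apply[OF bounded_linear_covec_chart[OF M this]]
    show ?thesis by (simp add: form_rep_def snd_cotangent_chart)
  qed
  then show "\<exists>B. \<forall>x\<in>snd c ` fst c. B differentiable (at x) \<and> (\<forall>w. form_rep M c \<alpha> w x = blinfun_apply (B x) w)"
    using smooth_on_differentiable[OF sm] by blast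
qed

text \<open>In the induced chart the form is p dq: at \<open>(x, p)\<close> it sends
  \<open>W\<close> to \<open>p (fst W)\<close>. Its coefficient map
  \<open>snd z o\<^sub>L fst_blinfun\<close> is bounded linear in \<open>z\<close>.\<close>

lemma differentiable_form_liouville:
  assumes M: "smooth_atlas M"
  shows "differentiable_form (cotangent_bundle M) (liouville_form M)"
  unfolding differentiable_form_def
proof (rule ballI)
  let ?TM = "cotangent_bundle M"
  note TM = smooth_atlas_cotangent_bundle[OF M] and fst_smooth = smooth_map_cotangent_fst[OF M]
  fix C assume C_mem: "C \<in> ?TM"
  then obtain c where C: "C = cotangent_chart M c" "c \<in> M"
    by (auto simp: cotangent_bundle_def)
  let ?B = "\<lambda>z. snd z o\<^sub>L fst_blinfun"
  have bl: "bounded_linear ?B"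
    by (rule bounded_linear_compose[OF bounded_bilinear.bounded_linear_left[OF bounded_bilinear_blinfun_compose] bounded_linear_snd])
  have "form_rep ?TM C (liouville_form M) W z = blinfun_apply (?B z) W" if z: "z \<in> snd C ` fst C" for W z
  proof -
    obtain x p where xp: "z = (x, p)" by (cases z)
    have x: "x \<in> snd c ` fst c"
      using z unfolding C(1) range_cotangent_chart[OF M C(2)] xp by simp
    let ?q = "chart_inv c x"
    let ?\<alpha> = "chart_covec M c ?q p"
    have q: "c \<in> charts_at M ?q"
      by (rule charts_atI[OF C(2) chart_inv_mem[OF x]])
    note \<alpha> = chart_covec_mem[OF M, of c ?q p]
    have CX: "C \<in> charts_at ?TM (?q, ?\<alpha>)"
      unfolding C(1) by (rule cotangent_charts_atI[OF q \<alpha>])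
    have "form_rep ?TM C (liouville_form M) W z = ?\<alpha> (tangent_map ?TM M fst (?q, ?\<alpha>) (tangent_of_chart ?TM C (?q, ?\<alpha>) W))"
      using charts_at_pts[OF CX] tangent_of_chart_mem[OF TM CX]
      by (simp add: form_rep_def liouville_form_def xp C(1) chart_inv_cotangent[OF M C(2) x])
    also have "\<dots> = ?\<alpha> (tangent_of_chart M c ?q (fst W))"
      using tangent_map_of_chart[OF TM M fst_smooth CX, of c W] q
      by (simp add: C(1) chart_deriv_cotangent_fst[OF M q \<alpha>])
    also have "\<dots> = blinfun_apply p (fst W)"
      by (simp add: chart_covec_tangent_of_chart[OF M q q] chart_deriv_id_self[OF M q])
    finally show ?thesis by (simp add: xp)
  qed
  then show "\<exists>B. \<forall>x\<in>snd C ` fst C. B differentiable (at x) \<and> (\<forall>w. form_rep ?TM C (liouville_form M) w x = blinfun_apply (B x) w)"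
    using bounded_linear_imp_differentiable[OF bl] by blast
qed

section \<open>Twisted cotangent lifts\<close>

lemma pull_covec_mem:
  assumes M: "smooth_atlas M" and N: "smooth_atlas N" and f: "smooth_map M N f"
    and p: "p \<in> pts M" and \<beta>: "\<beta> \<in> cotangent_space N (f p)"
  shows "(\<lambda>v. if v \<in> tangent_space M p then \<beta> (tangent_map M N f p v) else 0) \<in> cotangent_space M p"
proof -
  note mem = tangent_map_mem[OF M N f p]
  show ?thesis
    using tangent_space_add[OF M] tangent_space_scale[OF M]
      cotangent_spaceD(1)[OF \<beta> mem mem] cotangent_spaceD(2)[OF \<beta> mem]
    by (simp add: cotangent_space_def tangent_map_add[OF M f p] tangent_map_scale[OF M f p])
qed

lemma cotangent_space_add:
  "\<alpha> \<in> cotangent_space M p \<Longrightarrow> \<beta> \<in> cotangent_space M p \<Longrightarrow> (\<lambda>v. \<alpha> v + \<beta> v) \<in> cotangent_space M p"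
  by (simp add: cotangent_space_def algebra_simps)

lemma cotangent_space_zero: "(\<lambda>v. 0) \<in> cotangent_space M p"
  by (simp add: cotangent_space_def)

text \<open>The two laws make \<open>\<Phi> (inv g)\<close> a two-sided inverse of
  \<open>\<Phi> g\<close> on \<open>E\<close>, which gives bijectivity. Extensionality turns the
  pointwise composition law into the equality of functions that \<open>BijGroup\<close>
  requires.\<close>

lemma group_actionI:
  fixes G (structure)
  assumes G: "group G"
    and mem: "\<And>g x. g \<in> carrier G \<Longrightarrow> x \<in> E \<Longrightarrow> \<Phi> g x \<in> E"
    and ext: "\<And>g. g \<in> carrier G \<Longrightarrow> \<Phi> g \<in> extensional E"
    and one: "\<And>x. x \<in> E \<Longrightarrow> \<Phi> \<one> x = x"
    and mult: "\<And>g h x. g \<in> carrier G \<Longrightarrow> h \<in> carrier G \<Longrightarrow> x \<in> E \<Longrightarrow> \<Phi> (g \<otimes> h) x = \<Phi> g (\<Phi> h x)"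
  shows "group_action G E \<Phi>"
proof -
  interpret group G by (rule G)
  have bij: "\<Phi> g \<in> Bij E" if g: "g \<in> carrier G" for g
  proof -
    have "\<Phi> (inv g) (\<Phi> g x) = x" "\<Phi> g (\<Phi> (inv g) x) = x" if "x \<in> E" for x
      using g that mult[of "inv g" g x] mult[of g "inv g" x] one by simp_all
    then have "bij_betw (\<Phi> g) E E"
      using g mem by (intro bij_betw_byWitness[where f' = "\<Phi> (inv g)"]) auto
    then show ?thesis using ext[OF g] by (simp add: Bij_def)
  qed
  have "\<Phi> (g \<otimes> h) = compose E (\<Phi> g) (\<Phi> h)" if "g \<in> carrier G" "h \<in> carrier G" for g h
    by (rule extensionalityI[of _ E]) (use that ext mult in \<open>auto simp: compose_def\<close>)
  then have "\<Phi> \<in> hom G (BijGroup E)"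
    using bij by (intro homI) (simp_all add: BijGroup_def)
  then show ?thesis
    using group_BijGroup by (intro group_action.intro group_hom.intro group_hom_axioms.intro G)
qed

text \<open>For \<open>n = 1\<close> the signs of the coboundary on \<open>[g, h]\<close> are
  \<open>(-1)^2\<close> for \<open>A h\<close>, \<open>(-1)^3\<close> for
  \<open>A (g \<otimes> h)\<close> and plus for the pullback of \<open>A g\<close> by
  \<open>\<phi> h\<close>.\<close>

lemma one_cocycle_iff:
  fixes G (structure)
  shows "one_cocycle G Q \<phi> F A \<longleftrightarrow> (\<forall>g\<in>carrier G. A g \<in> F) \<and>
    (\<forall>g\<in>carrier G. \<forall>h\<in>carrier G. \<forall>q v. A h q v - A (g \<otimes> h) q v + pullback1 Q Q (\<phi> h) (A g) q v = 0)"
proof -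
  have t1: "tuples G 1 = {[g] | g. g \<in> carrier G}"
    by (auto simp: tuples_def length_Suc_conv)
  have t2: "tuples G (1 + 1) = {[g, h] | g h. g \<in> carrier G \<and> h \<in> carrier G}"
    by (auto simp: tuples_def length_Suc_conv)
  have c: "coboundary G Q \<phi> 1 (\<lambda>gs. A (hd gs)) [g, h]
      = (\<lambda>q v. A h q v - A (g \<otimes> h) q v + pullback1 Q Q (\<phi> h) (A g) q v)" for g h
    by (simp add: coboundary_def)
  have "(\<forall>gs\<in>tuples G 1. A (hd gs) \<in> F) \<longleftrightarrow> (\<forall>g\<in>carrier G. A g \<in> F)"
    unfolding t1 by auto
  moreover have "(\<forall>gs\<in>tuples G (1 + 1). coboundary G Q \<phi> 1 (\<lambda>gs. A (hd gs)) gs = (\<lambda>q v. 0)) \<longleftrightarrow>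
      (\<forall>g\<in>carrier G. \<forall>h\<in>carrier G. \<forall>q v. A h q v - A (g \<otimes> h) q v + pullback1 Q Q (\<phi> h) (A g) q v = 0)"
    (is "?l \<longleftrightarrow> ?r")
  proof
    assume l: ?l
    show ?r
    proof (intro ballI allI)
      fix g h q v assume "g \<in> carrier G" "h \<in> carrier G"
      then have "[g, h] \<in> tuples G (1 + 1)" unfolding t2 by blast
      from bspec[OF l this] show "A h q v - A (g \<otimes> h) q v + pullback1 Q Q (\<phi> h) (A g) q v = 0"
        unfolding c by (rule fun_cong[OF fun_cong])
    qed
  next
    assume r: ?r
    show ?l
    proof
      fix gs assume "gs \<in> tuples G (1 + 1)"
      then obtain g h where "gs = [g, h]" "g \<in> carrier G" "h \<in> carrier G" unfolding t2 by blast
      then show "coboundary G Q \<phi> 1 (\<lambda>gs. A (hd gs)) gs = (\<lambda>q v. 0)"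
        using r by (simp only: c)
    qed
  qed
  ultimately show ?thesis
    by (simp only: one_cocycle_def cocycle_def cochains_def mem_Collect_eq)
qed

text \<open>The hypotheses shared by both directions of the equivalences; \<open>A\<close> is an
  arbitrary smooth cochain here.\<close>

locale cochain_action =
  fixes G :: "('g, 'm) monoid_scheme" (structure)
    and GA :: "('g, 'h::real_normed_vector) atlas"
    and Q :: "('q, 'e::real_normed_vector) atlas"
    and \<phi> :: "'g \<Rightarrow> 'q \<Rightarrow> 'q"
    and A :: "'g \<Rightarrow> ('q, 'e) form1"
  assumes lie: "lie_group G GA"
    and manifold_Q: "manifold Q"
    and action: "smooth_action G GA Q \<phi>"
    and one_form: "g \<in> carrier G \<Longrightarrow> A g \<in> one_forms Q"
    and smooth_A: "smooth_map (product_atlas GA Q) (cotangent_bundle Q) (\<lambda>(g, q). (q, A g q))"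
begin

sublocale group G
  using lie by (simp add: lie_group_def)

sublocale group_action G "pts Q" \<phi>
  using action by (simp add: smooth_action_def)

abbreviation "TQ \<equiv> cotangent_bundle Q"
abbreviation "\<Phi> \<equiv> twisted_lift G Q \<phi> A"

lemma atlas_GA: "smooth_atlas GA" and pts_GA: "pts GA = carrier G"
  using lie by (simp_all add: lie_group_def manifold_smooth_atlas)

lemma atlas_Q: "smooth_atlas Q"
  using manifold_Q by (rule manifold_smooth_atlas)

lemma atlas_TQ: "smooth_atlas TQ"
  by (rule smooth_atlas_cotangent_bundle[OF atlas_Q])

lemma smooth_action_map: "smooth_map (product_atlas GA Q) Q (\<lambda>(g, q). \<phi> g q)"
  using action by (simp add: smooth_action_def)

text \<open>Composition with this map turns joint smoothness in \<open>(g, x)\<close> into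
  smoothness in \<open>x\<close> for fixed \<open>g\<close>.\<close>

lemma smooth_map_insert:
  assumes "smooth_atlas M" "g \<in> carrier G"
  shows "smooth_map M (product_atlas GA M) (\<lambda>x. (g, x))"
  using smooth_map_Pair[OF assms(1) smooth_map_const[OF assms(1), of g GA] smooth_map_id[OF assms(1)]] assms(2)
  by (simp add: pts_GA)

lemma smooth_act:
  assumes "g \<in> carrier G"
  shows "smooth_map Q Q (\<phi> g)"
  using smooth_map_compose[OF atlas_Q smooth_atlas_product[OF atlas_GA atlas_Q]
      smooth_map_insert[OF atlas_Q assms] smooth_action_map]
  by (simp add: comp_def)

text \<open>The cotangent lift by \<open>g\<close> involves the tangent map of
  \<open>\<phi> (inv g)\<close>, which must vary smoothly with \<open>g\<close> as well; smoothness
  of group inversion supplies this.\<close>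

lemma smooth_inverse_action_map: "smooth_map (product_atlas GA Q) Q (\<lambda>(g, q). \<phi> (inv g) q)"
proof -
  note P = smooth_atlas_product[OF atlas_GA atlas_Q]
  have "smooth_map GA GA (\<lambda>g. inv g)"
    using lie by (simp add: lie_group_def)
  from smooth_map_compose[OF P P smooth_map_Pair[OF P smooth_map_compose[OF P atlas_GA
          smooth_map_fst[OF atlas_GA atlas_Q] this] smooth_map_snd[OF atlas_GA atlas_Q]] smooth_action_map]
  show ?thesis
    by (simp add: comp_def case_prod_unfold)
qed

lemma act_mem: "g \<in> carrier G \<Longrightarrow> q \<in> pts Q \<Longrightarrow> \<phi> g q \<in> pts Q"
  by (rule smooth_map_mem[OF smooth_act])

lemma act_one: "q \<in> pts Q \<Longrightarrow> \<phi> \<one> q = q"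
  using id_eq_one by (metis restrict_apply')

lemma act_inv:
  assumes "g \<in> carrier G" "q \<in> pts Q"
  shows "\<phi> (inv g) (\<phi> g q) = q" "\<phi> g (\<phi> (inv g) q) = q"
  using composition_rule[OF assms(2), of "inv g" g] composition_rule[OF assms(2), of g "inv g"]
    assms act_one by simp_all

lemma tangent_act_mem:
  "g \<in> carrier G \<Longrightarrow> q \<in> pts Q \<Longrightarrow> tangent_map Q Q (\<phi> g) q v \<in> tangent_space Q (\<phi> g q)"
  by (rule tangent_map_mem[OF atlas_Q atlas_Q smooth_act])

lemma tangent_act_mult:
  assumes g: "g \<in> carrier G" and h: "h \<in> carrier G" and q: "q \<in> pts Q"
  shows "tangent_map Q Q (\<phi> (g \<otimes> h)) q v = tangent_map Q Q (\<phi> g) (\<phi> h q) (tangent_map Q Q (\<phi> h) q v)"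
proof -
  have "tangent_map Q Q (\<phi> (g \<otimes> h)) q v = tangent_map Q Q (\<phi> g \<circ> \<phi> h) q v"
    using g h composition_rule by (intro tangent_map_cong[OF atlas_Q smooth_act _ q]) simp_all
  then show ?thesis
    using tangent_map_compose[OF atlas_Q atlas_Q smooth_act[OF h] smooth_act[OF g] q] by simp
qed

lemma tangent_act_one:
  "q \<in> pts Q \<Longrightarrow> v \<in> tangent_space Q q \<Longrightarrow> tangent_map Q Q (\<phi> \<one>) q v = v"
  by (rule tangent_map_id[OF atlas_Q]) (simp_all add: act_one)

lemma tangent_act_inv:
  assumes g: "g \<in> carrier G" and q: "q \<in> pts Q" and v: "v \<in> tangent_space Q q"
  shows "tangent_map Q Q (\<phi> (inv g)) (\<phi> g q) (tangent_map Q Q (\<phi> g) q v) = v"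
  using tangent_act_mult[of "inv g" g q v] tangent_act_one[OF q v] g q by simp

lemma tangent_act_inv':
  assumes g: "g \<in> carrier G" and q: "q \<in> pts Q" and w: "w \<in> tangent_space Q (\<phi> g q)"
  shows "tangent_map Q Q (\<phi> g) q (tangent_map Q Q (\<phi> (inv g)) (\<phi> g q) w) = w"
  using tangent_act_inv[of "inv g" "\<phi> g q" w] act_inv(1)[OF g q] act_mem[OF g q] g w by simp

definition covec_lift :: "'g \<Rightarrow> 'q \<Rightarrow> ('q, 'e) covec \<Rightarrow> ('q, 'e) covec" where
  "covec_lift g q \<gamma> = (\<lambda>w. if w \<in> tangent_space Q (\<phi> g q)
     then \<gamma> (tangent_map Q Q (\<phi> (inv g)) (\<phi> g q) w) else 0)"

lemma covec_lift_mem: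
  assumes g: "g \<in> carrier G" and q: "q \<in> pts Q" and \<gamma>: "\<gamma> \<in> cotangent_space Q q"
  shows "covec_lift g q \<gamma> \<in> cotangent_space Q (\<phi> g q)"
  unfolding covec_lift_def
  using pull_covec_mem[OF atlas_Q atlas_Q smooth_act[of "inv g"] act_mem[OF g q], of \<gamma>] act_inv(1)[OF g q] g \<gamma>
  by simp

lemma covec_add_mem:
  assumes "g \<in> carrier G" "q \<in> pts Q" "\<gamma> \<in> cotangent_space Q q"
  shows "(\<lambda>v. \<gamma> v + A g q v) \<in> cotangent_space Q q"
  by (rule cotangent_space_add[OF assms(3) one_formsD(1)[OF one_form[OF assms(1)] assms(2)]])

lemma twisted_lift_apply:
  assumes "q \<in> pts Q" "\<gamma> \<in> cotangent_space Q q"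
  shows "\<Phi> g (q, \<gamma>) = (\<phi> g q, covec_lift g q (\<lambda>v. \<gamma> v + A g q v))"
  using assms
  by (simp add: twisted_lift_def compose_def pts_cotangent_bundle translation_def cotangent_lift_def covec_lift_def)

lemma twisted_lift_mem:
  assumes "g \<in> carrier G" "X \<in> pts TQ"
  shows "\<Phi> g X \<in> pts TQ"
  using assms
  by (auto simp: pts_cotangent_bundle twisted_lift_apply act_mem intro!: covec_lift_mem covec_add_mem)

text \<open>The covector \<open>\<gamma>\<close> contributes the same value to both sides and
  cancels. The composition law at a single covector over \<open>q\<close> is thus already equivalent
  to the cocycle identity at \<open>q\<close>.\<close>

lemma twisted_lift_mult_iff:
  assumes g: "g \<in> carrier G" and h: "h \<in> carrier G" and q: "q \<in> pts Q" and \<gamma>: "\<gamma> \<in> cotangent_space Q q"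
  shows "\<Phi> (g \<otimes> h) (q, \<gamma>) = \<Phi> g (\<Phi> h (q, \<gamma>)) \<longleftrightarrow>
    (\<forall>v\<in>tangent_space Q q. A h q v - A (g \<otimes> h) q v + pullback1 Q Q (\<phi> h) (A g) q v = 0)"
proof -
  let ?T = "\<lambda>g q. tangent_map Q Q (\<phi> g) q"
  let ?hq = "\<phi> h q"
  note gh = m_closed[OF g h]
  have hq: "?hq \<in> pts Q" by (rule act_mem[OF h q])
  have y: "\<phi> (g \<otimes> h) q = \<phi> g ?hq" by (rule composition_rule[OF q g h])
  \<comment> \<open>On vectors of this form the inverse tangent maps hidden in the lifts
    cancel.\<close>
  have val: "snd (\<Phi> (g \<otimes> h) (q, \<gamma>)) (?T g ?hq (?T h q v)) = \<gamma> v + A (g \<otimes> h) q v"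
    "snd (\<Phi> g (\<Phi> h (q, \<gamma>))) (?T g ?hq (?T h q v)) = \<gamma> v + A h q v + pullback1 Q Q (\<phi> h) (A g) q v"
    if v: "v \<in> tangent_space Q q" for v
  proof -
    have "?T (inv (g \<otimes> h)) (\<phi> g ?hq) (?T g ?hq (?T h q v)) = v"
      using tangent_act_inv[OF gh q v] tangent_act_mult[OF g h q, of v] y by simp
    then show "snd (\<Phi> (g \<otimes> h) (q, \<gamma>)) (?T g ?hq (?T h q v)) = \<gamma> v + A (g \<otimes> h) q v"
      using tangent_act_mem[OF g hq] by (simp add: twisted_lift_apply[OF q \<gamma>] covec_lift_def y)
    note m = covec_lift_mem[OF h q covec_add_mem[OF h q \<gamma>]]
    show "snd (\<Phi> g (\<Phi> h (q, \<gamma>))) (?T g ?hq (?T h q v)) = \<gamma> v + A h q v + pullback1 Q Q (\<phi> h) (A g) q v"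
      using tangent_act_mem[OF g hq] tangent_act_mem[OF h q] q v
      by (simp add: twisted_lift_apply[OF q \<gamma>] twisted_lift_apply[OF hq m])
        (simp add: covec_lift_def tangent_act_inv[OF g hq] tangent_act_inv[OF h q v] pullback1_def)
  qed
  \<comment> \<open>Covectors are compared as total functions: every tangent \<open>w\<close> has
    the form treated in \<open>val\<close>, and at all other \<open>w\<close> both sides are 0 by
    convention.\<close>
  have surj: "\<exists>v\<in>tangent_space Q q. w = ?T g ?hq (?T h q v)" if w: "w \<in> tangent_space Q (\<phi> g ?hq)" for w
  proof -
    define u where "u = ?T (inv g) (\<phi> g ?hq) w"
    have u: "u \<in> tangent_space Q ?hq"
      unfolding u_def using tangent_act_mem[OF inv_closed[OF g] act_mem[OF g hq]] act_inv(1)[OF g hq] by simp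
    have v: "?T (inv h) ?hq u \<in> tangent_space Q q"
      using tangent_act_mem[OF inv_closed[OF h] hq] act_inv(1)[OF h q] by simp
    have "?T g ?hq (?T h q (?T (inv h) ?hq u)) = w"
      unfolding tangent_act_inv'[OF h q u] unfolding u_def by (rule tangent_act_inv'[OF g hq w])
    with v show ?thesis by blast
  qed
  have off: "snd (\<Phi> (g \<otimes> h) (q, \<gamma>)) w = 0" "snd (\<Phi> g (\<Phi> h (q, \<gamma>))) w = 0"
    if "w \<notin> tangent_space Q (\<phi> g ?hq)" for w
    using that
    by (simp_all add: twisted_lift_apply[OF q \<gamma>] twisted_lift_apply[OF hq covec_lift_mem[OF h q covec_add_mem[OF h q \<gamma>]]])
      (simp_all add: covec_lift_def y)
  have fst_eq: "fst (\<Phi> (g \<otimes> h) (q, \<gamma>)) = fst (\<Phi> g (\<Phi> h (q, \<gamma>)))"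
    by (simp add: twisted_lift_apply[OF q \<gamma>] twisted_lift_apply[OF hq covec_lift_mem[OF h q covec_add_mem[OF h q \<gamma>]]] y)
  have "\<Phi> (g \<otimes> h) (q, \<gamma>) = \<Phi> g (\<Phi> h (q, \<gamma>)) \<longleftrightarrow>
      (\<forall>w. snd (\<Phi> (g \<otimes> h) (q, \<gamma>)) w = snd (\<Phi> g (\<Phi> h (q, \<gamma>))) w)"
    using fst_eq by (auto simp: prod_eq_iff fun_eq_iff)
  also have "\<dots> \<longleftrightarrow> (\<forall>v\<in>tangent_space Q q. \<gamma> v + A (g \<otimes> h) q v = \<gamma> v + A h q v + pullback1 Q Q (\<phi> h) (A g) q v)"
    using val surj off by metis
  also have "\<dots> \<longleftrightarrow> (\<forall>v\<in>tangent_space Q q. A h q v - A (g \<otimes> h) q v + pullback1 Q Q (\<phi> h) (A g) q v = 0)"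
    by (rule ball_cong) auto
  finally show ?thesis .
qed

lemma group_action_iff_one_cocycle:
  "group_action G (pts TQ) \<Phi> \<longleftrightarrow> one_cocycle G Q \<phi> (one_forms Q) A"
proof
  assume act: "group_action G (pts TQ) \<Phi>"
  have "A h q v - A (g \<otimes> h) q v + pullback1 Q Q (\<phi> h) (A g) q v = 0"
    if g: "g \<in> carrier G" and h: "h \<in> carrier G" for g h q v
  proof (cases "q \<in> pts Q \<and> v \<in> tangent_space Q q")
    case True
    then have q: "q \<in> pts Q" and v: "v \<in> tangent_space Q q" by auto
    \<comment> \<open>The zero covector provides a point of the bundle over every \<open>q\<close>
      at which to test the composition law.\<close>
    note zero = cotangent_space_zero[of Q q]
    have "(q, \<lambda>v. 0) \<in> pts TQ"
      using q zero by (simp add: pts_cotangent_bundle)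
    from group_action.composition_rule[OF act this g h] v
    show ?thesis
      unfolding twisted_lift_mult_iff[OF g h q zero] by blast
  next
    \<comment> \<open>The coboundary must vanish as a total function; away from points and tangent
      vectors all three terms are 0 by convention.\<close>
    case False
    then show ?thesis
      using one_formsD(2)[OF one_form[OF h], of q v] one_formsD(3)[OF one_form[OF h], of v q]
        one_formsD(2)[OF one_form[OF m_closed[OF g h]], of q v] one_formsD(3)[OF one_form[OF m_closed[OF g h]], of v q]
      by (auto simp: pullback1_def)
  qed
  then show "one_cocycle G Q \<phi> (one_forms Q) A"
    by (simp add: one_cocycle_iff one_form)
next
  assume "one_cocycle G Q \<phi> (one_forms Q) A"
  then have coc: "A h q v - A (g \<otimes> h) q v + pullback1 Q Q (\<phi> h) (A g) q v = 0"
    if "g \<in> carrier G" "h \<in> carrier G" for g h q v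
    using that by (simp add: one_cocycle_iff)
  show "group_action G (pts TQ) \<Phi>"
  proof (rule group_actionI[OF is_group])
    show "\<Phi> g X \<in> pts TQ" if "g \<in> carrier G" "X \<in> pts TQ" for g X
      by (rule twisted_lift_mem[OF that])
    show "\<Phi> g \<in> extensional (pts TQ)" for g
      by (simp add: twisted_lift_def)
    show "\<Phi> (g \<otimes> h) X = \<Phi> g (\<Phi> h X)" if "g \<in> carrier G" "h \<in> carrier G" "X \<in> pts TQ" for g h X
      using that coc by (cases X) (simp add: pts_cotangent_bundle twisted_lift_mult_iff)
    fix X assume "X \<in> pts TQ"
    then obtain q \<gamma> where X: "X = (q, \<gamma>)" and q: "q \<in> pts Q" and \<gamma>: "\<gamma> \<in> cotangent_space Q q"
      by (auto simp: pts_cotangent_bundle)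
    \<comment> \<open>At the pair of units the identity reads
      \<open>A \<one> - A \<one> + A \<one> = 0\<close>, because \<open>\<phi> \<one>\<close> pulls
      back trivially.\<close>
    have A_one: "A \<one> q v = 0" if v: "v \<in> tangent_space Q q" for v
      using coc[of \<one> \<one> q v] q v by (simp add: pullback1_def act_one tangent_act_one)
    have "covec_lift \<one> q (\<lambda>v. \<gamma> v + A \<one> q v) w = \<gamma> w" for w
      using cotangent_spaceD(3)[OF \<gamma>, of w] by (simp add: covec_lift_def act_one[OF q] tangent_act_one[OF q] A_one)
    then show "\<Phi> \<one> X = X"
      by (simp add: X twisted_lift_apply[OF q \<gamma>] act_one[OF q] fun_eq_iff)
  qed
qed

end

section \<open>Smoothness of the twisted lift\<close>

lemma has_derivative_partial:
  assumes "f differentiable (at (s, y))"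
  shows "((\<lambda>y. f (s, y)) has_derivative (\<lambda>w. frechet_derivative f (at (s, y)) (0, w))) (at y)"
proof -
  have "((\<lambda>y. (s, y)) has_derivative (\<lambda>w. (0, w))) (at y)"
    by (intro has_derivative_Pair has_derivative_const has_derivative_ident)
  from has_derivative_compose[OF this has_derivative_frechet[OF assms]] show ?thesis .
qed

context cochain_action
begin

text \<open>In charts the map is
  \<open>(s, x, p) \<mapsto> (Y(s, x), (p + \<alpha>(s, x)) o L)\<close>. Here \<open>Y\<close>
  represents the action, \<open>\<alpha>\<close> the cochain, and \<open>L\<close> is the partial
  derivative, in the second variable at \<open>(s, Y(s, x))\<close>, of the representative
  \<open>\<Psi>\<close> of the inverse action.\<close>

lemma smooth_twisted_lift: "smooth_map (product_atlas GA TQ) TQ (\<lambda>(g, X). \<Phi> g X)"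
  unfolding smooth_map_iff[OF smooth_atlas_product[OF atlas_GA atlas_TQ]]
proof (intro conjI ballI)
  show "(\<lambda>(g, X). \<Phi> g X) ` pts (product_atlas GA TQ) \<subseteq> pts TQ"
    using twisted_lift_mem by (auto simp: pts_product_atlas pts_GA)
  note finQ = smooth_atlas_finite_dim[OF atlas_Q]
  note prod = smooth_atlas_product[OF atlas_GA atlas_Q]
  note fin = smooth_atlas_finite_dim[OF prod]
  fix C D assume "C \<in> product_atlas GA TQ" and "D \<in> TQ"
  then obtain a c d where a: "a \<in> GA" and c: "c \<in> Q" and d: "d \<in> Q"
    and C: "C = (fst a \<times> fst (cotangent_chart Q c), map_prod (snd a) (snd (cotangent_chart Q c)))"
    and D: "D = cotangent_chart Q d"
    unfolding product_atlas_def cotangent_bundle_def by blast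
  let ?K = "cotangent_chart Q c"
  have K: "?K \<in> TQ" using c by (simp add: cotangent_bundle_def)
  define P where "P = (fst a \<times> fst c, map_prod (snd a) (snd c))"
  define P' where "P' = (fst a \<times> fst d, map_prod (snd a) (snd d))"
  have P: "P \<in> product_atlas GA Q" and P': "P' \<in> product_atlas GA Q"
    unfolding P_def P'_def by (intro product_atlasI a c d)+
  let ?act = "\<lambda>(g, q). \<phi> g q" and ?iact = "\<lambda>(g, q). \<phi> (inv g) q" and ?sec = "\<lambda>(g, q). (q, A g q)"
  define S where "S = rep_dom P ?act d"
  define S' where "S' = rep_dom P' ?iact c"
  define Y where "Y = snd d \<circ> ?act \<circ> chart_inv P"
  define \<Psi> where "\<Psi> = snd c \<circ> ?iact \<circ> chart_inv P'"
  define \<alpha> where "\<alpha> x = snd ((snd ?K \<circ> ?sec \<circ> chart_inv P) x)" for x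
  have invP: "chart_inv P (s, x) = (chart_inv a s, chart_inv c x)"
    if "s \<in> snd a ` fst a" "x \<in> snd c ` fst c" for s x
    unfolding P_def by (rule chart_inv_product[OF atlas_GA atlas_Q a c that])
  have invP': "chart_inv P' (s, y) = (chart_inv a s, chart_inv d y)"
    if "s \<in> snd a ` fst a" "y \<in> snd d ` fst d" for s y
    unfolding P'_def by (rule chart_inv_product[OF atlas_GA atlas_Q a d that])
  have imP: "snd P ` fst P = snd a ` fst a \<times> snd c ` fst c" and imP': "snd P' ` fst P' = snd a ` fst a \<times> snd d ` fst d"
    unfolding P_def P'_def by (rule image_product_chart)+
  have gG: "g \<in> carrier G" if "g \<in> fst a" for g
    using mem_pts[OF a that] by (simp add: pts_GA)
  have S_iff: "(s, x) \<in> S \<longleftrightarrow> s \<in> snd a ` fst a \<and> x \<in> snd c ` fst c \<and> \<phi> (chart_inv a s) (chart_inv c x) \<in> fst d" for s x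
    unfolding S_def rep_dom_def imP by (auto simp: invP)
  have opS: "open S" and opS': "open S'"
    unfolding S_def S'_def
    by (rule smooth_map_open[OF prod smooth_action_map P d], rule smooth_map_open[OF prod smooth_inverse_action_map P' c])
  have smY: "smooth_on S Y"
    unfolding S_def Y_def by (rule smooth_map_smooth_on[OF prod smooth_action_map P d])
  have sm\<Psi>: "smooth_on S' \<Psi>"
    unfolding S'_def \<Psi>_def by (rule smooth_map_smooth_on[OF prod smooth_inverse_action_map P' c])
  \<comment> \<open>The covector \<open>A g q\<close> sits over \<open>q\<close> itself, so the
    representative of the cochain is defined on the entire chart.\<close>
  have "rep_dom P ?sec ?K = snd P ` fst P"
    unfolding rep_dom_def imP
    using one_formsD(1)[OF one_form[OF gG] mem_pts[OF c]] chart_inv_mem[of _ a] chart_inv_mem[of _ c]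
    by (auto simp: invP fst_cotangent_chart)
  then have sm\<alpha>: "smooth_on (snd P ` fst P) \<alpha>"
    unfolding \<alpha>_def
    using smooth_on_snd[OF smooth_atlas_open[OF prod P] smooth_map_smooth_on[OF prod smooth_A P K, THEN smooth_on_subset[rotated]]]
    by simp
  have S_sub: "S \<subseteq> snd P ` fst P"
    by (auto simp: S_def rep_dom_def)
  \<comment> \<open>Forgets the fibre coordinate. Whether the image lies in the target chart depends
    on the base point only, so the domain is a preimage under \<open>pr\<close>.\<close>
  define pr where "pr z = (fst z, fst (snd z))" for z :: "'h \<times> 'e \<times> ('e \<Rightarrow>\<^sub>L real)"
  have bl_pr: "bounded_linear pr"
    unfolding pr_def
    by (intro bounded_linear_Pair bounded_linear_fst bounded_linear_compose[OF bounded_linear_fst bounded_linear_snd])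
  have TS: "z \<in> rep_dom C (\<lambda>(g, X). \<Phi> g X) D \<longleftrightarrow> pr z \<in> S" for z
  proof -
    obtain s x p where z: "z = (s, x, p)" by (cases z)
    show ?thesis
    proof (cases "s \<in> snd a ` fst a \<and> x \<in> snd c ` fst c")
      case True
      then have s: "s \<in> snd a ` fst a" and x: "x \<in> snd c ` fst c" by auto
      have zim: "z \<in> snd C ` fst C"
        unfolding C image_product_chart range_cotangent_chart[OF atlas_Q c] z using s x by simp
      have X: "chart_inv C z = (chart_inv a s, chart_inv c x, chart_covec Q c (chart_inv c x) p)"
        unfolding C z using chart_inv_product[OF atlas_GA atlas_TQ a K s, of "(x, p)"] x
        by (simp add: range_cotangent_chart[OF atlas_Q c] chart_inv_cotangent[OF atlas_Q c])
      have g: "chart_inv a s \<in> carrier G" and q: "chart_inv c x \<in> pts Q"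
        by (rule gG[OF chart_inv_mem[OF s]], rule mem_pts[OF c chart_inv_mem[OF x]])
      note \<kappa> = chart_covec_mem[OF atlas_Q, of c "chart_inv c x" p]
      show ?thesis
        using zim s x covec_lift_mem[OF g q covec_add_mem[OF g q \<kappa>]]
        by (simp add: rep_dom_def X[unfolded z] D fst_cotangent_chart twisted_lift_apply[OF q \<kappa>] z pr_def S_iff)
    next
      case False
      then have "z \<notin> snd C ` fst C"
        unfolding C image_product_chart range_cotangent_chart[OF atlas_Q c] z by simp
      with False show ?thesis by (auto simp: rep_dom_def z pr_def S_iff)
    qed
  qed
  define W where "W = pr -` S"
  have dom: "rep_dom C (\<lambda>(g, X). \<Phi> g X) D = W"
    using TS by (auto simp: W_def)
  have opW: "open W"
    unfolding W_def by (rule open_vimage[OF opS]) (rule linear_continuous_on[OF bl_pr])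
  show "open (rep_dom C (\<lambda>(g, X). \<Phi> g X) D)"
    unfolding dom by (rule opW)
  have Wpr: "pr z \<in> S" if "z \<in> W" for z
    using that by (simp add: W_def)
  have sm_pr: "smooth_on W pr"
    using smooth_on_bounded_linear[OF bl_pr opW smooth_on_id] .
  have Y_eq: "Y (s, x) = snd d (\<phi> (chart_inv a s) (chart_inv c x))" if "(s, x) \<in> S" for s x
    using that by (simp add: Y_def S_iff invP)
  \<comment> \<open>The inverse action leads back to the starting point in \<open>c\<close>, so
    \<open>\<Psi>\<close> is defined, hence differentiable, where \<open>L\<close> needs it.\<close>
  have YS': "(fst u, Y u) \<in> S'" if u: "u \<in> S" for u
  proof -
    obtain s x where sx: "u = (s, x)" by (cases u)
    have s: "s \<in> snd a ` fst a" and x: "x \<in> snd c ` fst c" and m: "\<phi> (chart_inv a s) (chart_inv c x) \<in> fst d"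
      using u by (simp_all add: sx S_iff)
    have "\<phi> (inv (chart_inv a s)) (\<phi> (chart_inv a s) (chart_inv c x)) = chart_inv c x"
      by (rule act_inv(1)[OF gG[OF chart_inv_mem[OF s]] mem_pts[OF c chart_inv_mem[OF x]]])
    then show ?thesis
      using s chart_inv_mem[OF x] m unfolding S'_def rep_dom_def imP'
      by (simp add: sx Y_eq[OF u[unfolded sx]] invP' chart_inv_chart[OF atlas_Q d])
  qed
  \<comment> \<open>The direction \<open>(0, w)\<close> keeps the group coordinate fixed; the total
    derivative of \<open>\<Psi>\<close> is used because it is known to be smooth in
    \<open>(s, y)\<close> jointly.\<close>
  define L where "L z w = frechet_derivative \<Psi> (at (fst z, Y (pr z))) (0, w)" for z w
  have smYpr: "smooth_on W (\<lambda>z. Y (pr z))"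
    by (rule smooth_on_compose[OF fin opW opS Wpr sm_pr smY])
  have "smooth_on W (\<lambda>z. (Y (pr z), Blinfun (\<lambda>w. blinfun_apply (snd (snd z) + \<alpha> (pr z)) (L z w))))"
  proof (rule smooth_on_Pair[OF opW smYpr], rule smooth_on_dual_apply[OF finQ opW, where L = L])
    show "smooth_on W (\<lambda>z. snd (snd z) + \<alpha> (pr z))"
    proof (rule smooth_on_add[OF opW smooth_on_snd[OF opW smooth_on_snd[OF opW smooth_on_id]]])
      show "smooth_on W (\<lambda>z. \<alpha> (pr z))"
        by (rule smooth_on_compose[OF fin opW smooth_atlas_open[OF prod P] _ sm_pr sm\<alpha>]) (use Wpr S_sub in blast)
    qed
    have m: "(fst z, Y (pr z)) \<in> S'" if "z \<in> W" for z
      using YS'[OF Wpr[OF that]] by (simp add: pr_def)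
    have sm_sY: "smooth_on W (\<lambda>z. (fst z, Y (pr z)))"
      by (rule smooth_on_Pair[OF opW smooth_on_fst[OF opW smooth_on_id] smYpr])
    show "smooth_on W (\<lambda>z. L z w)" for w
      unfolding L_def
      by (rule smooth_on_compose[OF fin opW opS' m sm_sY smooth_on_frechet_derivative[OF sm\<Psi>]])
    show "linear (L z)" if "z \<in> W" for z
    proof -
      have "linear (\<lambda>w::'e. (0::'h, w))"
        by (rule linearI) auto
      from linear_compose[OF this linear_frechet_derivative'[OF smooth_on_differentiable[OF sm\<Psi> m[OF that]]]]
      show ?thesis by (simp add: L_def[abs_def] comp_def)
    qed
  qed
  then show "smooth_on (rep_dom C (\<lambda>(g, X). \<Phi> g X) D) (snd D \<circ> (\<lambda>(g, X). \<Phi> g X) \<circ> chart_inv C)"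
    unfolding dom
  proof (rule smooth_on_cong[OF opW, rotated])
    fix z assume z: "z \<in> W"
    obtain s x p where sxp: "z = (s, x, p)" by (cases z)
    have sxS: "(s, x) \<in> S" using Wpr[OF z] by (simp add: sxp pr_def)
    then have s: "s \<in> snd a ` fst a" and x: "x \<in> snd c ` fst c" and m: "\<phi> (chart_inv a s) (chart_inv c x) \<in> fst d"
      by (simp_all add: S_iff)
    define g where "g = chart_inv a s"
    define q where "q = chart_inv c x"
    define \<kappa> where "\<kappa> = chart_covec Q c q p"
    have g: "g \<in> carrier G" and q: "q \<in> pts Q"
      unfolding g_def q_def by (rule gG[OF chart_inv_mem[OF s]], rule mem_pts[OF c chart_inv_mem[OF x]])
    have \<kappa>: "\<kappa> \<in> cotangent_space Q q"
      unfolding \<kappa>_def by (rule chart_covec_mem[OF atlas_Q])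
    have X: "chart_inv C z = (g, q, \<kappa>)"
      unfolding C sxp using chart_inv_product[OF atlas_GA atlas_TQ a K s, of "(x, p)"] x
      by (simp add: range_cotangent_chart[OF atlas_Q c] chart_inv_cotangent[OF atlas_Q c] g_def q_def \<kappa>_def)
    have cq: "c \<in> charts_at Q q"
      unfolding q_def by (rule charts_atI[OF c chart_inv_mem[OF x]])
    have cq': "c \<in> charts_at Q (\<phi> (inv g) (\<phi> g q))"
      using cq by (simp add: act_inv(1)[OF g q])
    have dgq: "d \<in> charts_at Q (\<phi> g q)"
      unfolding g_def q_def by (rule charts_atI[OF d m])
    have Yz: "Y (pr z) = snd d (\<phi> g q)"
      using Y_eq[OF sxS] by (simp add: pr_def sxp g_def q_def)
    have ig: "inv g \<in> carrier G" using g by simp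
    \<comment> \<open>With \<open>s\<close> frozen, \<open>\<Psi>\<close> is the local
      representative of \<open>\<phi> (inv g)\<close>, so the partial derivative is the Jacobian
      occurring in the cotangent lift.\<close>
    have L_eq: "chart_deriv (\<phi> (inv g)) d c (\<phi> g q) = L z"
    proof -
      have "((\<lambda>y. \<Psi> (s, y)) has_derivative (\<lambda>w. L z w)) (at (snd d (\<phi> g q)))"
        using has_derivative_partial[OF smooth_on_differentiable[OF sm\<Psi> YS'[OF sxS]]] Yz
        by (simp add: L_def pr_def sxp)
      then have "(snd c \<circ> \<phi> (inv g) \<circ> chart_inv d has_derivative (\<lambda>w. L z w)) (at (snd d (\<phi> g q)))"
      proof (rule has_derivative_transform_within_open[OF _ smooth_atlas_open[OF atlas_Q d]])
        show "snd d (\<phi> g q) \<in> snd d ` fst d"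
          using charts_atD(2)[OF dgq] by simp
        show "\<Psi> (s, y) = (snd c \<circ> \<phi> (inv g) \<circ> chart_inv d) y" if "y \<in> snd d ` fst d" for y
          by (simp add: \<Psi>_def invP'[OF s that] g_def)
      qed
      then show ?thesis
        unfolding chart_deriv_def by (simp add: frechet_derivative_eq)
    qed
    have \<alpha>_app: "blinfun_apply (\<alpha> (s, x)) w = A g q (tangent_of_chart Q c q w)" for w
      using bounded_linear_Blinfun_apply[OF bounded_linear_covec_chart[OF atlas_Q cq one_formsD(1)[OF one_form[OF g] q]]]
      by (simp add: \<alpha>_def invP[OF s x] snd_cotangent_chart g_def q_def)
    have "covec_lift g q (\<lambda>v. \<kappa> v + A g q v) (tangent_of_chart Q d (\<phi> g q) w)
        = blinfun_apply (snd (snd z) + \<alpha> (pr z)) (L z w)" for w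
    proof -
      have "tangent_map Q Q (\<phi> (inv g)) (\<phi> g q) (tangent_of_chart Q d (\<phi> g q) w) = tangent_of_chart Q c q (L z w)"
        using tangent_map_of_chart[OF atlas_Q atlas_Q smooth_act[OF ig] dgq cq', of w]
        by (simp add: act_inv(1)[OF g q] L_eq)
      then show ?thesis
        using tangent_of_chart_mem[OF atlas_Q dgq]
        by (simp add: covec_lift_def \<kappa>_def chart_covec_tangent_of_chart[OF atlas_Q cq cq]
            chart_deriv_id_self[OF atlas_Q cq] sxp pr_def \<alpha>_app blinfun.add_left)
    qed
    then show "(Y (pr z), Blinfun (\<lambda>w. blinfun_apply (snd (snd z) + \<alpha> (pr z)) (L z w)))
        = (snd D \<circ> (\<lambda>(g, X). \<Phi> g X) \<circ> chart_inv C) z"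
      by (simp add: X D twisted_lift_apply[OF q \<kappa>] snd_cotangent_chart Yz)
  qed
qed

section \<open>The Liouville form and the symplectic condition\<close>

lemma smooth_twisted_lift_at:
  assumes "g \<in> carrier G"
  shows "smooth_map TQ TQ (\<Phi> g)"
  using smooth_map_compose[OF atlas_TQ smooth_atlas_product[OF atlas_GA atlas_TQ]
      smooth_map_insert[OF atlas_TQ assms] smooth_twisted_lift]
  by (simp add: comp_def)

text \<open>The lifted action preserves the Liouville form, and translation by \<open>A g\<close> adds the
  pullback of \<open>A g\<close> to it.\<close>

lemma pullback_liouville:
  assumes g: "g \<in> carrier G"
  shows "pullback1 TQ TQ (\<Phi> g) (liouville_form Q)
    = (\<lambda>X V. liouville_form Q X V + pullback1 TQ Q fst (A g) X V)"
proof (intro ext)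
  fix X V
  note fst_smooth = smooth_map_cotangent_fst[OF atlas_Q]
  show "pullback1 TQ TQ (\<Phi> g) (liouville_form Q) X V
      = liouville_form Q X V + pullback1 TQ Q fst (A g) X V"
  proof (cases "X \<in> pts TQ \<and> V \<in> tangent_space TQ X")
    case True
    then have X: "X \<in> pts TQ" and V: "V \<in> tangent_space TQ X" by auto
    obtain q \<gamma> where X': "X = (q, \<gamma>)" and q: "q \<in> pts Q" and \<gamma>: "\<gamma> \<in> cotangent_space Q q"
      using X by (auto simp: pts_cotangent_bundle)
    define u where "u = tangent_map TQ Q fst X V"
    have u: "u \<in> tangent_space Q q"
      using tangent_map_mem[OF atlas_TQ atlas_Q fst_smooth X, of V] by (simp add: u_def X')
    have "tangent_map TQ Q fst (\<Phi> g X) (tangent_map TQ TQ (\<Phi> g) X V) = tangent_map TQ Q (fst \<circ> \<Phi> g) X V"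
      by (rule tangent_map_compose[OF atlas_TQ atlas_TQ smooth_twisted_lift_at[OF g] fst_smooth X, symmetric])
    \<comment> \<open>The lift covers the action: \<open>fst o \<Phi> g\<close> and
      \<open>\<phi> g o fst\<close> agree on the points of the bundle.\<close>
    also have "\<dots> = tangent_map TQ Q (\<phi> g \<circ> fst) X V"
      by (rule tangent_map_cong[OF atlas_TQ smooth_map_compose[OF atlas_TQ atlas_TQ smooth_twisted_lift_at[OF g] fst_smooth] _ X])
        (auto simp: pts_cotangent_bundle twisted_lift_apply)
    also have "\<dots> = tangent_map Q Q (\<phi> g) q u"
      using tangent_map_compose[OF atlas_TQ atlas_Q fst_smooth smooth_act[OF g] X, of V] by (simp add: u_def X')
    finally have T: "tangent_map TQ Q fst (\<Phi> g X) (tangent_map TQ TQ (\<Phi> g) X V) = tangent_map Q Q (\<phi> g) q u" .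
    have "pullback1 TQ TQ (\<Phi> g) (liouville_form Q) X V
        = snd (\<Phi> g X) (tangent_map Q Q (\<phi> g) q u)"
      using X V twisted_lift_mem[OF g X] tangent_map_mem[OF atlas_TQ atlas_TQ smooth_twisted_lift_at[OF g] X]
      by (simp add: pullback1_def liouville_form_def T)
    \<comment> \<open>The lifted covector first applies the tangent map of
      \<open>\<phi> (inv g)\<close>, which undoes that of \<open>\<phi> g\<close>.\<close>
    also have "\<dots> = \<gamma> u + A g q u"
      using tangent_act_mem[OF g q] by (simp add: X' twisted_lift_apply[OF q \<gamma>] covec_lift_def tangent_act_inv[OF g q u])
    also have "\<dots> = liouville_form Q X V + pullback1 TQ Q fst (A g) X V"
      using X V by (simp add: liouville_form_def pullback1_def u_def X')
    finally show ?thesis .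
  qed (auto simp: pullback1_def liouville_form_def)
qed

text \<open>For the nontrivial direction, a tangent vector \<open>u\<close> at \<open>q\<close> is
  lifted to the zero covector over \<open>q\<close> by giving it the components
  \<open>(u c, 0)\<close> in an induced chart; the projection sends this lift back to
  \<open>u\<close>.\<close>

lemma pullback2_fst_eq_0_iff:
  "pullback2 TQ Q fst (ext_deriv Q \<beta>) = (\<lambda>X u v. 0) \<longleftrightarrow> closed_form Q \<beta>"
proof
  assume zero: "pullback2 TQ Q fst (ext_deriv Q \<beta>) = (\<lambda>X u v. 0)"
  have "ext_deriv Q \<beta> q u v = 0" for q u v
  proof (cases "q \<in> pts Q \<and> u \<in> tangent_space Q q \<and> v \<in> tangent_space Q q")
    case True
    then have q: "q \<in> pts Q" and u: "u \<in> tangent_space Q q" and v: "v \<in> tangent_space Q q" by auto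
    let ?c = "some_chart Q q" and ?X = "(q, \<lambda>v::('q, 'e) tvec. 0::real)"
    note c = some_chart_mem[OF q] and z = cotangent_space_zero[of Q q]
    note CX = cotangent_charts_atI[OF c z]
    define lift where "lift u = tangent_of_chart TQ (cotangent_chart Q ?c) ?X (u ?c, 0)" for u
    have lift: "lift u \<in> tangent_space TQ ?X" for u
      unfolding lift_def by (rule tangent_of_chart_mem[OF atlas_TQ CX])
    have T: "tangent_map TQ Q fst ?X (lift u) = u" if "u \<in> tangent_space Q q" for u
      using tangent_map_of_chart[OF atlas_TQ atlas_Q smooth_map_cotangent_fst[OF atlas_Q] CX, of ?c "(u ?c, 0)"]
        tangent_of_chart_self[OF that c] c
      by (simp add: lift_def chart_deriv_cotangent_fst[OF atlas_Q c z])
    have "pullback2 TQ Q fst (ext_deriv Q \<beta>) ?X (lift u) (lift v) = ext_deriv Q \<beta> q u v"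
      using lift T[OF u] T[OF v] charts_at_pts[OF CX] by (simp add: pullback2_def)
    then show ?thesis by (simp add: zero)
  qed (auto simp: ext_deriv_def)
  then show "closed_form Q \<beta>" by (simp add: closed_form_def fun_eq_iff)
qed (simp add: closed_form_def pullback2_def fun_eq_iff)

lemma symplectic_iff_closed:
  assumes g: "g \<in> carrier G"
  shows "pullback2 TQ TQ (\<Phi> g) (canonical_symplectic_form Q) = canonical_symplectic_form Q
    \<longleftrightarrow> closed_form Q (A g)"
proof -
  let ?\<theta> = "liouville_form Q"
  note fst_smooth = smooth_map_cotangent_fst[OF atlas_Q]
  note \<theta> = differentiable_form_liouville[OF atlas_Q]
  note A = differentiable_form_one_forms[OF atlas_Q one_form[OF g]]
  have "pullback2 TQ TQ (\<Phi> g) (ext_deriv TQ ?\<theta>) = ext_deriv TQ (\<lambda>X V. ?\<theta> X V + pullback1 TQ Q fst (A g) X V)"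
    unfolding pullback_liouville[OF g, symmetric]
    by (rule ext_deriv_pullback[OF atlas_TQ atlas_TQ smooth_twisted_lift_at[OF g] \<theta>, symmetric])
  also have "\<dots> = (\<lambda>X u v. ext_deriv TQ ?\<theta> X u v + ext_deriv TQ (pullback1 TQ Q fst (A g)) X u v)"
    by (intro ext_deriv_add form_rep_differentiable[OF atlas_TQ _ \<theta>]
        form_rep_pullback_differentiable[OF atlas_TQ atlas_Q fst_smooth A])
  also have "ext_deriv TQ (pullback1 TQ Q fst (A g)) = pullback2 TQ Q fst (ext_deriv Q (A g))"
    by (rule ext_deriv_pullback[OF atlas_TQ atlas_Q fst_smooth A])
  finally have "pullback2 TQ TQ (\<Phi> g) (ext_deriv TQ ?\<theta>) X u v
      = ext_deriv TQ ?\<theta> X u v + pullback2 TQ Q fst (ext_deriv Q (A g)) X u v" for X u v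
    by simp
  moreover have "pullback2 TQ TQ (\<Phi> g) (canonical_symplectic_form Q) X u v
      = - pullback2 TQ TQ (\<Phi> g) (ext_deriv TQ ?\<theta>) X u v" for X u v
    by (simp add: pullback2_def canonical_symplectic_form_def)
  ultimately have "pullback2 TQ TQ (\<Phi> g) (canonical_symplectic_form Q) = canonical_symplectic_form Q
      \<longleftrightarrow> pullback2 TQ Q fst (ext_deriv Q (A g)) = (\<lambda>X u v. 0)"
    by (simp add: fun_eq_iff canonical_symplectic_form_def)
  then show ?thesis
    by (simp add: pullback2_fst_eq_0_iff)
qed

end

theorem theorem2p3:
  fixes G :: "('g, 'm) monoid_scheme"
    and GA :: "('g, 'h::real_normed_vector) atlas"
    and Q :: "('q, 'e::real_normed_vector) atlas"
    and \<phi> :: "'g \<Rightarrow> 'q \<Rightarrow> 'q"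
    and A :: "'g \<Rightarrow> ('q, 'e) form1"
  assumes "lie_group G GA"
    and "manifold Q"
    and "smooth_action G GA Q \<phi>"
    and "\<forall>g\<in>carrier G. A g \<in> one_forms Q"
    and "smooth_map (product_atlas GA Q) (cotangent_bundle Q) (\<lambda>(g, q). (q, A g q))"
  shows "(smooth_action G GA (cotangent_bundle Q) (twisted_lift G Q \<phi> A) \<longleftrightarrow>
            one_cocycle G Q \<phi> (one_forms Q) A) \<and>
         (smooth_action G GA (cotangent_bundle Q) (twisted_lift G Q \<phi> A) \<longrightarrow>
            (symplectic_action G Q (twisted_lift G Q \<phi> A) \<longleftrightarrow>
               (\<forall>g\<in>carrier G. closed_form Q (A g))) \<and>
            ((\<forall>g\<in>carrier G. closed_form Q (A g)) \<longleftrightarrow>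
               one_cocycle G Q \<phi> (closed_one_forms Q) A))"
proof -
  interpret cochain_action G GA Q \<phi> A
    using assms by unfold_locales simp_all
  \<comment> \<open>The smoothness half of \<open>smooth_action\<close> holds for every cochain, so
    the equivalence reduces to the algebraic half.\<close>
  have action_iff: "smooth_action G GA TQ \<Phi> \<longleftrightarrow> one_cocycle G Q \<phi> (one_forms Q) A"
    by (simp add: smooth_action_def smooth_twisted_lift group_action_iff_one_cocycle)
  have "symplectic_action G Q \<Phi> \<longleftrightarrow> (\<forall>g\<in>carrier G. closed_form Q (A g))"
    by (simp add: symplectic_action_def symplectic_iff_closed)
  \<comment> \<open>Given the cocycle identity, passing to the subcomplex only changes the space in
    which the values \<open>A g\<close> must lie.\<close>
  moreover have "(\<forall>g\<in>carrier G. closed_form Q (A g)) \<longleftrightarrow> one_cocycle G Q \<phi> (closed_one_forms Q) A"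
    if "one_cocycle G Q \<phi> (one_forms Q) A"
    using that by (auto simp: one_cocycle_iff closed_one_forms_def)
  ultimately show ?thesis
    using action_iff by blast
qed

end
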